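(* There is a constant $c>0$ such that the following holds. Let $G$ be an Eulerian solid subgraph of the triangular lattice with $f$ bounded faces, and let $\mathcal{M}_T$ be the tower-moves Markov chain on the set $EO(G)$ of Eulerian orientations of $G$, with tower-reversal probability $p_T = \frac{1}{3h}$ for every tower $T$ of length $h$. Then $\mathcal{M}_T$ is rapidly mixing, with mixing time $$\tau_{\mathcal{M}_T}(\epsilon) \le c\, f^4 \log \epsilon^{-1}$$ for all $0<\epsilon<1$, i.e. $\tau_{\mathcal{M}_T}(\epsilon) \in O(f^4 \log \epsilon^{-1})$.
   Context: The triangular lattice is the infinite plane graph with vertex set $\{v_{i,j} : i,j\in\mathbb{Z}\}$ and edges $\{v_{i,j},v_{i+1,j}\}$, $\{v_{i,j},v_{i,j+1}\}$, $\{v_{i,j},v_{i+1,j-1}\}$, with its standard planar embedding in which every bounded face is a triangle. A solid subgraph of the triangular lattice is obtained by choosing a cycle in the lattice as boundary and taking this cycle together with all vertices and edges in its interior. A graph is Eulerian if every vertex has even degree. An Eulerian orientation is an orientation of the edges such that every vertex has in-degree equal to out-degree; $EO(G)$ is the set of these. A bounded face is directed in an orientation if its boundary edges form a directed cycle. A face is almost-directed if all but one of its boundary edges have a common direction around the face; the disagreeing edge is its blocking edge. A tower of length $h$ in an orientation $\sigma$, starting at $F_1$ and ending at $F_h$, is a sequence of bounded faces $F_1,\dots,F_h$, consecutive ones sharing an edge, such that for $1\le i\le h-1$ the face $F_i$ is almost-directed in $\sigma$ with blocking edge the edge shared with $F_{i+1}$, and $F_h$ is directed in $\sigma$. Then the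 symmetric difference $C=\bigoplus_{i} E(F_i)$ of the edge sets of the faces is a directed cycle. One step of the tower-moves chain $\mathcal{M}_T$ from state $X$: with probability $1/2$ set $X'=X$. Otherwise choose a bounded face $F$ uniformly at random. If $F$ is directed, obtain $X'$ by reversing all edges of $F$. Otherwise, if there is a tower $T=(F_1,\dots,F_h)$ with $F_1=F$, then with probability $p_T$ obtain $X'$ by reversing all edges of $C=\bigoplus_i E(F_i)$, and otherwise set $X'=X$. In all remaining cases set $X'=X$. This chain is ergodic with uniform stationary distribution $\pi$ on $EO(G)$. The mixing time is $\tau(\epsilon)=\max_{x}\min\{t : \|P^t(x,\cdot)-\pi\|_{TV}\le \epsilon\}$, where $\|\rho-\mu\|_{TV}=\sup_A|\rho(A)-\mu(A)|$. Here $f$ denotes the number of bounded faces of $G$.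
   Formalization: The bound is proved as c f^4 ⌈ln(1/ε)⌉ instead of c f^4 log ε^{-1}: with one constant for all 0<ε<1 the literal bound fails as ε→1 (large lattice triangles, ε = 1−2/|EO(G)|, where τ ≥ 1); for ε ≤ ε₀ < 1 the two agree up to the constant. *)

theory Defs
  imports "HOL-Probability.Probability"
begin

type_synonym vertex = "int \<times> int"
type_synonym edge = "vertex set"
type_synonym arc = "vertex \<times> vertex"


text \<open>The triangular lattice and its straight-line embedding by unit equilateral triangles.\<close>

definition lattice_edges :: "edge set" where
  "lattice_edges =
     (\<Union>i j. {{(i, j), (i + 1, j)}, {(i, j), (i, j + 1)}, {(i, j), (i + 1, j - 1)}})"

definition embed :: "vertex \<Rightarrow> complex" where
  "embed v = of_int (fst v) + of_int (snd v) * cis (pi / 3)"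

definition edge_curve :: "edge \<Rightarrow> complex set" where
  "edge_curve e = convex hull (embed ` e)"

definition drawing :: "vertex set \<Rightarrow> edge set \<Rightarrow> complex set" where
  "drawing V E = embed ` V \<union> (\<Union>e\<in>E. edge_curve e)"


definition cycle_arcs :: "vertex list \<Rightarrow> arc set" where
  "cycle_arcs vs = {(vs ! i, vs ! (Suc i mod length vs)) | i. i < length vs}"

definition directed_cycle :: "arc set \<Rightarrow> bool" where
  "directed_cycle D \<longleftrightarrow> (\<exists>vs. 3 \<le> length vs \<and> distinct vs \<and> D = cycle_arcs vs)"

definition arc_edges :: "arc set \<Rightarrow> edge set" where
  "arc_edges D = {{u, v} | u v. (u, v) \<in> D}"

definition lattice_cycle :: "edge set \<Rightarrow> bool" where
  "lattice_cycle B \<longleftrightarrow> B \<subseteq> lattice_edges \<and> (\<exists>D. directed_cycle D \<and> B = arc_edges D)"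

text \<open>
  An edge lies in the interior of the boundary cycle if the open segment representing it does,
  so chords joining two boundary vertices through the interior are included.
\<close>

definition solid_subgraph :: "vertex set \<Rightarrow> edge set \<Rightarrow> bool" where
  "solid_subgraph V E \<longleftrightarrow>
     (\<exists>B. lattice_cycle B \<and>
        V = \<Union>B \<union> {v. embed v \<in> inside (drawing (\<Union>B) B)} \<and>
        E = B \<union> {e \<in> lattice_edges. edge_curve e - embed ` e \<subseteq> inside (drawing (\<Union>B) B)})"

definition eulerian :: "vertex set \<Rightarrow> edge set \<Rightarrow> bool" where
  "eulerian V E \<longleftrightarrow> (\<forall>v\<in>V. even (card {e \<in> E. v \<in> e}))"


definition orientation :: "edge set \<Rightarrow> arc set \<Rightarrow> bool" where
  "orientation E X \<longleftrightarrow>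
     arc_edges X = E \<and> (\<forall>u v. (u, v) \<in> X \<longrightarrow> (v, u) \<notin> X)"

definition EO :: "vertex set \<Rightarrow> edge set \<Rightarrow> arc set set" where
  "EO V E =
     {X. orientation E X \<and> (\<forall>v\<in>V. card {u. (u, v) \<in> X} = card {w. (v, w) \<in> X})}"

definition reverse_edges :: "edge set \<Rightarrow> arc set \<Rightarrow> arc set" where
  "reverse_edges C X = {(u, v). if {u, v} \<in> C then (v, u) \<in> X else (u, v) \<in> X}"


definition bounded_faces :: "vertex set \<Rightarrow> edge set \<Rightarrow> complex set set" where
  "bounded_faces V E = {F \<in> components (- drawing V E). bounded F}"

definition face_edges :: "edge set \<Rightarrow> complex set \<Rightarrow> edge set" where
  "face_edges E F = {e \<in> E. edge_curve e \<subseteq> frontier F}"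

definition directed_face :: "edge set \<Rightarrow> arc set \<Rightarrow> complex set \<Rightarrow> bool" where
  "directed_face E X F \<longleftrightarrow>
     (\<exists>D. directed_cycle D \<and> arc_edges D = face_edges E F \<and> D \<subseteq> X)"

text \<open>
  The cycle \<open>D\<close> is one of the two ways of going around \<open>F\<close>: all boundary edges follow it
  except for \<open>e\<close>, which is traversed backwards.
\<close>

definition blocking_edge :: "edge set \<Rightarrow> arc set \<Rightarrow> complex set \<Rightarrow> edge \<Rightarrow> bool" where
  "blocking_edge E X F e \<longleftrightarrow>
     (\<exists>D u v. directed_cycle D \<and> arc_edges D = face_edges E F \<and>
        (u, v) \<in> D \<and> e = {u, v} \<and> (v, u) \<in> X \<and> D - {(u, v)} \<subseteq> X)"

definition tower :: "vertex set \<Rightarrow> edge set \<Rightarrow> arc set \<Rightarrow> complex set list \<Rightarrow> bool" where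
  "tower V E X T \<longleftrightarrow>
     T \<noteq> [] \<and> set T \<subseteq> bounded_faces V E \<and>
     (\<forall>i. Suc i < length T \<longrightarrow>
        (\<exists>e. face_edges E (T ! i) \<inter> face_edges E (T ! Suc i) = {e} \<and>
             blocking_edge E X (T ! i) e)) \<and>
     directed_face E X (last T)"

definition tower_cycle :: "edge set \<Rightarrow> complex set list \<Rightarrow> edge set" where
  "tower_cycle E T = foldr (\<lambda>F C. sym_diff (face_edges E F) C) T {}"


text \<open>
  A non-directed triangle has exactly one blocking edge, so there is at most one tower
  starting at a given face and the choice below is from a singleton.
\<close>

definition tower_move ::
  "vertex set \<Rightarrow> edge set \<Rightarrow> (complex set list \<Rightarrow> real) \<Rightarrow> arc set \<Rightarrow> complex set \<Rightarrow> arc set pmf"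
where
  "tower_move V E p X F =
     (if directed_face E X F then return_pmf (reverse_edges (face_edges E F) X)
      else if \<exists>T. tower V E X T \<and> hd T = F then
        (let T = (SOME T. tower V E X T \<and> hd T = F)
         in map_pmf (\<lambda>b. if b then reverse_edges (tower_cycle E T) X else X)
              (bernoulli_pmf (p T)))
      else return_pmf X)"

definition tower_chain ::
  "vertex set \<Rightarrow> edge set \<Rightarrow> (complex set list \<Rightarrow> real) \<Rightarrow> arc set \<Rightarrow> arc set pmf"
where
  "tower_chain V E p X =
     bind_pmf (bernoulli_pmf (1 / 2)) (\<lambda>stay.
       if stay then return_pmf X
       else bind_pmf (pmf_of_set (bounded_faces V E)) (tower_move V E p X))"


definition tv_dist :: "'a pmf \<Rightarrow> 'a pmf \<Rightarrow> real" where
  "tv_dist \<rho> \<mu> = (SUP A. \<bar>measure_pmf.prob \<rho> A - measure_pmf.prob \<mu> A\<bar>)"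

primrec steps :: "('a \<Rightarrow> 'a pmf) \<Rightarrow> nat \<Rightarrow> 'a \<Rightarrow> 'a pmf" where
  "steps K 0 x = return_pmf x"
| "steps K (Suc t) x = bind_pmf (steps K t x) K"

text \<open>The value is \<open>\<infinity>\<close> if from some state the distance never drops to \<open>\<epsilon>\<close>.\<close>

definition mixing_time :: "'a set \<Rightarrow> ('a \<Rightarrow> 'a pmf) \<Rightarrow> 'a pmf \<Rightarrow> real \<Rightarrow> enat" where
  "mixing_time S K \<pi> \<epsilon> = (SUP x\<in>S. INF t\<in>{t. tv_dist (steps K t x) \<pi> \<le> \<epsilon>}. enat t)"

end

theory Submission
  imports Defs
begin

text \<open>
  Record an Eulerian orientation by the height function on the triangles of the lattice that drops
  by one from the left to the right of every arc and vanishes outside \<open>G\<close>. Directed faces are the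
  local extrema of the heights, a tower is a steepest monotone path ending in a local extremum, and
  reversing it changes the heights of its faces by 2. Replacing the lazy coin by an up/down coin
  turns the chain into a random map that is monotone in the heights.

  For \<open>X \<le> Y\<close> let \<open>Z\<close> be half the total height difference. Since a tower of length \<open>h \<ge> 2\<close> is reversed
  with probability \<open>1/(3h)\<close>, its expected contribution to \<open>Z\<close> is \<open>\<plusminus>1/3\<close>, whatever its length; comparing
  two states that differ in one face shows that \<open>Z\<close> is a supermartingale. Two distinct comparable
  states always have towers of different lengths at some face, so the mean square step of \<open>Z\<close>
  is at least \<open>1/(6f)\<close>. As \<open>Z\<close> is at most \<open>4 * f^(3/2)\<close>, the two copies meet within \<open>O(f^4)\<close> steps.
\<close>

section \<open>Random maps and coalescence\<close>

text \<open>The probability 1/(3h) is dictated by the drift. Let X and Y differ in one face F only.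
  Summed over both values of the up/down coin, F adds -2 to the drift of Z, and each of its three
  neighbours adds at most 2/3: the extreme case is a tower that steps into F (worth 1/3) and shrinks
  to a local extremum (worth 1). The obstacle is that raising F can affect towers further away;
  since heights must close up around every lattice vertex, new ones start only at neighbours of F or
  at faces pointing to such a neighbour.

  A drift of 0 does not force Z down. The concave potential 2DZ - Z^2, where D = 4 * f^(3/2) bounds
  Z, loses on average at least the mean square step, so 1/(6f) per step until the copies meet, and
  it is at most D^2 = 16 * f^3. The bound D comes from area: a height difference of 2m at a face
  shrinks by at most 2 per crossing, so it needs about (m/4)^2 faces. States that are not comparable
  are coupled through their pointwise maximum.\<close>

locale random_map =
  fixes W :: "'w set" and act :: "'w \<Rightarrow> 's \<Rightarrow> 's" and Om :: "'s set"
  assumes finite_W: "finite W" and W_nonempty: "W \<noteq> {}"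
    and finite_Om: "finite Om" and Om_nonempty: "Om \<noteq> {}"
    and act_closed: "w \<in> W \<Longrightarrow> x \<in> Om \<Longrightarrow> act w x \<in> Om"
begin

definition avg :: "('w \<Rightarrow> real) \<Rightarrow> real" where
  "avg g = (\<Sum>w\<in>W. g w) / real (card W)"

definition kernel :: "'s \<Rightarrow> 's pmf" where
  "kernel x = map_pmf (\<lambda>w. act w x) (pmf_of_set W)"

text \<open>The probability that two copies started in \<open>x\<close> and \<open>y\<close> and
  driven by the same seeds still differ after \<open>t\<close> steps.\<close>

primrec sep :: "nat \<Rightarrow> 's \<Rightarrow> 's \<Rightarrow> real" where
  "sep 0 x y = of_bool (x \<noteq> y)"
| "sep (Suc t) x y = avg (\<lambda>w. sep t (act w x) (act w y))"

lemma card_W_pos: "0 < real (card W)"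
  using finite_W W_nonempty by (simp add: card_gt_0_iff)

lemma avg_mono: "(\<And>w. w \<in> W \<Longrightarrow> g w \<le> h w) \<Longrightarrow> avg g \<le> avg h"
  unfolding avg_def by (intro divide_right_mono sum_mono) auto

lemma avg_const [simp]: "avg (\<lambda>w. c) = c"
  using card_W_pos by (simp add: avg_def)

lemma avg_cmult: "avg (\<lambda>w. c * g w) = c * avg g"
  by (simp add: avg_def sum_distrib_left[symmetric])

lemma avg_diff: "avg (\<lambda>w. g w - h w) = avg g - avg h"
  by (simp add: avg_def sum_subtractf diff_divide_distrib)

lemma avg_add: "avg (\<lambda>w. g w + h w) = avg g + avg h"
  by (simp add: avg_def sum.distrib add_divide_distrib)

lemma abs_avg_le: "\<bar>avg g\<bar> \<le> avg (\<lambda>w. \<bar>g w\<bar>)"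
  unfolding avg_def by (simp add: abs_divide divide_right_mono sum_abs)

lemma sep_refl [simp]: "sep t x x = 0"
  by (induction t arbitrary: x) auto

lemma sep_le_neq: "sep t x y \<le> of_bool (x \<noteq> y)"
proof (induction t arbitrary: x y)
  case (Suc t)
  show ?case
  proof (cases "x = y")
    case False
    have "avg (\<lambda>w. sep t (act w x) (act w y)) \<le> avg (\<lambda>w. 1)"
      by (intro avg_mono order_trans[OF Suc.IH]) auto
    then show ?thesis using False by simp
  qed (simp only: sep_refl, simp)
qed simp

text \<open>If the copies from \<open>x\<close> and \<open>z\<close> differ, the copy from
  \<open>y\<close> differs from one of them. This lets states that are not comparable be treated
  through an intermediate state.\<close>

lemma sep_triangle: "sep t x z \<le> sep t x y + sep t y z"
proof (induction t arbitrary: x y z)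
  case (Suc t)
  have "sep (Suc t) x z \<le> avg (\<lambda>w. sep t (act w x) (act w y) + sep t (act w y) (act w z))"
    unfolding sep.simps by (intro avg_mono Suc.IH)
  then show ?case by (simp add: avg_add)
qed auto

lemma sep_sym: "sep t x y = sep t y x"
  by (induction t arbitrary: x y) auto

text \<open>Split at time \<open>s\<close>: pairs that have met stay together, and all others still
  differ \<open>t\<close> steps later with probability at most \<open>c\<close>.\<close>

lemma sep_add_le:
  assumes "\<And>x y. x \<in> Om \<Longrightarrow> y \<in> Om \<Longrightarrow> sep t x y \<le> c" "x \<in> Om" "y \<in> Om"
  shows "sep (s + t) x y \<le> c * sep s x y"
  using assms(2,3)
proof (induction s arbitrary: x y)
  case 0
  then show ?case using assms(1) by (cases "x = y") auto
next
  case (Suc s)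
  have "sep (Suc s + t) x y \<le> avg (\<lambda>w. c * sep s (act w x) (act w y))"
    unfolding add_Suc sep.simps by (intro avg_mono Suc.IH act_closed Suc.prems)
  then show ?case by (simp add: avg_cmult)
qed

lemma sep_mult_le:
  assumes "\<And>x y. x \<in> Om \<Longrightarrow> y \<in> Om \<Longrightarrow> sep t x y \<le> c" "0 \<le> c" "x \<in> Om" "y \<in> Om"
  shows "sep (k * t) x y \<le> c ^ k"
proof (induction k)
  case 0
  then show ?case using sep_le_neq[of 0 x y] by (simp add: of_bool_def)
next
  case (Suc k)
  have "sep (Suc k * t) x y \<le> c * sep (k * t) x y"
    using sep_add_le[of t c x y "k * t"] assms by (simp add: add.commute)
  also have "\<dots> \<le> c * c ^ k" using Suc assms(2) by (rule mult_left_mono)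
  finally show ?case by simp
qed

text \<open>Each step before the meeting lowers the potential by \<open>\<alpha>\<close> on average,
  and the probability of not having met only decreases, so \<open>t\<close> steps cost at least
  \<open>\<alpha> * t * sep t x y\<close>; the potential cannot go below 0.\<close>

lemma sep_le_potential:
  assumes R: "\<And>w x y. w \<in> W \<Longrightarrow> R x y \<Longrightarrow> R (act w x) (act w y)"
    and nonneg: "\<And>x y. R x y \<Longrightarrow> 0 \<le> \<phi> x y"
    and drop: "\<And>x y. R x y \<Longrightarrow> avg (\<lambda>w. \<phi> (act w x) (act w y)) \<le> \<phi> x y - \<alpha> * of_bool (x \<noteq> y)"
    and "0 \<le> \<alpha>" "R x y"
  shows "\<alpha> * real t * sep t x y \<le> \<phi> x y"
  using assms(5)
proof (induction t arbitrary: x y)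
  case 0
  then show ?case using nonneg by simp
next
  case (Suc t)
  have "\<alpha> * real t * sep (Suc t) x y = avg (\<lambda>w. \<alpha> * real t * sep t (act w x) (act w y))"
    by (simp add: avg_cmult)
  also have "\<dots> \<le> avg (\<lambda>w. \<phi> (act w x) (act w y))"
    by (intro avg_mono Suc.IH R Suc.prems)
  also have "\<dots> \<le> \<phi> x y - \<alpha> * of_bool (x \<noteq> y)" by (rule drop[OF Suc.prems])
  also have "\<dots> \<le> \<phi> x y - \<alpha> * sep (Suc t) x y"
    using sep_le_neq[of "Suc t" x y] \<open>0 \<le> \<alpha>\<close> by (intro diff_left_mono mult_left_mono) auto
  finally show ?case by (simp add: algebra_simps)
qed

lemma steps_0: "steps K 0 = return_pmf"
  by (rule ext) simp

text \<open>\<open>steps\<close> appends its steps at the end, whereas \<open>sep\<close> peels off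
  the first one.\<close>

lemma steps_Suc_front: "steps K (Suc t) x = bind_pmf (K x) (\<lambda>y. steps K t y)"
proof (induction t arbitrary: x)
  case (Suc t)
  have "steps K (Suc (Suc t)) x = bind_pmf (bind_pmf (K x) (\<lambda>y. steps K t y)) K"
    by (subst steps.simps) (simp only: Suc.IH)
  then show ?case by (simp add: bind_assoc_pmf)
qed (simp add: bind_return_pmf bind_return_pmf' steps_0)

section \<open>From coupling to total variation distance\<close>

lemma prob_steps_Suc:
  "measure_pmf.prob (steps kernel (Suc t) x) A
     = avg (\<lambda>w. measure_pmf.prob (steps kernel t (act w x)) A)"
proof -
  have "measure_pmf.prob (steps kernel (Suc t) x) A
      = measure_pmf.expectation (kernel x) (\<lambda>y. measure_pmf.prob (steps kernel t y) A)"
    unfolding steps_Suc_front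
    by (subst measure_pmf_bind) (simp add: measure_pmf.measure_bind[where N = "count_space UNIV"] measure_pmf_in_subprob_algebra)
  also have "\<dots> = avg (\<lambda>w. measure_pmf.prob (steps kernel t (act w x)) A)"
    unfolding kernel_def avg_def
    by (simp add: integral_pmf_of_set[OF W_nonempty finite_W])
  finally show ?thesis .
qed

lemma prob_steps_diff_le:
  "\<bar>measure_pmf.prob (steps kernel t x) A - measure_pmf.prob (steps kernel t y) A\<bar> \<le> sep t x y"
proof (induction t arbitrary: x y)
  case 0
  then show ?case by (auto simp: measure_return indicator_def)
next
  case (Suc t)
  show ?case
    unfolding prob_steps_Suc avg_diff[symmetric] sep.simps
    by (intro order_trans[OF abs_avg_le] avg_mono Suc.IH)
qed

text \<open>Run a second copy from the uniform distribution. By \<open>stat\<close> it remains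
  uniform, so the uniform probability of an event is the average of its \<open>t\<close>-step
  probabilities over all starts \<open>y\<close>, and each of these is within \<open>c\<close> of
  the one for \<open>x\<close>.\<close>

lemma tv_dist_steps_le:
  assumes stat: "\<And>g. (\<Sum>x\<in>Om. avg (\<lambda>w. g (act w x))) = (\<Sum>x\<in>Om. g x)"
    and c: "\<And>y. y \<in> Om \<Longrightarrow> sep t x y \<le> c"
  shows "tv_dist (steps kernel t x) (pmf_of_set Om) \<le> c"
  unfolding tv_dist_def
proof (rule cSUP_least)
  fix A
  let ?p = "\<lambda>y. measure_pmf.prob (steps kernel t y) A"
  have card_pos: "0 < real (card Om)"
    using finite_Om Om_nonempty by (simp add: card_gt_0_iff)
  have sum_p: "(\<Sum>y\<in>Om. measure_pmf.prob (steps kernel t y) A) = (\<Sum>y\<in>Om. indicator A y)" for t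
  proof (induction t)
    case 0
    then show ?case by (simp add: measure_return)
  next
    case (Suc t)
    show ?case
      unfolding prob_steps_Suc
      using stat[of "\<lambda>y. measure_pmf.prob (steps kernel t y) A"] Suc by simp
  qed
  have "measure_pmf.prob (pmf_of_set Om) A = (\<Sum>y\<in>Om. ?p y) / real (card Om)"
    unfolding sum_p using finite_Om Om_nonempty
    by (simp add: measure_pmf_of_set indicator_def of_bool_def sum.If_cases Int_commute)
  then have "?p x - measure_pmf.prob (pmf_of_set Om) A = (\<Sum>y\<in>Om. ?p x - ?p y) / real (card Om)"
    using card_pos by (simp add: sum_subtractf field_simps)
  also have "\<bar>\<dots>\<bar> \<le> (\<Sum>y\<in>Om. \<bar>?p x - ?p y\<bar>) / real (card Om)"
    by (simp add: abs_divide divide_right_mono sum_abs)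
  also have "\<dots> \<le> (\<Sum>y\<in>Om. c) / real (card Om)"
    by (intro divide_right_mono sum_mono order_trans[OF prob_steps_diff_le] c) auto
  also have "\<dots> = c" using card_pos by simp
  finally show "\<bar>?p x - measure_pmf.prob (pmf_of_set Om) A\<bar> \<le> c" .
qed simp

end

section \<open>Height functions on a hexagonal region\<close>

datatype dir = A | B | C

lemma dir_UNIV: "(UNIV :: dir set) = {A, B, C}"
  using dir.exhaust by auto

instance dir :: finite
  by standard (simp add: dir_UNIV)

lemma all_dir: "(\<forall>k. P k) \<longleftrightarrow> P A \<and> P B \<and> P C"
  by (metis dir.exhaust)

lemma all_dir_distinct:
  assumes "k \<noteq> l" "l \<noteq> m" "m \<noteq> k"
  shows "(\<forall>j. P j) \<longleftrightarrow> P k \<and> P l \<and> P (m :: dir)"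
  using assms by (cases k; cases l; cases m; simp add: all_dir; blast)

lemma third_dir:
  fixes k l :: dir
  assumes "k \<noteq> l"
  obtains m where "l \<noteq> m" "m \<noteq> k"
  using assms dir.distinct by (metis dir.exhaust)

text \<open>The dual of the triangular lattice: \<open>nb k\<close> crosses the side of direction
  \<open>k\<close>, and \<open>hexagon\<close> says that the six triangles around a lattice vertex
  close up. Crossing two sides of different directions is a translation;
  \<open>translations_inj\<close> makes two of these independent. \<open>no_hole\<close> reflects
  that a triangle with all three sides in the graph is itself a face.\<close>

locale hex_region =
  fixes nb :: "dir \<Rightarrow> 'f \<Rightarrow> 'f" and S :: "'f set"
  assumes nb_nb [simp]: "nb k (nb k f) = f"
    and nb_eq [simp]: "nb k f = nb l f \<longleftrightarrow> k = l"
    and hexagon: "k \<noteq> l \<Longrightarrow> l \<noteq> m \<Longrightarrow> m \<noteq> k \<Longrightarrow> nb k (nb l (nb m (nb k (nb l (nb m f))))) = f"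
    and translations_inj:
      "inj (\<lambda>(i, j). ((nb A \<circ> nb B) ^^ i) (((nb A \<circ> nb C) ^^ j) f))"
    and finite_S: "finite S"
    and no_hole: "(\<And>k. nb k f \<in> S) \<Longrightarrow> f \<in> S"
begin

definition states :: "('f \<Rightarrow> int) set" where
  "states = {X. (\<forall>f. f \<notin> S \<longrightarrow> X f = 0) \<and> (\<forall>f\<in>S. \<forall>k. \<bar>X (nb k f) - X f\<bar> = 1)}"

lemma states_outside: "X \<in> states \<Longrightarrow> f \<notin> S \<Longrightarrow> X f = 0"
  by (simp add: states_def)

lemma states_step: "X \<in> states \<Longrightarrow> f \<in> S \<Longrightarrow> X (nb k f) = X f + 1 \<or> X (nb k f) = X f - 1"
proof -
  assume "X \<in> states" "f \<in> S"
  then have "\<bar>X (nb k f) - X f\<bar> = 1" by (simp add: states_def)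
  then show ?thesis by linarith
qed

lemma states_lip: 
  assumes "X \<in> states" shows "\<bar>X (nb k f) - X f\<bar> \<le> 1"
proof (cases "f \<in> S \<or> nb k f \<in> S")
  case True
  then show ?thesis
    using states_step[OF assms, of f k] states_step[OF assms, of "nb k f" k] by auto
qed (simp add: states_outside[OF assms])

lemma states_step_iff: 
  assumes "X \<in> states" "f \<in> S \<or> nb k f \<in> S"
  shows "X (nb k f) = X f + 1 \<or> X (nb k f) = X f - 1"
    using assms states_step[of X f k] states_step[of X "nb k f" k] by auto

lemma states_neg: "X \<in> states \<Longrightarrow> - X \<in> states"
  unfolding states_def by (auto simp: abs_if split: if_splits) (smt (verit))+

lemma neg_neg [simp]: "- (- X) = (X :: 'f \<Rightarrow> int)"
  by (rule ext) simp

text \<open>A nonempty set closed under all crossings contains an infinite orbit of a translation,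
  which does not fit into the finite \<open>S\<close>.\<close>

lemma no_closed_subset:
  assumes sub: "\<And>g. P g \<Longrightarrow> g \<in> S" and step: "\<And>g k. P g \<Longrightarrow> P (nb k g)"
  shows "\<not> P f"
proof
  assume "P f"
  let ?t = "\<lambda>i. ((nb A \<circ> nb B) ^^ i) f"
  have "P (?t i)" for i
  proof (induction i)
    case (Suc i)
    then show ?case using step[OF step[OF Suc.IH], of A B] by simp
  qed (use \<open>P f\<close> in simp)
  then have "range ?t \<subseteq> S" using sub by blast
  moreover have "inj ?t"
  proof (rule injI)
    fix i j
    assume "?t i = ?t j"
    then show "i = j" using injD[OF translations_inj[of f], of "(i, 0)" "(j, 0)"] by simp
  qed
  ultimately show False
    using finite_S finite_subset infinite_UNIV_nat finite_imageD by blast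
qed

text \<open>Crossing a side of a face in \<open>S\<close> changes both heights by one, so the faces
  with odd difference would be closed under all crossings.\<close>

lemma states_even_diff:
  assumes "X \<in> states" "Y \<in> states"
  shows "even (Y f - X f)"
proof -
  have in_S: "g \<in> S" if "odd (Y g - X g)" for g
    by (rule ccontr) (use that states_outside[OF assms(1), of g] states_outside[OF assms(2), of g] in simp)
  have step: "odd (Y (nb k g) - X (nb k g))" if "odd (Y g - X g)" for k g
    using states_step[OF assms(1) in_S[OF that], of k] states_step[OF assms(2) in_S[OF that], of k] that
    by auto
  from no_closed_subset[of "\<lambda>g. odd (Y g - X g)" f, OF in_S step] show ?thesis by simp
qed

text \<open>A disagreement would be passed on across every side. This is the injectivity of the
  passage from heights to orientations.\<close>

lemma states_eqI:
  assumes "X \<in> states" "Y \<in> states"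
    and "\<And>f k. f \<in> S \<Longrightarrow> X f - X (nb k f) = 1 \<longleftrightarrow> Y f - Y (nb k f) = 1"
  shows "X = Y"
proof
  fix f
  have in_S: "g \<in> S" if "X g \<noteq> Y g" for g
    by (rule ccontr) (use that states_outside[OF assms(1), of g] states_outside[OF assms(2), of g] in simp)
  have step: "X (nb k g) \<noteq> Y (nb k g)" if "X g \<noteq> Y g" for k g
    using states_step[OF assms(1) in_S[OF that], of k] states_step[OF assms(2) in_S[OF that], of k] that
      assms(3)[OF in_S[OF that], of k]
    by auto
  from no_closed_subset[of "\<lambda>g. X g \<noteq> Y g" f, OF in_S step] show "X f = Y f" by simp
qed

text \<open>The faces whose boundary is directed clockwise; the counterclockwise ones satisfy
  \<open>lmin (- X)\<close>.\<close>

definition lmin :: "('f \<Rightarrow> int) \<Rightarrow> 'f \<Rightarrow> bool" where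
  "lmin X f \<longleftrightarrow> (\<forall>k. X (nb k f) = X f + 1)"

text \<open>An almost-directed face in terms of heights: the side \<open>k\<close> is its blocking
  edge.\<close>

definition points :: "('f \<Rightarrow> int) \<Rightarrow> 'f \<Rightarrow> dir \<Rightarrow> bool" where
  "points X f k \<longleftrightarrow> X (nb k f) = X f - 1 \<and> (\<forall>j. j \<noteq> k \<longrightarrow> X (nb j f) = X f + 1)"

text \<open>Reversing an up tower of \<open>X\<close> raises its faces by 2; the towers whose faces are lowered are the
  up towers of \<open>- X\<close>.\<close>

inductive utower :: "('f \<Rightarrow> int) \<Rightarrow> 'f list \<Rightarrow> bool" for X where
  utower_single: "f \<in> S \<Longrightarrow> lmin X f \<Longrightarrow> utower X [f]"
| utower_Cons: "f \<in> S \<Longrightarrow> points X f k \<Longrightarrow> utower X (nb k f # T) \<Longrightarrow> utower X (f # nb k f # T)"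

definition raise :: "'f set \<Rightarrow> ('f \<Rightarrow> int) \<Rightarrow> 'f \<Rightarrow> int" where
  "raise T X f = X f + (if f \<in> T then 2 else 0)"

lemma utower_not_Nil: "utower X T \<Longrightarrow> T \<noteq> []"
  by (cases rule: utower.cases) auto

lemma utower_subset: "utower X T \<Longrightarrow> set T \<subseteq> S"
  by (induction rule: utower.induct) auto

lemma lminD: "lmin X f \<Longrightarrow> X (nb k f) = X f + 1"
  by (simp add: lmin_def)

lemma points_at: "points X f k \<Longrightarrow> X (nb k f) = X f - 1"
  by (simp add: points_def)

lemma points_off: "points X f k \<Longrightarrow> j \<noteq> k \<Longrightarrow> X (nb j f) = X f + 1"
  by (simp add: points_def)

lemma points_unique: "points X f k \<Longrightarrow> points X f l \<Longrightarrow> k = l"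
  by (rule ccontr) (auto simp: points_def)

lemma points_not_lmin: "points X f k \<Longrightarrow> \<not> lmin X f"
proof
  assume "points X f k" "lmin X f"
  then have "X (nb k f) = X f - 1" "X (nb k f) = X f + 1" by (simp_all add: points_def lmin_def)
  then show False by simp
qed

lemma lmin_not_lmax: "lmin X f \<Longrightarrow> \<not> lmin (- X) f"
  by (simp add: lmin_def)

lemma lmin_not_points_neg:
  assumes "lmin X f" shows "\<not> points (- X) f k"
proof
  assume "points (- X) f k"
  moreover obtain j where "j \<noteq> k" by (metis dir.distinct(1))
  ultimately have "- X (nb j f) = - X f + 1" by (simp add: points_def)
  then show False using assms by (simp add: lmin_def)
qed

lemma points_not_points_neg:
  assumes "points X f k" shows "\<not> points (- X) f l"
proof
  assume l: "points (- X) f l"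
  obtain j where "j \<noteq> k" "j \<noteq> l" by (metis dir.distinct dir.exhaust)
  then show False using points_off[OF l, of j] points_off[OF assms, of j] by simp
qed

lemma utower_unique: "utower X T \<Longrightarrow> utower X T' \<Longrightarrow> hd T = hd T' \<Longrightarrow> T = T'"
proof (induction arbitrary: T' rule: utower.induct)
  case (utower_single f)
  from utower_single(3) show ?case
  proof (cases rule: utower.cases)
    case (utower_Cons g l T'')
    then have "points X f l" using utower_single.prems(2) by simp
    then show ?thesis using points_not_lmin utower_single.hyps(2) by blast
  qed (use utower_single.prems(2) in simp)
next
  case (utower_Cons f k T)
  from utower_Cons.prems(1) show ?case
  proof (cases rule: utower.cases)
    case (utower_single g)
    then have "lmin X f" using utower_Cons.prems(2) by simp
    then show ?thesis using points_not_lmin utower_Cons.hyps(2) by blast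
  next
    case T': (utower_Cons g l T'')
    then have "g = f" using utower_Cons.prems(2) by simp
    then have "l = k" using T' utower_Cons.hyps(2) points_unique by blast
    have "nb k f # T = nb l g # T''"
      by (rule utower_Cons.IH[OF T'(4)]) (simp add: \<open>l = k\<close> \<open>g = f\<close>)
    then show ?thesis using T'(1) \<open>g = f\<close> by simp
  qed
qed

lemma utower_hd: "utower X T \<Longrightarrow> hd T \<in> S \<and> (lmin X (hd T) \<or> (\<exists>k. points X (hd T) k))"
  by (cases rule: utower.cases) auto

text \<open>An up tower starts at a face with at least two higher neighbours, a down tower at one
  with at least two lower ones; a face has only three.\<close>

lemma utower_neg_disjoint:
  assumes "utower X T" "utower (- X) T'" shows "hd T \<noteq> hd T'"
proof
  assume eq: "hd T = hd T'"
  have "lmin X (hd T) \<or> (\<exists>k. points X (hd T) k)" using utower_hd[OF assms(1)] by simp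
  moreover have "lmin (- X) (hd T) \<or> (\<exists>k. points (- X) (hd T) k)"
    using utower_hd[OF assms(2)] eq by simp
  ultimately show False
    using lmin_not_lmax lmin_not_points_neg[of X] lmin_not_points_neg[of "- X"] points_not_points_neg
    by (metis neg_neg)
qed

lemma utower_heights:
  assumes "utower X (f # T)" "g \<in> set T" shows "X g < X f"
  using assms
proof (induction "f # T" arbitrary: f T rule: utower.induct)
  case (utower_Cons f k T)
  then show ?case by (cases "g = nb k f") (auto simp: points_def)
qed simp

lemma utower_distinct: "utower X T \<Longrightarrow> distinct T"
proof (induction rule: utower.induct)
  case (utower_Cons f k T)
  have "utower X (f # nb k f # T)"
    by (rule utower.utower_Cons) fact+
  from utower_heights[OF this] have "f \<notin> set (nb k f # T)" by blast
  then show ?case using utower_Cons.IH by simp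
qed simp

lemma raise_raise: "T \<inter> T' = {} \<Longrightarrow> raise T (raise T' X) = raise (T \<union> T') X"
  by (rule ext) (auto simp: raise_def)

lemma raise_states:
  assumes "X \<in> states" "f \<in> S" "lmin X f"
  shows "raise {f} X \<in> states"
proof -
  have ne: "nb k f \<noteq> f" for k
    using states_step[OF assms(1,2), of k] by auto
  have "\<bar>raise {f} X (nb k g) - raise {f} X g\<bar> = 1" if "g \<in> S" for g k
  proof (cases "g = f")
    case True
    then show ?thesis using assms(3) ne by (simp add: raise_def lmin_def)
  next
    case False
    show ?thesis
    proof (cases "nb k g = f")
      case True
      then have "g = nb k f" by auto
      then show ?thesis using assms(3) False by (simp add: raise_def lmin_def)
    next
      case F: False
      then show ?thesis using False states_step[OF assms(1) that, of k] by (auto simp: raise_def)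
    qed
  qed
  then show ?thesis
    using assms(1,2) by (auto simp: states_def raise_def)
qed

text \<open>A reversed tower is a sequence of single flips from the end to the start: once the tail
  is raised, the head has become a local minimum.\<close>

lemma utower_raise:
  assumes "X \<in> states" "utower X T"
  shows "raise (set T) X \<in> states"
  using assms(2)
proof (induction rule: utower.induct)
  case (utower_single f)
  then show ?case using raise_states[OF assms(1)] by simp
next
  case (utower_Cons f k T)
  let ?T = "nb k f # T" and ?Y = "raise (set (nb k f # T)) X"
  have tow: "utower X (f # ?T)" by (rule utower.utower_Cons) fact+
  have notin: "f \<notin> set ?T" using utower_distinct[OF tow] by simp
  have "lmin ?Y f"
    unfolding lmin_def
  proof
    fix j
    show "?Y (nb j f) = ?Y f + 1"
    proof (cases "j = k")
      case True
      then show ?thesis using notin \<open>points X f k\<close> by (auto simp: raise_def points_def)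
    next
      case False
      then have "X (nb j f) = X f + 1" using \<open>points X f k\<close> by (simp add: points_def)
      then have "nb j f \<notin> set ?T" using utower_heights[OF tow, of "nb j f"] by auto
      then show ?thesis using \<open>X (nb j f) = X f + 1\<close> notin by (simp add: raise_def)
    qed
  qed
  from raise_states[OF utower_Cons.IH \<open>f \<in> S\<close> this]
  show ?case using notin by (subst (asm) raise_raise) (auto simp: insert_commute)
qed

lemma utower_appendD: "utower X (P @ x # Q) \<Longrightarrow> utower X (x # Q)"
proof (induction P)
  case (Cons p P)
  then show ?case by (auto elim: utower.cases simp: Cons_eq_append_conv)
qed simp

text \<open>The faces of the tower rise by 2 while the faces beside it keep their heights.
  Afterwards the first face is a local maximum and every other face has only its predecessor above
  it, so the opposite pointers run through the tower backwards.\<close>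

lemma utower_neg_rev:
  assumes X: "X \<in> states" and T: "utower X T"
  shows "utower (- raise (set T) X) (rev T)"
proof -
  define Y where "Y = raise (set T) X"
  define Z where "Z = - Y"
  have prev: "X p = X x + 1 \<and> (\<exists>k. x = nb k p)" if "T = P @ [p, x] @ Q" for P p x Q
  proof -
    have "utower X (p # x # Q)" using utower_appendD[of X P p "x # Q"] T that by simp
    then show ?thesis by (cases rule: utower.cases) (auto simp: points_def)
  qed
  \<comment> \<open>Heights strictly decrease along the tower, so its only face one level above
    \<open>x\<close> is the predecessor \<open>p\<close>.\<close>
  have above: "y = p" if T_eq: "T = P @ [p, x] @ Q" and y: "y \<in> set T" "X y \<ge> X x + 1" "X y \<le> X x + 1" for P p x y Q
  proof -
    from y(1) T_eq consider "y \<in> set P" | "y = p" | "y \<in> set (x # Q)" by auto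
    then show ?thesis
    proof cases
      case 1
      then obtain P1 P2 where "P = P1 @ y # P2" by (auto simp: in_set_conv_decomp)
      then have "utower X (y # (P2 @ [p, x] @ Q))"
        using T T_eq utower_appendD[of X P1 y "P2 @ [p, x] @ Q"] by simp
      then have "X p < X y" using utower_heights[of X y _ p] by auto
      then show ?thesis using prev[OF T_eq] y by simp
    next
      case 3
      have "utower X (x # Q)" using T T_eq utower_appendD[of X "P @ [p]" x Q] by simp
      then have "X y \<le> X x" using 3 utower_heights[of X x Q y] by force
      then show ?thesis using y by simp
    qed simp
  qed
  \<comment> \<open>Induction over the prefixes \<open>P\<close> of the tower, so that the reversed
    prefix grows at its head.\<close>
  have "utower Z (rev P)" if "T = P @ Q" "P \<noteq> []" for P Q
    using that
  proof (induction P arbitrary: Q rule: rev_induct)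
    case (snoc x P)
    have tx: "utower X (x # Q)" using T snoc.prems utower_appendD[of X P x Q] by simp
    then have xS: "x \<in> S" using utower_subset by fastforce
    have xT: "x \<in> set T" using snoc.prems by simp
    have low: "Y (nb j x) = Y x - 1" if j: "\<And>p P'. P = P' @ [p] \<Longrightarrow> nb j x \<noteq> p" for j
      using tx
    proof (cases rule: utower.cases)
      case utower_single
      then have "X (nb j x) = X x + 1" by (simp add: lmin_def)
      moreover have "nb j x \<notin> set T"
      proof
        assume "nb j x \<in> set T"
        show False
        proof (cases P rule: rev_cases)
          case Nil
          then show ?thesis using \<open>nb j x \<in> set T\<close> snoc.prems utower_single states_step[OF X xS, of j] by auto
        next
          case (snoc P' p)
          have "nb j x = p"
            using above[of P' p x Q "nb j x"] \<open>nb j x \<in> set T\<close> \<open>X (nb j x) = X x + 1\<close> snoc snoc.prems by auto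
          then show False using j snoc by blast
        qed
      qed
      ultimately show ?thesis using xT by (simp add: Y_def raise_def)
    next
      case (utower_Cons k Q')
      show ?thesis
      proof (cases "j = k")
        case True
        then show ?thesis using utower_Cons xT snoc.prems by (auto simp: Y_def raise_def points_def)
      next
        case False
        then have eq: "X (nb j x) = X x + 1" using utower_Cons by (simp add: points_def)
        have "nb j x \<notin> set T"
        proof
          assume inT: "nb j x \<in> set T"
          show False
          proof (cases P rule: rev_cases)
            case Nil
            then have "T = x # Q" using snoc.prems by simp
            then show ?thesis using inT eq utower_heights[OF tx, of "nb j x"] by auto
          next
            case (snoc P' p)
            have "nb j x = p"
              using above[of P' p x Q "nb j x"] inT eq snoc snoc.prems by auto
            then show False using j snoc by blast
          qed
        qed
        then show ?thesis using xT eq by (simp add: Y_def raise_def)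
      qed
    qed
    show ?case
    proof (cases P rule: rev_cases)
      case Nil
      then have "lmin Z x" using low by (auto simp: lmin_def Z_def)
      then have "utower Z [x]" by (rule utower.utower_single[OF xS])
      then show ?thesis by (simp only: Nil append_Nil rev.simps)
    next
      case (snoc P' p)
      have T_eq: "T = P' @ [p, x] @ Q" using snoc snoc.prems by simp
      then obtain k where k: "x = nb k p" "X p = X x + 1" using prev by blast
      then have p: "p = nb k x" by simp
      have "p \<in> set T" using T_eq by simp
      have "Y p = Y x + 1" using k(2) xT \<open>p \<in> set T\<close> by (simp add: Y_def raise_def)
      moreover have "Y (nb j x) = Y x - 1" if "j \<noteq> k" for j
        by (rule low) (use snoc p that in auto)
      ultimately have "points Z x k" using p by (simp add: points_def Z_def)
      moreover have "utower Z (nb k x # rev P')"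
        using snoc.IH[of "x # Q"] snoc snoc.prems p by simp
      ultimately show ?thesis using xS utower.utower_Cons[of x Z k "rev P'"] snoc p by simp
    qed
  qed simp
  from this[of T "[]"] show ?thesis using utower_not_Nil[OF T] by (simp add: Y_def Z_def)
qed

end

section \<open>Comparison of two states that differ in one face\<close>

context hex_region
begin

text \<open>The drift needs only the existence of a tower of length at least 2, because its length
  cancels against the probability 1/(3h).\<close>

inductive hasU :: "('f \<Rightarrow> int) \<Rightarrow> 'f \<Rightarrow> bool" for X where
  hasU_lmin: "f \<in> S \<Longrightarrow> lmin X f \<Longrightarrow> hasU X f"
| hasU_points: "f \<in> S \<Longrightarrow> points X f k \<Longrightarrow> hasU X (nb k f) \<Longrightarrow> hasU X f"

lemma hasU_iff: "hasU X f \<longleftrightarrow> (\<exists>T. utower X (f # T))"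
proof
  show "\<exists>T. utower X (f # T)" if "hasU X f"
    using that by (induction rule: hasU.induct) (blast intro: utower.intros)+
  show "hasU X f" if "\<exists>T. utower X (f # T)"
  proof -
    from that obtain T where "utower X (f # T)" by blast
    then show ?thesis
      by (induction "f # T" arbitrary: f T rule: utower.induct) (auto intro: hasU.intros)
  qed
qed

lemma hasU_in: "hasU X f \<Longrightarrow> f \<in> S"
  by (cases rule: hasU.cases) auto

lemma hasU_neg_points: assumes "points X f k" shows "\<not> hasU (- X) f"
proof
  assume "hasU (- X) f"
  then show False
  proof (cases rule: hasU.cases)
    case hasU_lmin
    then show ?thesis using lmin_not_points_neg[of "- X" f k] assms by simp
  next
    case hasU_points
    then show ?thesis using points_not_points_neg[OF assms] by simp
  qed
qed

lemma hasU_neg_lmin: assumes "lmin X f" shows "\<not> hasU (- X) f"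
proof
  assume "hasU (- X) f"
  then show False
  proof (cases rule: hasU.cases)
    case hasU_lmin
    then show ?thesis using lmin_not_lmax[OF assms] by simp
  next
    case hasU_points
    then show ?thesis using lmin_not_points_neg[OF assms] by simp
  qed
qed

text \<open>The expected volume gained by choosing \<open>f\<close> and the direction ``up'': the length of the tower times
  the probability of reversing it.\<close>

definition gU :: "('f \<Rightarrow> int) \<Rightarrow> 'f \<Rightarrow> real" where
  "gU X f = (if f \<in> S \<and> lmin X f then 1 else if hasU X f then 1 / 3 else 0)"

lemma gU_nonneg: "0 \<le> gU X f"
  by (simp add: gU_def)

end

locale hex_flip = hex_region +
  fixes X F Y
  assumes X: "X \<in> states" and F: "F \<in> S" and lmin_F: "lmin X F" and Y_def: "Y = raise {F} X"
begin

lemma Y: "Y \<in> states"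
  using raise_states X F lmin_F Y_def by simp

lemma Y_F: "Y F = X F + 2"
  by (simp add: Y_def raise_def)

lemma Y_other: "f \<noteq> F \<Longrightarrow> Y f = X f"
  by (simp add: Y_def raise_def)

lemma nb_F: "nb k F \<noteq> F"
  using lminD[OF lmin_F, of k] by auto

lemma X_nb_F: "X (nb k F) = X F + 1"
  by (rule lminD[OF lmin_F])

lemma Y_nb_F: "Y (nb k F) = X F + 1"
  using Y_other[OF nb_F] X_nb_F by simp

lemma lmax_Y_F: "lmin (- Y) F"
  by (simp add: lmin_def Y_F Y_nb_F)

lemma far_same:
  assumes "f \<noteq> F" "\<And>k. f \<noteq> nb k F"
  shows "Y f = X f" "Y (nb j f) = X (nb j f)"
proof -
  show "Y f = X f" using assms Y_other by blast
  have "nb j f \<noteq> F" using assms(2)[of j] by auto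
  then show "Y (nb j f) = X (nb j f)" by (rule Y_other)
qed

lemma far_lmin:
  assumes "f \<noteq> F" "\<And>k. f \<noteq> nb k F"
  shows "lmin Y f = lmin X f" "points Y f k = points X f k"
    "lmin (- Y) f = lmin (- X) f" "points (- Y) f k = points (- X) f k"
  using far_same[OF assms] by (simp_all add: lmin_def points_def)

text \<open>A neighbour of the local minimum \<open>F\<close> has \<open>F\<close> below it, so a
  tower through that neighbour steps to \<open>F\<close> and ends there; raising \<open>F\<close>
  turns the neighbour into a local minimum, and the tower loses its last face. A tower that avoids
  \<open>F\<close> contains no neighbour of \<open>F\<close> and is unaffected.\<close>

lemma utower_flip:
  assumes "utower X T"
  shows "hd T = F \<or> (F \<notin> set T \<and> utower Y T) \<or> (\<exists>T'. T' \<noteq> [] \<and> T = T' @ [F] \<and> utower Y T')"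
  using assms
proof (induction rule: utower.induct)
  case (utower_single f)
  show ?case
  proof (cases "f = F")
    case False
    have "f \<noteq> nb k F" for k
    proof
      assume "f = nb k F"
      then have "X F = X f + 1" using lminD[OF utower_single(2), of k] by simp
      then show False using X_nb_F[of k] \<open>f = nb k F\<close> by simp
    qed
    then have "lmin Y f" using far_lmin False utower_single(2) by blast
    then show ?thesis using utower.utower_single utower_single(1) False by simp
  qed simp
next
  case (utower_Cons f k T)
  have "f \<noteq> F" using points_not_lmin[OF utower_Cons(2)] lmin_F by auto
  have near: "nb k f = F" if "f = nb j F" for j
  proof (rule ccontr)
    assume "nb k f \<noteq> F"
    then have "j \<noteq> k" using that by auto
    then show False using points_off[OF utower_Cons(2), of j] X_nb_F[of j] that by simp
  qed
  have far: ?case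
    if T12: "nb k f # T = T1 @ T2" "utower Y T1" "T1 \<noteq> []" "F \<notin> set T1" "T2 = [] \<or> T2 = [F]" for T1 T2
  proof -
    have nbF: "nb k f \<noteq> F" using T12 by (cases T1) auto
    then have "points Y f k" using far_lmin(2)[OF \<open>f \<noteq> F\<close>, of k] near utower_Cons(2) by blast
    moreover obtain T3 where "T1 = nb k f # T3" using T12 by (cases T1) auto
    ultimately have "utower Y (f # T1)" using utower.utower_Cons[OF utower_Cons(1)] T12(2) by blast
    then show ?thesis using T12 \<open>f \<noteq> F\<close> by auto
  qed
  from utower_Cons.IH consider "nb k f = F" | "F \<notin> set (nb k f # T)" "utower Y (nb k f # T)"
    | T' where "T' \<noteq> []" "nb k f # T = T' @ [F]" "utower Y T'" by auto
  then show ?case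
  proof cases
    case 1
    have "nb k f # T = [F]"
      by (rule utower_unique[OF utower_Cons(3) utower.utower_single[OF F lmin_F]]) (simp add: 1)
    moreover have "lmin Y f"
      unfolding lmin_def
    proof
      fix j
      show "Y (nb j f) = Y f + 1"
      proof (cases "j = k")
        case True
        then show ?thesis using 1 Y_F Y_other[OF \<open>f \<noteq> F\<close>] points_at[OF utower_Cons(2)] by simp
      next
        case False
        then have "nb j f \<noteq> F" using 1 nb_eq by metis
        then show ?thesis using Y_other \<open>f \<noteq> F\<close> points_off[OF utower_Cons(2) False] by simp
      qed
    qed
    ultimately have "f # nb k f # T = [f] @ [F]" "utower Y [f]"
      using utower.utower_single[OF utower_Cons(1)] by auto
    then show ?thesis by blast
  next
    case 2
    then show ?thesis using far[of "nb k f # T" "[]"] by simp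
  next
    case 3
    have "distinct (T' @ [F])" using utower_distinct[OF utower_Cons(3)] 3(2) by simp
    then show ?thesis using far[of T' "[F]"] 3 by simp
  qed
qed

text \<open>A tower created further away would run from \<open>f\<close> to \<open>g\<close>, then
  to a neighbour \<open>G\<close> of \<open>F\<close>, and beyond. Each of the two hexagons that
  this path can follow contains a height drop too large for the crossings left to bridge it.\<close>

lemma hasU_flipD:
  assumes "hasU Y f"
  shows "hasU X f \<or> (\<exists>k. f = nb k F) \<or>
    (\<exists>k l. l \<noteq> k \<and> f = nb l (nb k F) \<and> points Y f l \<and> hasU Y (nb k F) \<and> \<not> hasU X (nb k F))"
  using assms
proof (induction rule: hasU.induct)
  case (hasU_lmin f)
  have "f \<noteq> F" using lmin_not_lmax[OF hasU_lmin(2)] lmax_Y_F by auto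
  then show ?case using far_lmin(1) hasU_lmin hasU.hasU_lmin by blast
next
  case (hasU_points f j)
  have "f \<noteq> F" using lmin_not_points_neg[OF lmax_Y_F, of j] hasU_points(2) by auto
  show ?case
  proof (cases "\<exists>k. f = nb k F")
    case False
    then have "points X f j" using far_lmin(2) \<open>f \<noteq> F\<close> hasU_points(2) by blast
    show ?thesis
    proof (cases "hasU X (nb j f)")
      case True
      then show ?thesis using hasU.hasU_points \<open>points X f j\<close> hasU_points(1) by blast
    next
      case notU: False
      show ?thesis
      proof (cases "\<exists>k. nb j f = nb k F")
        case True
        then obtain k where k: "nb j f = nb k F" by blast
        then have f: "f = nb j (nb k F)" by (metis nb_nb)
        moreover have "j \<noteq> k" using f \<open>f \<noteq> F\<close> by auto
        ultimately show ?thesis using hasU_points k notU by metis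
      next
        case notN: False
        define g where "g = nb j f"
        from hasU_points.IH notU notN obtain k l where kl: "l \<noteq> k" "g = nb l (nb k F)"
          "points Y g l" "hasU Y (nb k F)" "\<not> hasU X (nb k F)" by (auto simp: g_def)
        define G where "G = nb k F"
        have G: "nb l g = G" "nb l G = g" "nb k G = F" using kl by (auto simp: G_def)
        have f: "f = nb j g" by (simp add: g_def)
        have hg: "Y G = Y g - 1" using points_at[OF kl(3)] G by simp
        have hf: "Y f = Y g + 1" using points_at[OF hasU_points(2)] g_def by simp
        have hF: "Y F = Y G + 1" using Y_F Y_nb_F[of k] G_def by simp
        have "j \<noteq> l" using G f False G_def by metis
        \<comment> \<open>If \<open>Y\<close> had a local minimum at \<open>G\<close>, then
          \<open>G\<close> would point to \<open>F\<close> in \<open>X\<close> and have a tower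
          there already.\<close>
        have "\<not> lmin Y G"
        proof
          assume min: "lmin Y G"
          have "points X G k"
            unfolding points_def
          proof (intro conjI allI impI)
            show "X (nb k G) = X G - 1" using G X_nb_F[of k] G_def by simp
            fix i assume "i \<noteq> k"
            then have "nb i G \<noteq> F" using G nb_eq by metis
            then show "X (nb i G) = X G + 1"
              using lminD[OF min, of i] Y_other nb_F[of k] G_def by metis
          qed
          moreover have "G \<in> S" using kl(4) hasU_in G_def by simp
          moreover have "hasU X F" using hasU.hasU_lmin F lmin_F by simp
          ultimately have "hasU X G" using hasU.hasU_points G by metis
          then show False using kl(5) G_def by simp
        qed
        with kl(4) obtain m where m: "points Y G m" 
          unfolding G_def by (cases rule: hasU.cases) auto
        have "m \<noteq> k" using points_at[OF m] G hF by auto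
        have "m \<noteq> l" using points_at[OF m] G hg by auto
        have "j = k \<or> j = m"
          using \<open>m \<noteq> k\<close> \<open>m \<noteq> l\<close> \<open>j \<noteq> l\<close> kl(1) by (cases j; cases k; cases l; cases m; simp)
        then show ?thesis
        proof
          assume "j = k"
          \<comment> \<open>This hexagon contains \<open>nb m G\<close>, \<open>G\<close>,
            \<open>g\<close>, \<open>f\<close> and \<open>nb m f\<close>; from \<open>nb m f\<close>
            to \<open>nb m G\<close> the height falls by 4, but only two crossings remain.\<close>
          have "nb k (nb l (nb m (nb k (nb l (nb m (nb m G)))))) = nb m G"
            by (rule hexagon) (use \<open>m \<noteq> k\<close> \<open>m \<noteq> l\<close> kl(1) in auto)
          then have hex: "nb k (nb l (nb m f)) = nb m G" using G f \<open>j = k\<close> by simp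
          have "Y (nb m f) = Y f + 1" using points_off[OF hasU_points(2), of m] \<open>m \<noteq> k\<close> \<open>j = k\<close> by simp
          moreover have "\<bar>Y (nb l (nb m f)) - Y (nb m f)\<bar> \<le> 1" by (rule states_lip[OF Y])
          moreover have "\<bar>Y (nb m G) - Y (nb l (nb m f))\<bar> \<le> 1"
            using states_lip[OF Y, of k "nb l (nb m f)"] hex by simp
          ultimately show ?thesis using points_at[OF m] hf hg by simp
        next
          assume "j = m"
          \<comment> \<open>This hexagon contains \<open>F\<close>, \<open>G\<close>,
            \<open>g\<close>, \<open>f\<close>, \<open>nb k f\<close> and \<open>nb m F\<close>; the
            last two are adjacent, yet their heights differ by 3.\<close>
          have "nb m (nb l (nb k (nb m (nb l (nb k F))))) = F"
            by (rule hexagon) (use \<open>m \<noteq> k\<close> \<open>m \<noteq> l\<close> kl(1) in auto)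
          then have hex: "nb m (nb l (nb k f)) = F" using kl(2) f \<open>j = m\<close> by simp
          then have "nb l (nb k f) = nb m F" by (metis nb_nb)
          then have "Y (nb l (nb k f)) = Y F - 1" using Y_nb_F Y_F by simp
          moreover have "Y (nb k f) = Y f + 1" using points_off[OF hasU_points(2), of k] \<open>m \<noteq> k\<close> \<open>j = m\<close> by simp
          moreover have "\<bar>Y (nb l (nb k f)) - Y (nb k f)\<bar> \<le> 1" by (rule states_lip[OF Y])
          ultimately show ?thesis using hf hg hF by simp
        qed
      qed
    qed
  qed simp
qed

text \<open>Raising \<open>F\<close> can create an up tower only at a neighbour of \<open>F\<close> or at a face that points to such a
  neighbour; the latter are charged to the neighbour.\<close>

definition qU :: "dir \<Rightarrow> dir \<Rightarrow> real" where
  "qU k l = (if l \<noteq> k \<and> points Y (nb l (nb k F)) l \<and> hasU Y (nb k F) \<and> \<not> hasU X (nb k F)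
     then 1 / 3 else 0)"

lemma qU_nonneg: "0 \<le> qU k l" by (simp add: qU_def)

text \<open>The charge is written as a sum over all pairs \<open>k\<close>, \<open>l\<close> so
  that, after summing over \<open>f\<close> and exchanging the sums, it can be collected at the
  neighbour \<open>nb k F\<close>.\<close>

lemma gU_flip_far:
  assumes "f \<noteq> F" "\<And>k. f \<noteq> nb k F"
  shows "gU Y f - gU X f \<le> (\<Sum>k\<in>UNIV. \<Sum>l\<in>UNIV. if f = nb l (nb k F) then qU k l else 0)"
proof -
  have nonneg: "0 \<le> (\<Sum>k\<in>UNIV. \<Sum>l\<in>UNIV. if f = nb l (nb k F) then qU k l else 0)"
    by (intro sum_nonneg) (simp add: qU_nonneg)
  show ?thesis
  proof (cases "hasU Y f \<and> \<not> hasU X f")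
    case True
    then obtain k l where kl: "l \<noteq> k" "f = nb l (nb k F)" "points Y f l" "hasU Y (nb k F)" "\<not> hasU X (nb k F)"
      using hasU_flipD[of f] assms(2) by blast
    have "1 / 3 = (if f = nb l (nb k F) then qU k l else 0)" using kl by (simp add: qU_def)
    also have "\<dots> \<le> (\<Sum>l\<in>UNIV. if f = nb l (nb k F) then qU k l else 0)"
      by (rule member_le_sum) (auto simp: qU_nonneg)
    also have "\<dots> \<le> (\<Sum>k\<in>UNIV. \<Sum>l\<in>UNIV. if f = nb l (nb k F) then qU k l else 0)"
      by (rule member_le_sum) (auto simp: qU_nonneg intro!: sum_nonneg)
    finally show ?thesis
      using True far_lmin(1)[OF assms] by (auto simp: gU_def hasU.hasU_lmin)
  next
    case False
    then have "gU Y f \<le> gU X f" using far_lmin(1)[OF assms] by (auto simp: gU_def)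
    then show ?thesis using nonneg by simp
  qed
qed

lemma gU_flip_F: "gU Y F - gU X F = -1"
proof -
  have "\<not> hasU Y F" using hasU_neg_lmin[OF lmax_Y_F] by simp
  then have "gU Y F = 0" using hasU.hasU_lmin[of F Y] by (auto simp: gU_def)
  then show ?thesis using F lmin_F by (simp add: gU_def)
qed

text \<open>Negation exchanges the two states and turns up towers into down towers, so every
  statement of this locale has a dual.\<close>

lemma hex_flip_neg: "hex_flip nb S (- Y) F (- X)"
proof unfold_locales
  show "- Y \<in> states" by (rule states_neg[OF Y])
  show "- X = raise {F} (- Y)" by (rule ext) (simp add: Y_def raise_def)
qed (use F lmax_Y_F in auto)

text \<open>The neighbour points to \<open>F\<close> in \<open>X\<close>, worth 1/3, and is a local
  minimum of \<open>Y\<close>, worth 1. This case attains the bound 2/3.\<close>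

lemma gU_flip_near_up:
  assumes G: "nb k F \<in> S" and up: "\<And>l. l \<noteq> k \<Longrightarrow> X (nb l (nb k F)) = X (nb k F) + 1"
  shows "gU Y (nb k F) - gU X (nb k F) + (gU (- X) (nb k F) - gU (- Y) (nb k F))
    + (\<Sum>l\<in>UNIV. qU k l + hex_flip.qU nb S (- Y) F (- X) k l) \<le> 2 / 3"
proof -
  let ?G = "nb k F"
  have pts: "points X ?G k"
    unfolding points_def using up X_nb_F[of k] by simp
  have U: "hasU X ?G" using hasU.hasU_points[OF G pts] hasU.hasU_lmin[OF F lmin_F] by simp
  have "lmin Y ?G"
    unfolding lmin_def
  proof
    fix l
    show "Y (nb l ?G) = Y ?G + 1"
    proof (cases "l = k")
      case False
      have "nb l ?G \<noteq> F" using nb_eq[of l ?G k] False by simp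
      then show ?thesis using up[OF False] Y_other nb_F by simp
    qed (simp add: Y_F Y_nb_F)
  qed
  then have "gU Y ?G = 1" using G by (simp add: gU_def)
  moreover have "gU X ?G = 1 / 3" using U points_not_lmin[OF pts] by (simp add: gU_def)
  moreover have nU: "\<not> hasU (- X) ?G" by (rule hasU_neg_points[OF pts])
  moreover have "gU (- X) ?G = 0" using nU hasU.hasU_lmin[of ?G "- X"] by (auto simp: gU_def)
  moreover have "0 \<le> gU (- Y) ?G" by (rule gU_nonneg)
  moreover have "qU k l = 0" for l using U by (simp add: qU_def)
  moreover have "hex_flip.qU nb S (- Y) F (- X) k l = 0" for l
    using nU by (simp add: hex_flip.qU_def[OF hex_flip_neg])
  ultimately show ?thesis by simp
qed

text \<open>Here \<open>X\<close> can only have a down tower and \<open>Y\<close> only an up tower,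
  each worth 1/3, and the faces across \<open>l\<close> and \<open>m\<close> may each add a charge
  of 1/3. But a charge from across \<open>l\<close> needs that face to point back to the neighbour,
  which blocks the down tower of \<open>X\<close> through it; a charge from across \<open>m\<close>
  blocks the up tower of \<open>Y\<close> in the same way. So at most two of the four terms
  survive.\<close>

lemma gU_flip_near_mixed:
  assumes G: "nb k F \<in> S" and klm: "k \<noteq> l" "l \<noteq> m" "m \<noteq> k"
    and l: "X (nb l (nb k F)) = X (nb k F) + 1" and m: "X (nb m (nb k F)) = X (nb k F) - 1"
  shows "gU Y (nb k F) - gU X (nb k F) + (gU (- X) (nb k F) - gU (- Y) (nb k F))
    + (\<Sum>l\<in>UNIV. qU k l + hex_flip.qU nb S (- Y) F (- X) k l) \<le> 2 / 3"
proof -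
  define G where "G = nb k F"
  define q' where "q' = hex_flip.qU nb S (- Y) F (- X) k"
  have GF: "G \<noteq> F" "nb k G = F" using nb_F by (auto simp: G_def)
  have Yl: "Y (nb l G) = Y G + 1" and Ym: "Y (nb m G) = Y G - 1"
    using l m Y_other nb_eq[of l G k] nb_eq[of m G k] GF klm by (auto simp: G_def)
  have XF: "X (nb k G) = X G - 1" and YF: "Y (nb k G) = Y G + 1"
    using X_nb_F[of k] Y_nb_F[of k] Y_F GF by (auto simp: G_def)
  have no_lmin: "\<not> lmin X G" "\<not> lmin Y G" "\<not> lmin (- X) G" "\<not> lmin (- Y) G"
    using l Ym XF lminD[of X G k] lminD[of Y G m] lminD[of "- X" G l] lminD[of "- Y" G l] Yl G_def by auto
  have pX: "points (- X) G l" and pY: "points Y G m"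
    unfolding points_def using l m XF Yl Ym YF all_dir_distinct[OF klm] G_def klm by auto
  have nU: "\<not> hasU X G" "\<not> hasU (- Y) G"
    using hasU_neg_points[OF pX] hasU_neg_points[OF pY] by auto
  have gs: "gU Y G - gU X G + (gU (- X) G - gU (- Y) G)
      = (if hasU Y G then 1/3 else 0) + (if hasU (- X) G then 1/3 else 0)"
    using no_lmin nU by (simp add: gU_def)
  have "\<not> points Y (nb m G) m" using points_at[of Y "nb m G" m] Ym by auto
  then have qm: "qU k m = 0" by (simp add: qU_def G_def)
  have "\<not> points (- X) (nb l G) l" using points_at[of "- X" "nb l G" l] l G_def by auto
  then have q'l: "q' l = 0" by (simp add: hex_flip.qU_def[OF hex_flip_neg] G_def q'_def)
  have qk: "qU k k = 0" "q' k = 0"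
    by (simp_all add: qU_def q'_def hex_flip.qU_def[OF hex_flip_neg])
  have "(\<Sum>i\<in>UNIV. qU k i + q' i) = (\<Sum>i\<in>{k, l, m}. qU k i + q' i)"
    using klm by (intro sum.cong) (cases k; cases l; cases m; auto simp: dir_UNIV)+
  also have "\<dots> = qU k l + q' m" using klm qk q'l qm by simp
  finally have sum: "(\<Sum>i\<in>UNIV. qU k i + q' i) = qU k l + q' m" .
  have far_l: "nb l G \<noteq> nb j F" for j
    using l X_nb_F[of j] X_nb_F[of k] by (auto simp: G_def)
  have far_m: "nb m G \<noteq> nb j F" for j
    using m X_nb_F[of j] X_nb_F[of k] by (auto simp: G_def)
  have ne: "nb l G \<noteq> F" "nb m G \<noteq> F"
    using nb_eq[of l G k] nb_eq[of m G k] GF klm by auto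
  have A1: "\<not> hasU (- X) G" if "points Y (nb l G) l"
  proof
    assume "hasU (- X) G"
    then have "hasU (- X) (nb l G)"
    proof (cases rule: hasU.cases)
      case (hasU_points k')
      then show ?thesis using points_unique[OF pX] by metis
    qed (use no_lmin in simp)
    moreover have "points X (nb l G) l" using far_lmin(2)[OF ne(1)] far_l that by blast
    ultimately show False using hasU_neg_points by blast
  qed
  have A2: "\<not> hasU Y G" if "points (- X) (nb m G) m"
  proof
    assume "hasU Y G"
    then have "hasU Y (nb m G)"
    proof (cases rule: hasU.cases)
      case (hasU_points k')
      then show ?thesis using points_unique[OF pY] by metis
    qed (use no_lmin in simp)
    moreover have "points (- Y) (nb m G) m" using far_lmin(4)[OF ne(2)] far_m that by blast
    ultimately show False using hasU_neg_points[of "- Y"] by simp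
  qed
  have "qU k l \<le> (if points Y (nb l G) l \<and> hasU Y G then 1 / 3 else 0)"
    by (simp add: qU_def G_def)
  moreover have "q' m \<le> (if points (- X) (nb m G) m \<and> hasU (- X) G then 1 / 3 else 0)"
    by (simp add: q'_def hex_flip.qU_def[OF hex_flip_neg] G_def)
  ultimately have "gU Y G - gU X G + (gU (- X) G - gU (- Y) G) + (\<Sum>i\<in>UNIV. qU k i + q' i) \<le> 2 / 3"
    unfolding gs sum using A1 A2 by (auto split: if_splits)
  then show ?thesis unfolding G_def q'_def .
qed

lemma gU_flip_near:
  "gU Y (nb k F) - gU X (nb k F) + (gU (- X) (nb k F) - gU (- Y) (nb k F))
    + (\<Sum>l\<in>UNIV. qU k l + hex_flip.qU nb S (- Y) F (- X) k l) \<le> 2 / 3"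
proof (cases "nb k F \<in> S")
  case False
  then have "\<not> hasU Z (nb k F)" for Z using hasU_in by blast
  then show ?thesis
    using False by (simp add: gU_def qU_def hex_flip.qU_def[OF hex_flip_neg])
next
  case G: True
  obtain l where "k \<noteq> l" by (metis dir.distinct(1))
  then obtain m where "l \<noteq> m" "m \<noteq> k" using third_dir by blast
  note klm = \<open>k \<noteq> l\<close> \<open>l \<noteq> m\<close> \<open>m \<noteq> k\<close>
  interpret neg: hex_flip nb S "- Y" F "- X" by (rule hex_flip_neg)
  have ne: "nb i (nb k F) \<noteq> F" if "i \<noteq> k" for i using nb_eq[of i "nb k F" k] that by simp
  consider "X (nb l (nb k F)) = X (nb k F) + 1" "X (nb m (nb k F)) = X (nb k F) + 1"
    | "X (nb l (nb k F)) = X (nb k F) - 1" "X (nb m (nb k F)) = X (nb k F) - 1"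
    | "X (nb l (nb k F)) = X (nb k F) + 1" "X (nb m (nb k F)) = X (nb k F) - 1"
    | "X (nb l (nb k F)) = X (nb k F) - 1" "X (nb m (nb k F)) = X (nb k F) + 1"
    using states_step[OF X G, of l] states_step[OF X G, of m] by blast
  then show ?thesis
  proof cases
    case 1
    show ?thesis
    proof (rule gU_flip_near_up[OF G])
      fix i show "i \<noteq> k \<Longrightarrow> X (nb i (nb k F)) = X (nb k F) + 1"
        using 1 klm by (cases i; cases k; cases l; cases m; simp)
    qed
  next
    case 2
    have "(- Y) (nb i (nb k F)) = (- Y) (nb k F) + 1" if "i \<noteq> k" for i
    proof -
      have "X (nb i (nb k F)) = X (nb k F) - 1"
        using 2 klm that by (cases i; cases k; cases l; cases m; simp)
      then show ?thesis using Y_other[OF ne[OF that]] Y_other[OF nb_F] by simp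
    qed
    from neg.gU_flip_near_up[OF G this] show ?thesis by (simp add: algebra_simps)
  next
    case 3
    then show ?thesis using gU_flip_near_mixed[OF G klm] by simp
  next
    case 4
    then show ?thesis using gU_flip_near_mixed[OF G, of m l] klm by simp
  qed
qed

lemma gU_flip_outside: "f \<notin> S \<Longrightarrow> gU Z f = 0"
  using hasU_in by (auto simp: gU_def)

lemma drift_flip:
  "(\<Sum>f\<in>S. gU Y f - gU (- Y) f) \<le> (\<Sum>f\<in>S. gU X f - gU (- X) f)"
proof -
  interpret neg: hex_flip nb S "- Y" F "- X" by (rule hex_flip_neg)
  define c where "c f = gU Y f - gU X f + (gU (- X) f - gU (- Y) f)" for f
  define q where "q k l = qU k l + neg.qU k l" for k l
  define N where "N = range (\<lambda>k. nb k F)"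
  have c_F: "c F = - 2" using gU_flip_F neg.gU_flip_F by (simp add: c_def)
  have q_nonneg: "0 \<le> q k l" for k l using qU_nonneg neg.qU_nonneg by (simp add: q_def)
  have finN: "finite N" by (simp add: N_def)
  have far: "c f \<le> (\<Sum>k\<in>UNIV. \<Sum>l\<in>UNIV. if f = nb l (nb k F) then q k l else 0)"
    if "f \<noteq> F" "f \<notin> N" for f
  proof -
    have n: "f \<noteq> nb k F" for k using that by (auto simp: N_def)
    have "c f \<le> (\<Sum>k\<in>UNIV. \<Sum>l\<in>UNIV. if f = nb l (nb k F) then qU k l else 0)
        + (\<Sum>k\<in>UNIV. \<Sum>l\<in>UNIV. if f = nb l (nb k F) then neg.qU k l else 0)"
      using gU_flip_far[OF that(1) n] neg.gU_flip_far[OF that(1) n] by (simp add: c_def)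
    also have "\<dots> = (\<Sum>k\<in>UNIV. \<Sum>l\<in>UNIV. if f = nb l (nb k F) then q k l else 0)"
      by (simp add: q_def sum.distrib[symmetric] if_distrib cong: if_cong)
    finally show ?thesis .
  qed
  have FN: "F \<notin> N" unfolding N_def using nb_F by (metis rangeE)
  \<comment> \<open>Faces outside \<open>S\<close> contribute 0, so all three neighbours of
    \<open>F\<close> may be counted.\<close>
  have "(\<Sum>f\<in>S. c f) = (\<Sum>f\<in>S \<union> N. c f)"
    by (rule sum.mono_neutral_left)
      (use finite_S finN in \<open>auto simp: c_def gU_flip_outside\<close>)
  also have "\<dots> = c F + (\<Sum>f\<in>N. c f) + (\<Sum>f\<in>S - N - {F}. c f)"
  proof -
    have "S \<union> N = {F} \<union> (N \<union> (S - N - {F}))" using F by auto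
    moreover have "sum c (N \<union> (S - N - {F})) = sum c N + sum c (S - N - {F})"
      by (rule sum.union_disjoint) (use finN finite_S in auto)
    ultimately show ?thesis
      using FN finN finite_S by simp
  qed
  also have "(\<Sum>f\<in>N. c f) = (\<Sum>k\<in>UNIV. c (nb k F))"
    unfolding N_def by (subst sum.reindex) (auto intro: injI)
  also have "(\<Sum>f\<in>S - N - {F}. c f)
      \<le> (\<Sum>f\<in>S - N - {F}. \<Sum>k\<in>UNIV. \<Sum>l\<in>UNIV. if f = nb l (nb k F) then q k l else 0)"
    by (intro sum_mono far) auto
  also have "\<dots> = (\<Sum>k\<in>UNIV. \<Sum>l\<in>UNIV. \<Sum>f\<in>S - N - {F}. if f = nb l (nb k F) then q k l else 0)"
    by (subst sum.swap, intro sum.cong refl, rule sum.swap)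
  also have "\<dots> \<le> (\<Sum>k\<in>UNIV. \<Sum>l\<in>UNIV. q k l)"
    by (intro sum_mono) (use finite_S q_nonneg in \<open>auto simp: sum.delta'\<close>)
  also have "c F + (\<Sum>k\<in>UNIV. c (nb k F)) + (\<Sum>k\<in>UNIV. \<Sum>l\<in>UNIV. q k l)
      = - 2 + (\<Sum>k\<in>UNIV. c (nb k F) + (\<Sum>l\<in>UNIV. q k l))"
    by (simp add: c_F sum.distrib)
  also have "\<dots> \<le> - 2 + (\<Sum>k\<in>(UNIV :: dir set). 2 / 3)"
    by (intro add_left_mono sum_mono) (use gU_flip_near in \<open>simp add: c_def q_def\<close>)
  also have "\<dots> = 0" by (simp add: dir_UNIV)
  finally have "(\<Sum>f\<in>S. c f) \<le> 0" by simp
  then show ?thesis by (simp add: c_def sum.distrib sum_subtractf)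
qed

end

section \<open>Distinct comparable states have different towers\<close>

context hex_region
begin

text \<open>A pointer path that does not bounce back after its first step never gets stuck: getting
  stuck would force the heights around one vertex to drop three times in a row, which leaves no
  room to climb back.\<close>

lemma hasU_descend:
  assumes Z: "Z \<in> states"
    and I: "\<And>q. q \<in> I \<Longrightarrow> q \<in> S" "\<And>q j. q \<in> I \<Longrightarrow> Z (nb j q) = Z q - 1 \<Longrightarrow> nb j q \<in> I"
    and "points Z p k" "nb k p \<in> I" "j \<noteq> k" "Z (nb j (nb k p)) = Z (nb k p) + 1"
  shows "hasU Z (nb k p)"
  using assms(4-)
proof (induction "card {g \<in> S. Z g < Z (nb k p)}" arbitrary: p k j rule: less_induct)
  case less
  define q where "q = nb k p"
  have qS: "q \<in> S" using I less.prems(2) q_def by blast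
  have qp: "nb k q = p" "Z p = Z q + 1" using points_at[OF less.prems(1)] q_def by auto
  obtain l where l: "k \<noteq> l" "j \<noteq> l" using third_dir[of k j] less.prems(3) by metis
  have kjl: "k \<noteq> j" "j \<noteq> l" "l \<noteq> k" using l less.prems(3) by auto
  have j: "Z (nb j q) = Z q + 1" using less.prems(4) q_def by simp
  show ?case
  proof (cases "Z (nb l q) = Z q + 1")
    case True
    then have "lmin Z q" unfolding lmin_def all_dir_distinct[OF kjl] using qp j by simp
    then show ?thesis using hasU.hasU_lmin qS q_def by simp
  next
    case False
    then have zl: "Z (nb l q) = Z q - 1" using states_step[OF Z qS, of l] by simp
    have pt: "points Z q l" unfolding points_def all_dir_distinct[OF kjl] using qp j zl by simp
    define r where "r = nb l q"
    have rI: "r \<in> I" using I(2) less.prems(2) zl r_def q_def by simp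
    have rS: "r \<in> S" using I rI by simp
    have "Z (nb j r) = Z r + 1"
    proof (rule ccontr)
      assume "Z (nb j r) \<noteq> Z r + 1"
      then have s: "Z (nb j r) = Z r - 1" using states_step[OF Z rS, of j] by simp
      define s' where "s' = nb j r"
      have "nb j (nb l (nb k (nb j (nb l (nb k p))))) = p"
        by (rule hexagon) (use kjl in auto)
      then have "nb j (nb l (nb k s')) = p" by (simp add: s'_def r_def q_def)
      then have "nb l (nb k s') = nb j p" by (metis nb_nb)
      moreover have "Z (nb j p) = Z p + 1" using points_off[OF less.prems(1,3)] .
      moreover have "\<bar>Z (nb l (nb k s')) - Z (nb k s')\<bar> \<le> 1" "\<bar>Z (nb k s') - Z s'\<bar> \<le> 1"
        by (rule states_lip[OF Z])+
      ultimately show False using s zl qp by (simp add: s'_def r_def)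
    qed
    moreover have "card {g \<in> S. Z g < Z (nb l q)} < card {g \<in> S. Z g < Z (nb k p)}"
    proof (rule psubset_card_mono)
      show "finite {g \<in> S. Z g < Z (nb k p)}" using finite_S by simp
      have "r \<in> {g \<in> S. Z g < Z (nb k p)}" "r \<notin> {g \<in> S. Z g < Z (nb l q)}"
        using zl rS q_def r_def by simp_all
      moreover have "{g \<in> S. Z g < Z (nb l q)} \<subseteq> {g \<in> S. Z g < Z (nb k p)}"
        using zl by (simp add: q_def[symmetric] Collect_mono)
      ultimately show "{g \<in> S. Z g < Z (nb l q)} \<subset> {g \<in> S. Z g < Z (nb k p)}" by blast
    qed
    ultimately have "hasU Z (nb l q)"
      using less.hyps[of l q j] pt rI l by (simp add: r_def)
    then show ?thesis using hasU.hasU_points[OF qS pt] q_def by simp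
  qed
qed

text \<open>Look at the highest face \<open>F\<close> of \<open>Y\<close> next to which \<open>Y - X\<close> changes. Above \<open>F\<close> the two states agree up to
  a constant, so the pointers of \<open>Y\<close> lead from \<open>F\<close> to a local maximum unless they bounce back at once.
  In that case the heights around a vertex of \<open>F\<close> are forced, and they produce either a local maximum
  \<open>K\<close> of \<open>X\<close> that is none of \<open>Y\<close>, or a tower of \<open>X\<close> that starts at \<open>F\<close>.\<close>

lemma states_eq_of_same_towers:
  assumes X: "X \<in> states" and Y: "Y \<in> states" and le: "X \<le> Y"
    and same_lmin: "\<And>f. f \<in> S \<Longrightarrow> lmin X f \<longleftrightarrow> lmin Y f"
    and same_lmax: "\<And>f. f \<in> S \<Longrightarrow> lmin (- X) f \<longleftrightarrow> lmin (- Y) f"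
    and same_U: "\<And>f. hasU X f \<longleftrightarrow> hasU Y f"
    and same_D: "\<And>f. hasU (- X) f \<longleftrightarrow> hasU (- Y) f"
  shows "X = Y"
proof (rule ccontr)
  assume "X \<noteq> Y"
  define d where "d f = Y f - X f" for f
  define Nf where "Nf = {f. \<exists>k. d (nb k f) \<noteq> d f}"
  have d_nonneg: "0 \<le> d f" for f using le by (simp add: d_def le_fun_def)
  have d_out: "f \<notin> S \<Longrightarrow> d f = 0" for f using X Y by (simp add: d_def states_outside)
  have flat: "d (nb k f) = d f" if "f \<notin> Nf" for f k using that by (auto simp: Nf_def)
  have "Nf \<noteq> {}"
  proof
    assume "Nf = {}"
    then have fl: "d (nb k g) = d g" for g k using flat by blast
    have "\<not> d f \<noteq> 0" for f
      by (rule no_closed_subset) (use d_out fl in auto)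
    then have "X = Y" by (intro ext) (simp add: d_def)
    then show False using \<open>X \<noteq> Y\<close> by simp
  qed
  moreover have "finite Nf"
  proof (rule finite_subset)
    show "Nf \<subseteq> S \<union> (\<Union>k. nb k ` S)"
    proof
      fix f assume "f \<in> Nf"
      then obtain k where "d (nb k f) \<noteq> d f" by (auto simp: Nf_def)
      then have "f \<in> S \<or> nb k f \<in> S" using d_out by metis
      moreover have "f = nb k (nb k f)" by simp
      ultimately show "f \<in> S \<union> (\<Union>k. nb k ` S)" by blast
    qed
  qed (simp add: finite_S)
  ultimately have "Max (Y ` Nf) \<in> Y ` Nf" "\<And>g. g \<in> Nf \<Longrightarrow> Y g \<le> Max (Y ` Nf)" by auto
  then obtain F where F: "F \<in> Nf" "\<And>g. g \<in> Nf \<Longrightarrow> Y g \<le> Y F" by auto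
  have flat_above: "d (nb k f) = d f" if "Y F < Y f" for f k using flat F(2) that by force
  \<comment> \<open>The face \<open>nb k F\<close> lies in \<open>Nf\<close> too, so by the choice
    of \<open>F\<close> it is lower in \<open>Y\<close>; as the difference changes, the step of
    \<open>X\<close> goes the other way.\<close>
  have drop: "Y (nb k F) = Y F - 1 \<and> X (nb k F) = X F + 1" if "d (nb k F) \<noteq> d F" for k
  proof -
    have live: "F \<in> S \<or> nb k F \<in> S" using that d_out by metis
    have "nb k F \<in> Nf" using that unfolding Nf_def by (auto intro!: exI[of _ k])
    then have "Y (nb k F) \<le> Y F" using F(2) by simp
    then have "Y (nb k F) = Y F - 1" using states_step_iff[OF Y live] by auto
    then show ?thesis using states_step_iff[OF X live] that by (auto simp: d_def)
  qed
  have lmin_flat: "f \<notin> Nf" if "f \<in> S" "lmin X f" for f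
    using that same_lmin[OF that(1)] by (auto simp: Nf_def d_def lmin_def)
  have lmax_flat: "f \<notin> Nf" if "f \<in> S" "lmin (- X) f" for f
  proof -
    have "lmin (- Y) f" using that same_lmax by simp
    then have "d (nb k f) = d f" for k
      using lminD[OF that(2), of k] lminD[of "- Y" f k] by (simp add: d_def)
    then show ?thesis by (simp add: Nf_def)
  qed
  from F(1) obtain k where k: "d (nb k F) \<noteq> d F" by (auto simp: Nf_def)
  define O' where "O' = nb k F"
  have O: "nb k O' = F" "Y O' = Y F - 1" "X O' = X F + 1" using drop[OF k] by (auto simp: O'_def)
  have O_Nf: "O' \<in> Nf" using k unfolding Nf_def O'_def by (auto intro!: exI[of _ k])
  have dF: "2 \<le> d F" using O d_nonneg[of O'] by (simp add: d_def)
  then have FS: "F \<in> S" using d_out[of F] by force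
  have "\<not> lmin (- Y) F" using lmax_flat same_lmax F(1) FS by blast
  then obtain l where "(- Y) (nb l F) \<noteq> (- Y) F + 1" unfolding lmin_def by blast
  then have "Y (nb l F) \<noteq> Y F - 1" by simp
  then have Yl: "Y (nb l F) = Y F + 1" using states_step[OF Y FS, of l] by simp
  then have "l \<noteq> k" using O by (auto simp: O'_def)
  have dl: "d (nb l F) = d F" using drop[of l] Yl by auto
  then have Xl: "X (nb l F) = X F + 1" using Yl by (simp add: d_def)
  obtain m where "l \<noteq> m" "m \<noteq> k" using third_dir[of k l] \<open>l \<noteq> k\<close> by metis
  then have klm: "k \<noteq> l" "l \<noteq> m" "m \<noteq> k" using \<open>l \<noteq> k\<close> by auto
  have "\<not> lmin X F" using lmin_flat F(1) FS by blast
  then have "X (nb m F) \<noteq> X F + 1" using O Xl unfolding lmin_def all_dir_distinct[OF klm] by (auto simp: O'_def)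
  then have Xm: "X (nb m F) = X F - 1" using states_step[OF X FS, of m] by simp
  have dm: "d (nb m F) = d F" using drop[of m] Xm by auto
  then have Ym: "Y (nb m F) = Y F - 1" using Xm by (simp add: d_def)
  have pX: "points X F m" unfolding points_def all_dir_distinct[OF klm] using O Xl Xm klm by (auto simp: O'_def)
  have pY: "points (- Y) F l" unfolding points_def all_dir_distinct[OF klm] using O Yl Ym klm by (auto simp: O'_def)
  \<comment> \<open>\<open>F\<close> can start only an up tower in \<open>X\<close> and only a down
    tower in \<open>Y\<close>; both states have the same towers, so it starts none.\<close>
  have noD: "\<not> hasU (- Y) F" using hasU_neg_points[OF pX] same_D by simp
  have noU: "\<not> hasU X F" using hasU_neg_points[OF pY] same_U by simp
  define P2 where "P2 = nb l F"
  define P1 where "P1 = nb m F"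
  have P2: "nb l P2 = F" "Y P2 = Y F + 1" "d P2 = d F" using Yl dl by (auto simp: P2_def)
  have P2S: "P2 \<in> S" using P2 dF d_out[of P2] by force
  have P1S: "P1 \<in> S" using dm dF d_out[of P1] by (force simp: P1_def)
  \<comment> \<open>Otherwise the pointers of \<open>- Y\<close> lead on from \<open>P2\<close> and
    yield a down tower at \<open>F\<close>. They stay above \<open>F\<close>, where the difference
    keeps the positive value \<open>d F\<close>, hence inside \<open>S\<close>.\<close>
  have up: "Y (nb j P2) = Y P2 + 1" if "j \<noteq> l" for j
  proof (rule ccontr)
    assume "Y (nb j P2) \<noteq> Y P2 + 1"
    then have "(- Y) (nb j P2) = (- Y) P2 + 1" using states_step[OF Y P2S, of j] by simp
    have "hasU (- Y) (nb l F)"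
    proof (rule hasU_descend[OF states_neg[OF Y], of "{q. Y F < Y q \<and> d q = d F}"])
      show "q \<in> S" if "q \<in> {q. Y F < Y q \<and> d q = d F}" for q
        using that dF d_out[of q] by force
      show "nb i q \<in> {q. Y F < Y q \<and> d q = d F}"
        if "q \<in> {q. Y F < Y q \<and> d q = d F}" "(- Y) (nb i q) = (- Y) q - 1" for q i
        using that flat_above[of q i] by simp
      show "nb l F \<in> {q. Y F < Y q \<and> d q = d F}" using P2 by (simp add: P2_def)
    qed (use pY that \<open>(- Y) (nb j P2) = (- Y) P2 + 1\<close> in \<open>simp_all add: P2_def\<close>)
    then show False using hasU.hasU_points[OF FS pY] noD by simp
  qed
  \<comment> \<open>The faces \<open>O'\<close>, \<open>F\<close>, \<open>P2\<close>,
    \<open>A'\<close>, \<open>B'\<close>, \<open>C'\<close> surround one vertex; their heights in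
    \<open>Y\<close>, relative to \<open>F\<close>, are forced to be -1, 0, 1, 2, 1, 0.\<close>
  define A' where "A' = nb m P2"
  define B' where "B' = nb k A'"
  define C' where "C' = nb m O'"
  have YA: "Y A' = Y F + 2" using up[of m] klm P2 by (simp add: A'_def)
  have "nb m (nb l (nb k (nb m (nb l (nb k O'))))) = O'"
    by (rule hexagon) (use klm in auto)
  then have "nb m (nb l B') = O'" by (simp add: O P2_def A'_def B'_def)
  then have C: "nb l B' = C'" "nb l C' = B'" by (metis C'_def nb_nb)+
  have lipY: "\<bar>Y (nb i f) - Y f\<bar> \<le> 1" and lipX: "\<bar>X (nb i f) - X f\<bar> \<le> 1" for i f
    using states_lip X Y by auto
  have YBC: "Y B' = Y F + 1" "Y C' = Y F"
    using lipY[of k A'] lipY[of l B'] lipY[of m O'] YA O C unfolding B'_def C'_def[symmetric]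
    by (auto simp: B'_def)
  have dA: "d A' = d F" using flat_above[of P2 m] P2 by (simp add: A'_def)
  have dB: "d B' = d F" using flat_above[of A' k] YA dA by (simp add: B'_def)
  have dC: "d C' = d F" using flat_above[of B' l] YBC dB C by simp
  have XC: "X C' = X F" "X B' = X F + 1" using dC dB YBC by (auto simp: d_def)
  have CS: "C' \<in> S" using dC dF d_out[of C'] by force
  \<comment> \<open>\<open>K\<close> is the third neighbour of \<open>O'\<close>, besides
    \<open>F\<close> and \<open>C'\<close>.\<close>
  define K where "K = nb l O'"
  have KO: "nb l K = O'" by (simp add: K_def)
  have "nb l (nb m (nb k (nb l (nb m (nb k O'))))) = O'"
    by (rule hexagon) (use klm in auto)
  then have "nb l (nb m (nb k (nb l P1))) = O'" by (simp add: O P1_def)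
  then have W: "nb m (nb k (nb l P1)) = K" by (metis K_def nb_nb)
  then have W2: "nb m K = nb k (nb l P1)" by (metis nb_nb)
  have XP1: "X P1 = X F - 1" using Xm by (simp add: P1_def)
  show False
  proof (cases "O' \<in> S")
    case True
    have "X K = X O' + 1"
    proof (rule ccontr)
      assume "X K \<noteq> X O' + 1"
      then have "X K = X O' - 1" using states_step[OF X True, of l] K_def by simp
      then have "lmin (- X) O'"
        unfolding lmin_def all_dir_distinct[OF klm] using O XC by (simp add: K_def C'_def[symmetric])
      then show False using lmax_flat True O_Nf by blast
    qed
    have "Y K = Y O' - 1"
    proof (rule ccontr)
      assume "Y K \<noteq> Y O' - 1"
      then have "Y K = Y O' + 1" using states_step[OF Y True, of l] K_def by simp
      then have "lmin Y O'"
        unfolding lmin_def all_dir_distinct[OF klm] using O YBC by (simp add: K_def C'_def[symmetric])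
      then show False using lmin_flat same_lmin True O_Nf by blast
    qed
    \<comment> \<open>Two crossings lead from \<open>P1\<close>, which is 1 below \<open>F\<close>
      in \<open>X\<close>, to \<open>nb m K\<close>, so \<open>X (nb m K)\<close> is at most
      \<open>X F + 1\<close>, one below \<open>X K\<close>.\<close>
    have XW: "X (nb m K) = X K - 1"
      using lipX[of l P1] lipX[of k "nb l P1"] lipX[of m K] XP1 O \<open>X K = X O' + 1\<close>
      unfolding W2 by linarith
    have "C' \<in> Nf" using dC O dF unfolding Nf_def by (auto simp: C'_def d_def intro!: exI[of _ m])
    have "X (nb k C') = X C' - 1"
    proof (rule ccontr)
      assume "X (nb k C') \<noteq> X C' - 1"
      then have "X (nb k C') = X C' + 1" using states_step[OF X CS, of k] by simp
      then have "lmin X C'"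
        unfolding lmin_def all_dir_distinct[OF klm] using O XC C by (simp add: C'_def)
      then show False using lmin_flat CS \<open>C' \<in> Nf\<close> by blast
    qed
    have "nb l (nb k (nb m (nb l (nb k (nb m O'))))) = O'"
      by (rule hexagon) (use klm in auto)
    then have W': "nb k (nb m (nb l (nb k C'))) = K" by (metis K_def C'_def nb_nb)
    then have W2': "nb k K = nb m (nb l (nb k C'))" by (metis nb_nb)
    have XW': "X (nb k K) = X K - 1"
      using lipX[of l "nb k C'"] lipX[of m "nb l (nb k C')"] lipX[of k K] O XC
        \<open>X (nb k C') = X C' - 1\<close> \<open>X K = X O' + 1\<close>
      unfolding W2' by linarith
    have max: "lmin (- X) K"
      unfolding lmin_def all_dir_distinct[OF klm] using XW XW' KO \<open>X K = X O' + 1\<close> by simp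
    \<comment> \<open>Outside \<open>S\<close> the height of \<open>K\<close> would be 0, so its
      three neighbours, one lower, would all lie in \<open>S\<close>.\<close>
    have "K \<in> S"
    proof (rule ccontr)
      assume "K \<notin> S"
      then have "nb j K \<in> S" for j
        using lminD[OF max, of j] states_outside[OF X, of K] states_outside[OF X, of "nb j K"] by force
      then show False using no_hole \<open>K \<notin> S\<close> by blast
    qed
    then have "lmin (- Y) K" using max same_lmax by simp
    from lminD[OF this, of l] show False using KO \<open>Y K = Y O' - 1\<close> by simp
  next
    case False
    have XO: "X O' = 0" using states_outside[OF X False] .
    have "K \<notin> S"
    proof
      assume "K \<in> S"
      have "nb j O' \<in> S" for j
        using \<open>K \<in> S\<close> CS FS O all_dir_distinct[OF klm, of "\<lambda>j. nb j O' \<in> S"] by (simp add: K_def C'_def)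
      then show False using no_hole False by blast
    qed
    then have "X K = 0" using states_outside[OF X] by simp
    \<comment> \<open>Now \<open>X P1\<close> is -2, and \<open>K\<close> with height 0 is two
      crossings away from \<open>nb l P1\<close>, so that face cannot have height -3. Hence the
      pointers of \<open>X\<close> continue from \<open>P1\<close>, through negative heights and
      therefore inside \<open>S\<close>.\<close>
    then have "X (nb l P1) = X P1 + 1"
      using lipX[of k "nb l P1"] lipX[of m "nb k (nb l P1)"] XP1 O XO states_step[OF X P1S, of l]
      unfolding W by linarith
    then have "hasU X (nb m F)"
      using hasU_descend[OF X, of "{q. X q < 0}" F m l] states_outside[OF X] pX klm Xm O XO
      by (force simp: P1_def)
    then show False using hasU.hasU_points[OF FS pX] noU by simp
  qed
qed

end

section \<open>The monotone random map\<close>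

context hex_region
begin

section \<open>The tower at a face and its acceptance\<close>

definition tow :: "('f \<Rightarrow> int) \<Rightarrow> 'f \<Rightarrow> 'f list" where
  "tow X f = (if hasU X f then THE T. utower X T \<and> hd T = f else [])"

lemma tow_eqI: "utower X T \<Longrightarrow> hd T = f \<Longrightarrow> tow X f = T"
proof -
  assume T: "utower X T" "hd T = f"
  then obtain T' where "T = f # T'" using utower_not_Nil by (cases T) auto
  then have "hasU X f" using T by (auto simp: hasU_iff)
  moreover have "(THE T. utower X T \<and> hd T = f) = T"
    using T utower_unique by (intro the_equality) auto
  ultimately show ?thesis by (simp add: tow_def)
qed

lemma tow_utower: "hasU X f \<Longrightarrow> utower X (tow X f) \<and> hd (tow X f) = f"
proof -
  assume "hasU X f"
  then obtain T where "utower X (f # T)" by (auto simp: hasU_iff)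
  then show ?thesis using tow_eqI[of X "f # T" f] by simp
qed

lemma tow_Nil: "\<not> hasU X f \<Longrightarrow> tow X f = []"
  by (simp add: tow_def)

lemma tow_subset: "set (tow X f) \<subseteq> S"
  using tow_utower[of X f] tow_Nil[of X f] utower_subset by (cases "hasU X f") auto

lemma tow_distinct: "distinct (tow X f)"
  using tow_utower[of X f] tow_Nil[of X f] utower_distinct by (cases "hasU X f") auto

lemma tow_length_le: "length (tow X f) \<le> card S"
  using distinct_card[OF tow_distinct, of X f] card_mono[OF finite_S tow_subset, of X f] by simp

lemma tow_length_0: "length (tow X f) = 0 \<longleftrightarrow> \<not> hasU X f"
  using tow_utower[of X f] tow_Nil[of X f] utower_not_Nil by auto

lemma tow_length_1: "length (tow X f) = 1 \<longleftrightarrow> f \<in> S \<and> lmin X f"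
proof
  assume "f \<in> S \<and> lmin X f"
  then have "tow X f = [f]" by (intro tow_eqI utower.utower_single) auto
  then show "length (tow X f) = 1" by simp
next
  assume len: "length (tow X f) = 1"
  then have "hasU X f" using tow_length_0[of X f] by simp
  then have "utower X (tow X f)" "hd (tow X f) = f" using tow_utower by auto
  then show "f \<in> S \<and> lmin X f"
    using len by (cases rule: utower.cases) auto
qed

text \<open>A number \<open>u\<close> drawn uniformly below \<open>ub\<close> accepts a tower of length \<open>h \<ge> 2\<close> with probability exactly
  \<open>1/(3h)\<close> because \<open>3 * h\<close> divides \<open>ub\<close>; shorter towers are accepted whenever longer ones are.\<close>

definition ub :: nat where "ub = 3 * fact (card S)"

definition acc :: "nat \<Rightarrow> nat \<Rightarrow> bool" where
  "acc h u \<longleftrightarrow> h = 1 \<or> 3 * h * u < ub"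

lemma ub_pos: "0 < ub" by (simp add: ub_def)

lemma acc_antimono: "acc h u \<Longrightarrow> 1 \<le> h' \<Longrightarrow> h' \<le> h \<Longrightarrow> acc h' u"
proof -
  assume a: "acc h u" "1 \<le> h'" "h' \<le> h"
  show ?thesis
  proof (cases "h = 1")
    case False
    have "3 * h' * u \<le> 3 * h * u" using a by (intro mult_right_mono) auto
    moreover have "3 * h * u < ub" using a False by (simp add: acc_def)
    ultimately have "3 * h' * u < ub" by (rule le_less_trans)
    then show ?thesis by (simp add: acc_def)
  qed (use a in \<open>auto simp: acc_def\<close>)
qed

lemma card_acc:
  assumes "2 \<le> h" "h \<le> card S"
  shows "real (card {u. u < ub \<and> acc h u}) = real ub / (3 * real h)"
proof -
  have "h dvd fact (card S)" using assms by (intro dvd_fact) auto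
  then obtain q where q: "fact (card S) = h * q" by (auto simp: dvd_def)
  then have ub: "ub = 3 * h * q" by (simp add: ub_def)
  have "u < ub \<and> acc h u \<longleftrightarrow> u < q" for u
  proof -
    have "q \<le> ub" using assms ub by simp
    moreover have "3 * h * u < ub \<longleftrightarrow> u < q"
      unfolding ub by (subst mult_less_cancel1) (use assms in auto)
    ultimately show ?thesis using assms by (auto simp: acc_def)
  qed
  then show ?thesis using assms by (simp add: ub)
qed

definition gain :: "nat \<Rightarrow> nat \<Rightarrow> real" where
  "gain h u = (if acc h u then real h else 0)"

lemma sum_if_acc:
  "(\<Sum>u<ub. if acc h u then c else 0) = c * real (card {u. u < ub \<and> acc h u})" for c :: real
  by (simp add: sum.If_cases lessThan_def Int_def Collect_conj_eq[symmetric] conj_commute)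

lemma sum_gain:
  assumes "h \<le> card S"
  shows "(\<Sum>u<ub. gain h u) = real ub * (if h = 0 then 0 else if h = 1 then 1 else 1 / 3)"
proof -
  consider "h = 0" | "h = 1" | "2 \<le> h" by linarith
  then show ?thesis
  proof cases
    case 3
    then show ?thesis
      using card_acc[OF 3 assms] by (simp add: gain_def sum_if_acc)
  qed (auto simp: gain_def acc_def)
qed

lemma sum_gain_tow:
  "(\<Sum>u<ub. gain (length (tow X f)) u) = real ub * gU X f"
  using sum_gain[OF tow_length_le, of X f] tow_length_0[of X f] tow_length_1[of X f]
  by (auto simp: gU_def)

text \<open>The accepting numbers are nested: both towers move for those accepting the longer one,
  only the shorter one moves for the rest of its own. For \<open>h \<ge> 2\<close> the mean square
  is thus h^2/(3h) + ((h' - h)^2 - h^2)/(3h') = (h' - h)/3. A tower of length 1, which is always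
  accepted, only adds to this.\<close>

lemma sum_gain_diff_less:
  assumes "h < h'" "h' \<le> card S"
  shows "real ub / 3 \<le> (\<Sum>u<ub. (gain h' u - gain h u)\<^sup>2)"
proof (cases "h = 0")
  case True
  have c: "real ub / (3 * real h') \<le> real (card {u. u < ub \<and> acc h' u})"
  proof (cases "h' = 1")
    case True
    then show ?thesis by (simp add: acc_def)
  next
    case False
    then show ?thesis using card_acc[of h'] assms by simp
  qed
  have "real ub / 3 = real h' * (real ub / (3 * real h'))" using assms by simp
  also have "\<dots> \<le> real h' ^ 2 * (real ub / (3 * real h'))"
    using assms by (intro mult_right_mono) (auto simp: power2_eq_square mult_le_cancel_left1)
  also have "\<dots> \<le> real h' ^ 2 * real (card {u. u < ub \<and> acc h' u})"
    using c by (intro mult_left_mono) auto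
  also have "\<dots> = (\<Sum>u<ub. if acc h' u then real h' ^ 2 else 0)" by (simp add: sum_if_acc)
  also have "\<dots> = (\<Sum>u<ub. (gain h' u - gain h u)\<^sup>2)"
    using True by (intro sum.cong) (auto simp: gain_def)
  finally show ?thesis .
next
  case False
  then have h: "1 \<le> h" "2 \<le> h'" using assms by auto
  let ?a = "real h" and ?b = "real h'"
  have c': "real (card {u. u < ub \<and> acc h' u}) = real ub / (3 * ?b)" using card_acc h assms by simp
  have c: "real ub / (3 * ?a) \<le> real (card {u. u < ub \<and> acc h u})"
  proof (cases "h = 1")
    case True
    then show ?thesis by (simp add: acc_def)
  next
    case False
    then show ?thesis using card_acc[of h] h assms by simp
  qed
  have "(gain h' u - gain h u)\<^sup>2
      = (if acc h u then ?a ^ 2 else 0) + (if acc h' u then (?b - ?a) ^ 2 - ?a ^ 2 else 0)" for u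
    using acc_antimono[of h' u h] h assms by (auto simp: gain_def)
  then have "(\<Sum>u<ub. (gain h' u - gain h u)\<^sup>2)
      = ?a ^ 2 * real (card {u. u < ub \<and> acc h u})
        + ((?b - ?a) ^ 2 - ?a ^ 2) * real (card {u. u < ub \<and> acc h' u})"
    by (simp add: sum.distrib sum_if_acc)
  also have "\<dots> \<ge> ?a ^ 2 * (real ub / (3 * ?a)) + ((?b - ?a) ^ 2 - ?a ^ 2) * (real ub / (3 * ?b))"
    unfolding c' using c by (intro add_right_mono mult_left_mono) auto
  also have "?a ^ 2 * (real ub / (3 * ?a)) + ((?b - ?a) ^ 2 - ?a ^ 2) * (real ub / (3 * ?b))
      = real ub / 3 * (?b - ?a)"
    using h by (simp add: field_simps power2_eq_square)
  finally have "real ub / 3 * (?b - ?a) \<le> (\<Sum>u<ub. (gain h' u - gain h u)\<^sup>2)" .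
  moreover have "real ub / 3 * 1 \<le> real ub / 3 * (?b - ?a)"
    using assms by (intro mult_left_mono) auto
  ultimately show ?thesis by simp
qed

lemma sum_gain_diff:
  assumes "h \<noteq> h'" "h \<le> card S" "h' \<le> card S"
  shows "real ub / 3 \<le> (\<Sum>u<ub. (gain h' u - gain h u)\<^sup>2)"
proof (cases "h < h'")
  case True
  then show ?thesis using sum_gain_diff_less assms by blast
next
  case False
  then have "real ub / 3 \<le> (\<Sum>u<ub. (gain h u - gain h' u)\<^sup>2)"
    using sum_gain_diff_less assms by simp
  then show ?thesis by (simp add: power2_commute)
qed

section \<open>The moves and their effect on the volume\<close>

definition upmove :: "nat \<Rightarrow> 'f \<Rightarrow> ('f \<Rightarrow> int) \<Rightarrow> 'f \<Rightarrow> int" where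
  "upmove u f X = (if acc (length (tow X f)) u then raise (set (tow X f)) X else X)"

fun act :: "'f \<times> bool \<times> nat \<Rightarrow> ('f \<Rightarrow> int) \<Rightarrow> 'f \<Rightarrow> int" where
  "act (f, b, u) X = (if b then upmove u f X else - upmove u f (- X))"

definition W :: "('f \<times> bool \<times> nat) set" where
  "W = S \<times> UNIV \<times> {..<ub}"

lemma raise_empty [simp]: "raise {} X = X"
  by (rule ext) (simp add: raise_def)

lemma upmove_states: "X \<in> states \<Longrightarrow> upmove u f X \<in> states"
  using utower_raise tow_utower[of X f] tow_Nil[of X f]
  by (cases "hasU X f") (auto simp: upmove_def)

lemma act_states: "X \<in> states \<Longrightarrow> act w X \<in> states"
  using upmove_states states_neg by (cases w) auto

lemma raise_ge: "X \<le> raise T X"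
  by (simp add: le_fun_def raise_def)

lemma upmove_ge: "X \<le> upmove u f X"
  by (simp add: upmove_def raise_ge)

definition vol :: "('f \<Rightarrow> int) \<Rightarrow> real" where
  "vol X = real_of_int (\<Sum>f\<in>S. X f)"

lemma vol_neg: "vol (- X) = - vol X"
  by (simp add: vol_def sum_negf)

lemma vol_upmove: "vol (upmove u f X) = vol X + 2 * gain (length (tow X f)) u"
proof -
  have "(\<Sum>g\<in>S. if g \<in> set (tow X f) then 2 else 0) = (\<Sum>g\<in>set (tow X f). 2 :: int)"
    using tow_subset[of X f] finite_S
    by (simp add: sum.inter_restrict[symmetric] Int_absorb1 del: sum_constant)
  also have "\<dots> = 2 * int (length (tow X f))"
    using distinct_card[OF tow_distinct, of X f] by simp
  finally have "(\<Sum>g\<in>S. raise (set (tow X f)) X g) = (\<Sum>g\<in>S. X g) + 2 * int (length (tow X f))"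
    by (simp add: raise_def sum.distrib)
  then show ?thesis by (simp add: upmove_def vol_def gain_def del: of_int_sum)
qed

lemma sum_W: "(\<Sum>w\<in>W. g w) = (\<Sum>f\<in>S. \<Sum>u<ub. g (f, True, u) + g (f, False, u))" for g :: "_ \<Rightarrow> real"
proof -
  have "(\<Sum>w\<in>W. g w) = (\<Sum>f\<in>S. \<Sum>p\<in>UNIV \<times> {..<ub}. g (f, p))"
    unfolding W_def by (simp add: sum.cartesian_product)
  also have "\<dots> = (\<Sum>f\<in>S. \<Sum>b\<in>UNIV. \<Sum>u<ub. g (f, b, u))"
    by (simp add: sum.cartesian_product)
  finally show ?thesis by (simp add: UNIV_bool sum.distrib add.commute)
qed

text \<open>Among the faces where \<open>Y - X\<close> is largest, take one where \<open>X\<close>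
  is lowest. A lower neighbour would have at least the same difference, because \<open>Y\<close>
  drops by at most 1 on the way. By parity there is room to raise by 2.\<close>

lemma states_path:
  assumes X: "X \<in> states" and Y: "Y \<in> states" and le: "X \<le> Y" and "X \<noteq> Y"
  obtains F where "F \<in> S" "lmin X F" "raise {F} X \<le> Y"
proof -
  define d where "d f = Y f - X f" for f
  have d_nonneg: "0 \<le> d f" for f using le by (simp add: d_def le_fun_def)
  have d_out: "f \<notin> S \<Longrightarrow> d f = 0" for f using X Y by (simp add: d_def states_outside)
  obtain f0 where "X f0 \<noteq> Y f0" using \<open>X \<noteq> Y\<close> by auto
  then have "d f0 > 0" using d_nonneg[of f0] by (simp add: d_def)
  then have "f0 \<in> S" using d_out[of f0] by force
  define M where "M = Max (d ` S)"
  have M: "d f \<le> M" for f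
  proof (cases "f \<in> S")
    case True
    then show ?thesis unfolding M_def using finite_S by (intro Max_ge) auto
  next
    case False
    have "d f0 \<le> M" unfolding M_def using finite_S \<open>f0 \<in> S\<close> by (intro Max_ge) auto
    then show ?thesis using d_out[OF False] \<open>d f0 > 0\<close> by simp
  qed
  have "M \<in> d ` S" unfolding M_def using finite_S \<open>f0 \<in> S\<close> by (intro Max_in) auto
  then have ne: "{f \<in> S. d f = M} \<noteq> {}" by auto
  define S' where "S' = {f \<in> S. d f = M}"
  have "Min (X ` S') \<in> X ` S'" "\<And>f. f \<in> S' \<Longrightarrow> Min (X ` S') \<le> X f"
    using ne finite_S by (auto simp: S'_def)
  then obtain F where F: "F \<in> S'" "\<And>f. f \<in> S' \<Longrightarrow> X F \<le> X f" by auto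
  have FS: "F \<in> S" "d F = M" using F by (auto simp: S'_def)
  have Mpos: "M > 0" using M[of f0] \<open>d f0 > 0\<close> by simp
  have "lmin X F"
    unfolding lmin_def
  proof
    fix k
    show "X (nb k F) = X F + 1"
    proof (rule ccontr)
      assume "X (nb k F) \<noteq> X F + 1"
      then have down: "X (nb k F) = X F - 1" using states_step[OF X FS(1), of k] by simp
      then have "d (nb k F) = M"
        using states_step[OF Y FS(1), of k] M[of "nb k F"] FS(2) by (auto simp: d_def)
      then have "nb k F \<in> S'" using Mpos d_out[of "nb k F"] by (force simp: S'_def)
      then show False using F(2) down by force
    qed
  qed
  moreover have "raise {F} X \<le> Y"
  proof -
    have "even (d F)" using states_even_diff[OF X Y] by (simp add: d_def)
    then have "d F \<ge> 2" using FS(2) Mpos by presburger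
    then show ?thesis using le by (auto simp: le_fun_def raise_def d_def)
  qed
  ultimately show ?thesis using that FS(1) by blast
qed

text \<open>Comparable states are joined by a monotone chain of single flips, so it suffices to
  compare states that differ in one face.\<close>

lemma states_le_induct [consumes 3, case_names refl flip]:
  assumes "X \<in> states" "Y \<in> states" "X \<le> Y"
    and refl: "P Y"
    and flip: "\<And>X F. X \<in> states \<Longrightarrow> F \<in> S \<Longrightarrow> lmin X F \<Longrightarrow> raise {F} X \<le> Y \<Longrightarrow> P (raise {F} X) \<Longrightarrow> P X"
  shows "P X"
  using assms(1,3)
proof (induction "nat (\<Sum>f\<in>S. Y f - X f)" arbitrary: X rule: less_induct)
  case less
  show ?case
  proof (cases "X = Y")
    case False
    then obtain F where F: "F \<in> S" "lmin X F" "raise {F} X \<le> Y"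
      using states_path less.prems assms(2) by blast
    have "(\<Sum>f\<in>S. Y f - raise {F} X f) < (\<Sum>f\<in>S. Y f - X f)"
      by (rule sum_strict_mono_ex1) (use finite_S F(1) in \<open>auto simp: raise_def\<close>)
    moreover have "0 \<le> (\<Sum>f\<in>S. Y f - raise {F} X f)"
      using F(3) by (intro sum_nonneg) (simp add: le_fun_def)
    ultimately have "P (raise {F} X)"
      using less.hyps raise_states[OF less.prems(1) F(1,2)] F(3) by simp
    then show ?thesis using flip less.prems(1) F by blast
  qed (simp add: refl)
qed

text \<open>In the critical case the tower of \<open>X\<close> ends in \<open>F\<close>. In the
  raised state it is shorter by one, hence accepted whenever the longer one is, and \<open>F\<close>
  has been raised already.\<close>

lemma upmove_mono_flip:
  assumes "X \<in> states" "F \<in> S" "lmin X F"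
  shows "upmove u f X \<le> upmove u f (raise {F} X)"
proof -
  define Y where "Y = raise {F} X"
  interpret hex_flip nb S X F Y by unfold_locales (use assms Y_def in auto)
  have XY: "X \<le> Y" by (simp add: Y_def raise_ge)
  have "upmove u f X \<le> upmove u f Y"
  proof (cases "hasU X f \<and> acc (length (tow X f)) u")
    case False
    then have "upmove u f X = X" using tow_Nil[of X f] by (auto simp: upmove_def)
    then show ?thesis using XY upmove_ge order_trans by metis
  next
    case True
    define T where "T = tow X f"
    have T: "utower X T" "hd T = f" using True tow_utower T_def by auto
    have up: "upmove u f X = raise (set T) X" using True by (simp add: upmove_def T_def)
    from utower_flip[OF T(1)] consider "hd T = F" | "F \<notin> set T" "utower Y T"
      | T' where "T' \<noteq> []" "T = T' @ [F]" "utower Y T'" by blast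
    then show ?thesis
    proof cases
      case 1
      have "T = [F]"
        by (rule utower_unique[OF T(1) utower.utower_single[OF F lmin_F]]) (simp add: 1)
      then have "upmove u f X = Y" using up Y_def by simp
      then show ?thesis using upmove_ge by simp
    next
      case 2
      then have "tow Y f = T" using tow_eqI T(2) by simp
      then have "upmove u f Y = raise (set T) Y" using True by (simp add: upmove_def T_def)
      then show ?thesis using XY up by (simp add: le_fun_def raise_def)
    next
      case 3
      then have "hd T' = f" using T(2) by simp
      then have tow': "tow Y f = T'" using tow_eqI 3(3) by simp
      have "acc (length T) u" using True by (simp add: T_def)
      then have "acc (length T') u"
        by (rule acc_antimono) (use 3 in \<open>auto simp: Suc_le_eq\<close>)
      then have "upmove u f Y = raise (set T') Y" using tow' by (simp add: upmove_def)
      moreover have "raise (set T) X \<le> raise (set T') Y"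
        using 3(2) by (auto simp: le_fun_def raise_def Y_def)
      ultimately show ?thesis using up by simp
    qed
  qed
  then show ?thesis by (simp add: Y_def)
qed

lemma upmove_mono:
  assumes "X \<in> states" "Y \<in> states" "X \<le> Y"
  shows "upmove u f X \<le> upmove u f Y"
  using assms
proof (induction rule: states_le_induct)
  case (flip X F)
  then show ?case using upmove_mono_flip[of X F u f] order_trans by blast
qed simp

lemma neg_le_neg: "X \<le> Y \<Longrightarrow> - Y \<le> - (X :: 'f \<Rightarrow> int)"
  by (simp add: le_fun_def)

lemma act_mono:
  assumes "X \<in> states" "Y \<in> states" "X \<le> Y"
  shows "act w X \<le> act w Y"
proof -
  obtain f b u where w: "w = (f, b, u)" by (cases w) auto
  have "upmove u f (- Y) \<le> upmove u f (- X)"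
    using assms by (intro upmove_mono states_neg neg_le_neg)
  then show ?thesis using upmove_mono[OF assms] neg_le_neg by (auto simp: w)
qed

lemma drift_mono:
  assumes "X \<in> states" "Y \<in> states" "X \<le> Y"
  shows "(\<Sum>f\<in>S. gU Y f - gU (- Y) f) \<le> (\<Sum>f\<in>S. gU X f - gU (- X) f)"
  using assms
proof (induction rule: states_le_induct)
  case (flip X F)
  interpret hex_flip nb S X F "raise {F} X" by unfold_locales (use flip in auto)
  show ?case using flip.IH drift_flip by linarith
qed simp

definition gap :: "('f \<Rightarrow> int) \<Rightarrow> ('f \<Rightarrow> int) \<Rightarrow> real" where
  "gap X Y = (vol Y - vol X) / 2"

definition dgap :: "('f \<Rightarrow> int) \<Rightarrow> ('f \<Rightarrow> int) \<Rightarrow> 'f \<times> bool \<times> nat \<Rightarrow> real" where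
  "dgap X Y w = gap (act w X) (act w Y) - gap X Y"

lemma dgap_True: "dgap X Y (f, True, u) = gain (length (tow Y f)) u - gain (length (tow X f)) u"
  by (simp add: dgap_def gap_def vol_upmove field_simps)

lemma dgap_False:
  "dgap X Y (f, False, u) = gain (length (tow (- X) f)) u - gain (length (tow (- Y) f)) u"
  by (simp add: dgap_def gap_def vol_upmove vol_neg field_simps)

lemma sum_dgap_nonpos:
  assumes "X \<in> states" "Y \<in> states" "X \<le> Y"
  shows "(\<Sum>w\<in>W. dgap X Y w) \<le> 0"
proof -
  have "(\<Sum>w\<in>W. dgap X Y w)
      = real ub * ((\<Sum>f\<in>S. gU Y f - gU (- Y) f) - (\<Sum>f\<in>S. gU X f - gU (- X) f))"
    by (simp add: sum_W dgap_True dgap_False sum.distrib sum_subtractf sum_gain_tow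
        sum_distrib_left[symmetric] algebra_simps)
  also have "\<dots> \<le> 0"
    using drift_mono[OF assms] ub_pos by (intro mult_nonneg_nonpos) auto
  finally show ?thesis .
qed

text \<open>A single face with different tower lengths in one direction gives \<open>ub / 3\<close>;
  divided by \<open>card W\<close>, which is \<open>2 * card S * ub\<close>, this is the mean square
  1/(6f).\<close>

lemma sum_dgap_square:
  assumes "X \<in> states" "Y \<in> states" "X \<le> Y" "X \<noteq> Y"
  shows "real ub / 3 \<le> (\<Sum>w\<in>W. (dgap X Y w)\<^sup>2)"
proof -
  have "\<exists>f\<in>S. length (tow X f) \<noteq> length (tow Y f) \<or> length (tow (- X) f) \<noteq> length (tow (- Y) f)"
  proof (rule ccontr)
    assume "\<not> ?thesis"
    then have eq: "length (tow X f) = length (tow Y f)" "length (tow (- X) f) = length (tow (- Y) f)"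
      if "f \<in> S" for f using that by auto
    have U: "hasU X f \<longleftrightarrow> hasU Y f" for f
      using eq(1)[of f] tow_length_0[of X f] tow_length_0[of Y f] hasU_in[of X f] hasU_in[of Y f] by auto
    have D: "hasU (- X) f \<longleftrightarrow> hasU (- Y) f" for f
      using eq(2)[of f] tow_length_0[of "- X" f] tow_length_0[of "- Y" f]
        hasU_in[of "- X" f] hasU_in[of "- Y" f] by auto
    have m: "lmin X f \<longleftrightarrow> lmin Y f" if "f \<in> S" for f
      using eq(1)[OF that] tow_length_1[of X f] tow_length_1[of Y f] that by auto
    have M: "lmin (- X) f \<longleftrightarrow> lmin (- Y) f" if "f \<in> S" for f
      using eq(2)[OF that] tow_length_1[of "- X" f] tow_length_1[of "- Y" f] that by auto
    show False using states_eq_of_same_towers[OF assms(1-3) m M U D] assms(4) by simp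
  qed
  then obtain f where f: "f \<in> S"
    "length (tow X f) \<noteq> length (tow Y f) \<or> length (tow (- X) f) \<noteq> length (tow (- Y) f)" by blast
  have "real ub / 3 \<le> (\<Sum>u<ub. (dgap X Y (f, True, u))\<^sup>2 + (dgap X Y (f, False, u))\<^sup>2)"
    using f(2)
  proof
    assume "length (tow X f) \<noteq> length (tow Y f)"
    then have "real ub / 3 \<le> (\<Sum>u<ub. (dgap X Y (f, True, u))\<^sup>2)"
      unfolding dgap_True by (intro sum_gain_diff tow_length_le) auto
    also have "\<dots> \<le> (\<Sum>u<ub. (dgap X Y (f, True, u))\<^sup>2 + (dgap X Y (f, False, u))\<^sup>2)"
      by (intro sum_mono) simp
    finally show ?thesis .
  next
    assume "length (tow (- X) f) \<noteq> length (tow (- Y) f)"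
    then have "real ub / 3 \<le> (\<Sum>u<ub. (dgap X Y (f, False, u))\<^sup>2)"
      unfolding dgap_False by (intro sum_gain_diff tow_length_le) auto
    also have "\<dots> \<le> (\<Sum>u<ub. (dgap X Y (f, True, u))\<^sup>2 + (dgap X Y (f, False, u))\<^sup>2)"
      by (intro sum_mono) simp
    finally show ?thesis .
  qed
  also have "\<dots> \<le> (\<Sum>f\<in>S. \<Sum>u<ub. (dgap X Y (f, True, u))\<^sup>2 + (dgap X Y (f, False, u))\<^sup>2)"
    using finite_S f(1) by (intro member_le_sum sum_nonneg) auto
  also have "\<dots> = (\<Sum>w\<in>W. (dgap X Y w)\<^sup>2)" by (simp add: sum_W)
  finally show ?thesis .
qed

end

section \<open>Diameter, stationarity and mixing\<close>

context hex_region
begin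

text \<open>Unequal heights differ by at least 2, so the state that is higher at a face is not below
  the other one at the neighbours either, and the maximum follows that state.\<close>

lemma states_join:
  assumes X: "X \<in> states" and Y: "Y \<in> states"
  shows "(\<lambda>f. max (X f) (Y f)) \<in> states"
proof -
  have "\<bar>max (X (nb k f)) (Y (nb k f)) - max (X f) (Y f)\<bar> = 1" if "f \<in> S" for f k
  proof -
    have "even (Y f - X f)" using states_even_diff[OF X Y] by blast
    then obtain c where "Y f - X f = 2 * c" unfolding dvd_def by blast
    then have "X f = Y f \<or> X f + 2 \<le> Y f \<or> Y f + 2 \<le> X f" by arith
    then consider "X f = Y f" | "X f + 2 \<le> Y f" | "Y f + 2 \<le> X f" by blast
    then show ?thesis
      using states_step[OF X that, of k] states_step[OF Y that, of k] by cases auto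
  qed
  then show ?thesis using X Y by (simp add: states_def)
qed

text \<open>The difference changes by at most 2 per crossing, so a difference of 2m stays positive
  on a parallelogram of translates of \<open>f\<close> with side about m/4, all of which lie in
  \<open>S\<close>.\<close>

lemma states_diff_square_le:
  assumes X: "X \<in> states" and Y: "Y \<in> states" and le: "X f \<le> Y f"
  shows "(real_of_int (Y f - X f) / 2)\<^sup>2 \<le> 16 * real (card S)"
proof -
  define d where "d g = Y g - X g" for g
  have d_out: "g \<notin> S \<Longrightarrow> d g = 0" for g using X Y by (simp add: d_def states_outside)
  have lip: "d g - 2 \<le> d (nb k g)" for g k
    using states_lip[OF X, of k g] states_lip[OF Y, of k g] by (simp add: d_def)
  define m where "m = nat (d f div 2)"
  have "even (d f)" using states_even_diff[OF X Y] by (simp add: d_def)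
  then have m: "d f = 2 * int m" using le by (simp add: m_def d_def)
  \<comment> \<open>This is m/4 rounded up: for \<open>i\<close> and \<open>j\<close> below
    \<open>q\<close>, both \<open>4 * i\<close> and \<open>4 * j\<close> are below \<open>m\<close>,
    so the loss \<open>4 * (i + j)\<close> stays below the initial difference
    \<open>2 * m\<close>.\<close>
  define q where "q = (m + 3) div 4"
  define t where "t i j = ((nb A \<circ> nb B) ^^ i) (((nb A \<circ> nb C) ^^ j) f)" for i j
  have t: "t 0 0 = f" "t 0 (Suc j) = nb A (nb C (t 0 j))" "t (Suc i) j = nb A (nb B (t i j))" for i j
    by (simp_all add: t_def)
  have lip2: "d f \<le> d (t 0 j) + 4 * int j" for j
  proof (induction j)
    case (Suc j)
    then show ?case using lip[of "t 0 j" C] lip[of "nb C (t 0 j)" A] by (simp add: t)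
  qed (simp add: t)
  have lip1: "d f \<le> d (t i j) + 4 * int (i + j)" for i j
  proof (induction i)
    case (Suc i)
    then show ?case using lip[of "t i j" B] lip[of "nb B (t i j)" A] by (simp add: t)
  qed (use lip2[of j] in simp)
  let ?t = "\<lambda>(i, j). ((nb A \<circ> nb B) ^^ i) (((nb A \<circ> nb C) ^^ j) f)"
  have "?t ` ({..<q} \<times> {..<q}) \<subseteq> S"
  proof clarify
    fix i j assume ij: "i < q" "j < q"
    have "4 * i < m" using ij(1) unfolding q_def by linarith
    moreover have "4 * j < m" using ij(2) unfolding q_def by linarith
    ultimately have "4 * (i + j) < 2 * m" by simp
    then have "int (4 * (i + j)) < int (2 * m)" by (simp only: of_nat_less_iff)
    then have "0 < d (t i j)" using lip1[where i = i and j = j] m by simp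
    then have "t i j \<in> S" using d_out[of "t i j"] by force
    then show "((nb A \<circ> nb B) ^^ i) (((nb A \<circ> nb C) ^^ j) f) \<in> S" by (simp only: t_def)
  qed
  then have "card (?t ` ({..<q} \<times> {..<q})) \<le> card S" using finite_S by (intro card_mono)
  moreover have "card (?t ` ({..<q} \<times> {..<q})) = q * q"
    using card_image[OF inj_on_subset[OF translations_inj[of f]], of "{..<q} \<times> {..<q}"]
    by (simp add: card_cartesian_product)
  ultimately have "q * q \<le> card S" by simp
  moreover have m_le: "m \<le> 4 * q" unfolding q_def by presburger
  have "m * m \<le> (4 * q) * (4 * q)" by (rule mult_le_mono[OF m_le m_le])
  ultimately have "m * m \<le> 16 * card S" by simp
  then have "real (m * m) \<le> real (16 * card S)" by (rule of_nat_mono)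
  moreover have "real_of_int (Y f - X f) / 2 = real m" using m by (simp add: d_def)
  ultimately show ?thesis by (simp add: power2_eq_square)
qed

definition diam :: real where
  "diam = real (card S) * (4 * sqrt (real (card S)))"

lemma diam_square: "diam\<^sup>2 = 16 * real (card S) ^ 3"
  by (simp add: diam_def power_mult_distrib power2_eq_square power3_eq_cube)

lemma gap_alt: "gap X Y = (\<Sum>f\<in>S. real_of_int (Y f - X f) / 2)"
  by (simp add: gap_def vol_def sum_subtractf sum_divide_distrib diff_divide_distrib)

lemma gap_nonneg: "X \<le> Y \<Longrightarrow> 0 \<le> gap X Y"
  unfolding gap_alt by (intro sum_nonneg) (simp add: le_fun_def)

lemma gap_le_diam:
  assumes "X \<in> states" "Y \<in> states" "X \<le> Y"
  shows "gap X Y \<le> diam"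
proof -
  have le: "real_of_int (Y f - X f) / 2 \<le> 4 * sqrt (real (card S))" for f
  proof (rule power2_le_imp_le)
    show "(real_of_int (Y f - X f) / 2)\<^sup>2 \<le> (4 * sqrt (real (card S)))\<^sup>2"
      using states_diff_square_le[OF assms(1,2), of f] assms(3) by (simp add: le_fun_def power_mult_distrib)
  qed simp
  have "gap X Y \<le> (\<Sum>f\<in>S. 4 * sqrt (real (card S)))" unfolding gap_alt by (rule sum_mono) (rule le)
  then show ?thesis by (simp add: diam_def)
qed

text \<open>Reversing a tower turns it into a tower of the same length in the opposite direction. This is an
  involution on pairs of a state and a random seed, which makes the uniform distribution stationary.\<close>

definition flip_pair :: "('f \<Rightarrow> int) \<times> ('f \<times> bool \<times> nat) \<Rightarrow> ('f \<Rightarrow> int) \<times> ('f \<times> bool \<times> nat)" where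
  "flip_pair = (\<lambda>(X, f, b, u).
     let T = tow (if b then X else - X) f in
     if T \<noteq> [] \<and> acc (length T) u then (act (f, b, u) X, last T, \<not> b, u) else (X, f, b, u))"

lemma fst_flip_pair: "fst (flip_pair (X, w)) = act w X"
  by (cases w) (auto simp: flip_pair_def Let_def upmove_def)

lemma tow_upmove:
  assumes "X \<in> states" "tow X f \<noteq> []" "acc (length (tow X f)) u"
  shows "tow (- upmove u f X) (last (tow X f)) = rev (tow X f)"
proof -
  let ?T = "tow X f"
  have "hasU X f" using assms(2) tow_Nil by blast
  then have T: "utower X ?T" "hd ?T = f" using tow_utower by auto
  have "utower (- raise (set ?T) X) (rev ?T)" by (rule utower_neg_rev[OF assms(1) T(1)])
  then show ?thesis
    using assms by (intro tow_eqI) (auto simp: upmove_def hd_rev)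
qed

lemma raise_neg_raise: "raise T (- raise T X) = - X"
  by (rule ext) (simp add: raise_def)

lemma flip_pair_flip_pair:
  assumes "X \<in> states"
  shows "flip_pair (flip_pair (X, w)) = (X, w)"
proof -
  obtain f b u where w: "w = (f, b, u)" by (cases w) auto
  define Z where "Z = (if b then X else - X)"
  define T where "T = tow Z f"
  have Z: "Z \<in> states" using assms states_neg by (simp add: Z_def)
  show ?thesis
  proof (cases "T \<noteq> [] \<and> acc (length T) u")
    case False
    then show ?thesis by (auto simp: flip_pair_def w T_def Z_def Let_def)
  next
    case True
    define Z' where "Z' = - upmove u f Z"
    have "hasU Z f" using True tow_Nil T_def by blast
    then have hd: "hd T = f" using tow_utower T_def by blast
    have rev: "tow Z' (last T) = rev T"
      using tow_upmove[OF Z, of f u] True by (simp add: T_def Z'_def)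
    have up: "upmove u f Z = raise (set T) Z" using True by (simp add: upmove_def T_def)
    have "upmove u (last T) Z' = raise (set T) Z'" using rev True by (simp add: upmove_def)
    then have undo: "upmove u (last T) Z' = - Z" by (simp add: Z'_def up raise_neg_raise)
    have 1: "flip_pair (X, w) = (if b then - Z' else Z', last T, \<not> b, u)"
      using True by (simp add: flip_pair_def w T_def Z_def Z'_def Let_def)
    have 2: "(if \<not> b then (if b then - Z' else Z') else - (if b then - Z' else Z')) = Z'" by simp
    show ?thesis
      unfolding 1
      unfolding flip_pair_def prod.case 2 rev Let_def
      using True hd undo by (simp add: w Z_def last_rev)
  qed
qed

lemma flip_pair_in: "p \<in> states \<times> W \<Longrightarrow> flip_pair p \<in> states \<times> W"
proof -
  assume p: "p \<in> states \<times> W"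
  then obtain X f b u where p_eq: "p = (X, f, b, u)" and X: "X \<in> states" and f: "f \<in> S" "u < ub"
    by (auto simp: W_def)
  have "last (tow (if b then X else - X) f) \<in> S" if "tow (if b then X else - X) f \<noteq> []"
    using tow_subset last_in_set[OF that] by blast
  then show ?thesis
    using X f act_states[OF X] by (cases b) (simp_all add: p_eq flip_pair_def Let_def W_def del: act.simps)
qed

lemma stationary:
  "(\<Sum>X\<in>states. \<Sum>w\<in>W. g (act w X)) = (\<Sum>X\<in>states. \<Sum>w\<in>W. g X)" for g :: "_ \<Rightarrow> real"
proof -
  have "(\<Sum>X\<in>states. \<Sum>w\<in>W. g (act w X)) = (\<Sum>p\<in>states \<times> W. g (fst (flip_pair p)))"
    by (simp add: sum.cartesian_product fst_flip_pair case_prod_unfold flip: fst_flip_pair)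
  also have "\<dots> = (\<Sum>p\<in>states \<times> W. g (fst p))"
    by (rule sum.reindex_bij_witness[where i = flip_pair and j = flip_pair])
      (use flip_pair_in flip_pair_flip_pair in auto)
  also have "\<dots> = (\<Sum>X\<in>states. \<Sum>w\<in>W. g X)"
    by (simp add: sum.cartesian_product case_prod_unfold del: sum_constant)
  finally show ?thesis .
qed

lemma card_W: "card W = 2 * card S * ub"
  by (simp add: W_def card_cartesian_product UNIV_bool)

text \<open>The value 32/100 is twice the bound 16/100 proved for comparable states.\<close>

lemma exp_minus_one_ge: "(32 / 100 :: real) \<le> exp (- 1)"
proof -
  have "exp (1 :: real) \<le> 3" by (rule exp_le)
  then have "1 / 3 \<le> 1 / exp (1 :: real)" by (intro divide_left_mono) auto
  moreover have "exp (- 1 :: real) = 1 / exp 1" by (simp add: exp_minus inverse_eq_divide)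
  ultimately show ?thesis by linarith
qed

text \<open>In each block of \<open>600 * card S ^ 4\<close> steps, two copies that have not met
  stay apart with probability at most 1/e.\<close>

theorem height_chain_mixing:
  assumes "S \<noteq> {}" "finite states" "X \<in> states"
  shows "tv_dist (steps (\<lambda>X. map_pmf (\<lambda>w. act w X) (pmf_of_set W)) (k * (600 * card S ^ 4)) X)
    (pmf_of_set states) \<le> exp (- 1) ^ k"
proof -
  have n: "0 < card S" using assms finite_S by (simp add: card_gt_0_iff)
  interpret rm: random_map W act states
  proof
    show "finite W" using finite_S by (simp add: W_def)
    show "W \<noteq> {}" using assms(1) ub_pos by (auto simp: W_def)
  qed (use assms act_states in auto)
  let ?n = "real (card S)" and ?t = "600 * card S ^ 4"
  have le_case: "rm.sep ?t X Y \<le> 16 / 100" if XY: "X \<in> states" "Y \<in> states" "X \<le> Y" for X Y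
  proof -
    \<comment> \<open>A step s of the gap z changes this potential by 2 * (diam - z) * s - s^2. As z
      is at most \<open>diam\<close> and s has nonpositive mean, the expected loss is at least the
      mean square of s.\<close>
    define \<phi> where "\<phi> X Y = 2 * diam * gap X Y - (gap X Y)\<^sup>2" for X Y
    let ?R = "\<lambda>X Y. X \<in> states \<and> Y \<in> states \<and> X \<le> Y"
    have "1 / (6 * ?n) * real ?t * rm.sep ?t X Y \<le> \<phi> X Y"
    proof (rule rm.sep_le_potential[where R = ?R])
      show "?R (act w X) (act w Y)" if "w \<in> W" "?R X Y" for w X Y
        using that act_mono act_states by blast
      show "0 \<le> \<phi> X Y" if "?R X Y" for X Y
      proof -
        have "0 \<le> gap X Y" "gap X Y \<le> diam" using that gap_nonneg gap_le_diam by auto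
        then have "0 \<le> gap X Y * (2 * diam - gap X Y)" by (intro mult_nonneg_nonneg) auto
        then show ?thesis by (simp add: \<phi>_def algebra_simps power2_eq_square)
      qed
      show "rm.avg (\<lambda>w. \<phi> (act w X) (act w Y)) \<le> \<phi> X Y - 1 / (6 * ?n) * of_bool (X \<noteq> Y)"
        if R: "?R X Y" for X Y
      proof -
        have "\<phi> (act w X) (act w Y)
            = \<phi> X Y + 2 * (diam - gap X Y) * dgap X Y w - (dgap X Y w)\<^sup>2" for w
          by (simp add: \<phi>_def dgap_def algebra_simps power2_eq_square)
        then have avg: "rm.avg (\<lambda>w. \<phi> (act w X) (act w Y))
            = \<phi> X Y + 2 * (diam - gap X Y) * rm.avg (dgap X Y) - rm.avg (\<lambda>w. (dgap X Y w)\<^sup>2)"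
          by (simp add: rm.avg_diff rm.avg_add rm.avg_cmult)
        have "rm.avg (dgap X Y) \<le> 0"
          unfolding rm.avg_def using sum_dgap_nonpos R by (intro divide_nonpos_nonneg) auto
        then have "2 * (diam - gap X Y) * rm.avg (dgap X Y) \<le> 0"
          using gap_le_diam R by (intro mult_nonneg_nonpos) auto
        moreover have "1 / (6 * ?n) * of_bool (X \<noteq> Y) \<le> rm.avg (\<lambda>w. (dgap X Y w)\<^sup>2)"
        proof (cases "X = Y")
          case True
          then show ?thesis by (simp add: rm.avg_def sum_nonneg)
        next
          case False
          have "1 / (6 * ?n) = (real ub / 3) / real (card W)"
            using n ub_pos by (simp add: card_W field_simps)
          also have "\<dots> \<le> rm.avg (\<lambda>w. (dgap X Y w)\<^sup>2)"
            unfolding rm.avg_def using sum_dgap_square R False by (intro divide_right_mono) auto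
          finally show ?thesis using False by simp
        qed
        ultimately show ?thesis using avg by linarith
      qed
    qed (use n XY in auto)
    also have "\<phi> X Y \<le> diam\<^sup>2"
      using zero_le_power2[of "diam - gap X Y"] by (simp add: \<phi>_def algebra_simps power2_eq_square)
    also have "\<dots> = 16 * ?n ^ 3" by (rule diam_square)
    finally have a: "1 / (6 * ?n) * (600 * ?n ^ 4) * rm.sep ?t X Y \<le> 16 * ?n ^ 3" by simp
    \<comment> \<open>The factor 600 makes this 100 n^3, to be compared with diam^2 = 16 n^3, where
      n is the number of faces.\<close>
    have eq: "1 / (6 * ?n) * (600 * ?n ^ 4) = 100 * ?n ^ 3"
      using n by (simp add: field_simps power4_eq_xxxx power3_eq_cube)
    have "100 * ?n ^ 3 * rm.sep ?t X Y \<le> 16 * ?n ^ 3" using a unfolding eq .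
    then have "100 * ?n ^ 3 * rm.sep ?t X Y \<le> 100 * ?n ^ 3 * (16 / 100)" by simp
    moreover have "0 < 100 * ?n ^ 3" using n by simp
    ultimately show ?thesis by (rule mult_left_le_imp_le)
  qed
  have all: "rm.sep ?t X Y \<le> exp (- 1)" if XY: "X \<in> states" "Y \<in> states" for X Y
  proof -
    let ?J = "\<lambda>f. max (X f) (Y f)"
    have J: "?J \<in> states" by (rule states_join[OF XY])
    have "rm.sep ?t X Y \<le> rm.sep ?t X ?J + rm.sep ?t ?J Y" by (rule rm.sep_triangle)
    also have "\<dots> = rm.sep ?t X ?J + rm.sep ?t Y ?J" by (simp add: rm.sep_sym[of _ ?J Y])
    also have "\<dots> \<le> 16 / 100 + 16 / 100"
      by (intro add_mono le_case XY J) (auto simp: le_fun_def)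
    finally show ?thesis using exp_minus_one_ge by linarith
  qed
  have "tv_dist (steps rm.kernel (k * ?t) X) (pmf_of_set states) \<le> exp (- 1) ^ k"
  proof (rule rm.tv_dist_steps_le)
    show "(\<Sum>x\<in>states. rm.avg (\<lambda>w. g (act w x))) = (\<Sum>x\<in>states. g x)" for g
      using rm.card_W_pos stationary[of g] by (simp add: rm.avg_def sum_divide_distrib[symmetric] sum_distrib_left[symmetric])
    show "rm.sep (k * ?t) X Y \<le> exp (- 1) ^ k" if "Y \<in> states" for Y
      by (rule rm.sep_mult_le) (use all that assms(3) in auto)
  qed
  then show ?thesis unfolding rm.kernel_def[abs_def] .
qed

end

section \<open>Faces of the triangular lattice\<close>

text \<open>The face \<open>(i, j, True)\<close> is the triangle with corners \<open>(i, j)\<close>, \<open>(i + 1, j)\<close>, \<open>(i, j + 1)\<close>;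
  \<open>(i, j, False)\<close> is the one with corners \<open>(i + 1, j)\<close>, \<open>(i + 1, j + 1)\<close>, \<open>(i, j + 1)\<close>.\<close>

type_synonym face = "int \<times> int \<times> bool"

fun nbr :: "dir \<Rightarrow> face \<Rightarrow> face" where
  "nbr A (i, j, b) = (i, j, \<not> b)"
| "nbr B (i, j, b) = (if b then i - 1 else i + 1, j, \<not> b)"
| "nbr C (i, j, b) = (i, if b then j - 1 else j + 1, \<not> b)"

text \<open>The sides of a face, traversed with the face on the left.\<close>

fun carc :: "dir \<Rightarrow> face \<Rightarrow> arc" where
  "carc A (i, j, b) = (if b then ((i + 1, j), (i, j + 1)) else ((i, j + 1), (i + 1, j)))"
| "carc B (i, j, b) = (if b then ((i, j + 1), (i, j)) else ((i + 1, j), (i + 1, j + 1)))"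
| "carc C (i, j, b) = (if b then ((i, j), (i + 1, j)) else ((i + 1, j + 1), (i, j + 1)))"

definition fedge :: "dir \<Rightarrow> face \<Rightarrow> edge" where
  "fedge k f = {fst (carc k f), snd (carc k f)}"

lemma nbr_nbr [simp]: "nbr k (nbr k f) = f"
  by (cases k; cases f) auto

lemma nbr_eq [simp]: "nbr k f = nbr l f \<longleftrightarrow> k = l"
  by (cases k; cases l; cases f) auto

lemma nbr_neq [simp]: "nbr k f \<noteq> f"
  by (cases k; cases f) auto

lemma nbr_hexagon:
  "k \<noteq> l \<Longrightarrow> l \<noteq> m \<Longrightarrow> m \<noteq> k \<Longrightarrow> nbr k (nbr l (nbr m (nbr k (nbr l (nbr m f))))) = f"
  by (cases k; cases l; cases m; cases f) auto

lemma nbr_translations: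
  "((nbr A \<circ> nbr B) ^^ n) (i, j, b) = (if b then i - int n else i + int n, j, b)"
  "((nbr A \<circ> nbr C) ^^ n) (i, j, b) = (i, if b then j - int n else j + int n, b)"
  by (induction n) auto

lemma nbr_translations_inj:
  "inj (\<lambda>(i, j). ((nbr A \<circ> nbr B) ^^ i) (((nbr A \<circ> nbr C) ^^ j) f))"
proof (rule injI, clarify)
  fix i j i' j' :: nat
  assume eq: "((nbr A \<circ> nbr B) ^^ i) (((nbr A \<circ> nbr C) ^^ j) f)
    = ((nbr A \<circ> nbr B) ^^ i') (((nbr A \<circ> nbr C) ^^ j') f)"
  obtain p q b where f: "f = (p, q, b)" by (cases f) auto
  show "i = i' \<and> j = j'"
    using eq unfolding f nbr_translations by (auto split: if_splits)
qed

lemma carc_nbr: "carc k (nbr k f) = prod.swap (carc k f)"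
  by (cases k; cases f) auto

lemma fedge_nbr [simp]: "fedge k (nbr k f) = fedge k f"
  by (auto simp: fedge_def carc_nbr)

lemma carc_inj: "carc k f = carc l g \<longleftrightarrow> k = l \<and> f = g"
  by (cases k; cases l; cases f; cases g) (auto split: if_splits)

lemma fedge_eq: "fedge k f = fedge l g \<longleftrightarrow> k = l \<and> (g = f \<or> g = nbr k f)"
proof
  assume "fedge k f = fedge l g"
  then have "carc k f = carc l g \<or> carc k f = prod.swap (carc l g)"
    by (auto simp: fedge_def doubleton_eq_iff prod_eq_iff)
  then show "k = l \<and> (g = f \<or> g = nbr k f)"
    unfolding carc_nbr[symmetric] carc_inj by auto
qed auto

lemma fedge_lattice: "fedge k f \<in> lattice_edges"
proof -
  have up: "fedge k (i, j, True) \<in> lattice_edges" for i j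
  proof (cases k)
    case A
    have "fedge k (i, j, True) = {(i, j + 1), (i + 1, (j + 1) - 1)}" by (auto simp: A fedge_def)
    then show ?thesis unfolding lattice_edges_def by blast
  next
    case B
    have "fedge k (i, j, True) = {(i, j), (i, j + 1)}" by (auto simp: B fedge_def)
    then show ?thesis unfolding lattice_edges_def by blast
  next
    case C
    have "fedge k (i, j, True) = {(i, j), (i + 1, j)}" by (auto simp: C fedge_def)
    then show ?thesis unfolding lattice_edges_def by blast
  qed
  obtain i j b where f: "f = (i, j, b)" by (cases f) auto
  show ?thesis
  proof (cases b)
    case False
    then have "\<exists>i' j'. nbr k f = (i', j', True)" by (cases k) (auto simp: f)
    then show ?thesis using up by (metis fedge_nbr)
  qed (use up f in auto)
qed

lemma lattice_edge_fedge:
  assumes "e \<in> lattice_edges"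
  obtains k i j where "e = fedge k (i, j, True)"
proof -
  from assms obtain i j where
    "e = {(i, j), (i + 1, j)} \<or> e = {(i, j), (i, j + 1)} \<or> e = {(i, j), (i + 1, j - 1)}"
    unfolding lattice_edges_def by blast
  moreover have "{(i, j), (i + 1, j)} = fedge C (i, j, True)" "{(i, j), (i, j + 1)} = fedge B (i, j, True)"
    "{(i, j), (i + 1, j - 1)} = fedge A (i, j - 1, True)"
    by (auto simp: fedge_def)
  ultimately show ?thesis using that by metis
qed

lemma lattice_arc_carc:
  assumes "{u, v} \<in> lattice_edges"
  obtains k f where "(u, v) = carc k f"
proof -
  obtain k f where "{u, v} = fedge k f" using assms lattice_edge_fedge by metis
  then have "(u, v) = carc k f \<or> (u, v) = prod.swap (carc k f)"
    by (auto simp: fedge_def doubleton_eq_iff prod_eq_iff)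
  then show ?thesis using that carc_nbr by metis
qed

section \<open>Balance at a vertex as flow conservation\<close>

definition around :: "vertex \<Rightarrow> vertex set" where
  "around v = (case v of (i, j) \<Rightarrow>
     {(i + 1, j), (i, j + 1), (i - 1, j + 1), (i - 1, j), (i, j - 1), (i + 1, j - 1)})"

lemma lattice_edge_around:
  assumes "{u, v} \<in> lattice_edges" shows "v \<in> around u" "u \<in> around v"
proof -
  obtain k f where k: "(u, v) = carc k f" using assms lattice_arc_carc by blast
  obtain i j b where f: "f = (i, j, b)" by (cases f) auto
  show "v \<in> around u" "u \<in> around v"
    using k by (cases k; cases b; simp add: f around_def)+
qed

lemma sum_around: "(\<Sum>w\<in>around (i, j). g w) = g (i + 1, j) + g (i, j + 1) + g (i - 1, j + 1)
    + g (i - 1, j) + g (i, j - 1) + g (i + 1, j - 1)" for g :: "vertex \<Rightarrow> int"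
  by (simp add: around_def)

lemma finite_around [simp]: "finite (around v)"
  by (cases v) (simp add: around_def)

lemma balanced_iff:
  assumes "\<And>u v. (u, v) \<in> X \<Longrightarrow> {u, v} \<in> lattice_edges"
  shows "card {u. (u, v) \<in> X} = card {w. (v, w) \<in> X}
    \<longleftrightarrow> (\<Sum>w\<in>around v. of_bool ((v, w) \<in> X) - of_bool ((w, v) \<in> X)) = (0 :: int)"
proof -
  have 1: "{u. (u, v) \<in> X} = {u \<in> around v. (u, v) \<in> X}"
    using assms lattice_edge_around(2) by blast
  have 2: "{w. (v, w) \<in> X} = {w \<in> around v. (v, w) \<in> X}"
    using assms lattice_edge_around(1) by blast
  have "(\<Sum>w\<in>around v. of_bool ((v, w) \<in> X) - of_bool ((w, v) \<in> X))
      = int (card {w. (v, w) \<in> X}) - int (card {u. (u, v) \<in> X})"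
    unfolding 1 2 by (simp add: sum_subtractf sum.If_cases of_bool_def Int_def)
  then show ?thesis by linarith
qed

text \<open>For an orientation, the height drop from \<open>f\<close> across its side
  \<open>k\<close>: 1 if the arc has \<open>f\<close> on its left, -1 if on its right, 0 if there is
  no arc.\<close>

definition sg :: "arc set \<Rightarrow> dir \<Rightarrow> face \<Rightarrow> int" where
  "sg X k f = of_bool (carc k f \<in> X) - of_bool (prod.swap (carc k f) \<in> X)"

lemma sg_nbr: "sg X k (nbr k f) = - sg X k f"
  by (simp add: sg_def carc_nbr)

text \<open>The net outflow of a vertex is the sum of the height drops met on a closed walk around
  it.\<close>

lemma sum_around_sg:
  "(\<Sum>w\<in>around (i, j). of_bool (((i, j), w) \<in> X) - of_bool ((w, (i, j)) \<in> X))
    = sg X C (i, j, True) - sg X B (i, j, True) + sg X A (i - 1, j, True)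
      - sg X C (i - 1, j, True) + sg X B (i, j - 1, True) - sg X A (i, j - 1, True)"
  unfolding sum_around sg_def by simp

text \<open>Heights are obtained by adding up the flow across each row from the far left; the flow
  conservation at the vertices makes neighbouring rows agree.\<close>

lemma height_exists:
  assumes cons: "\<And>v. (\<Sum>w\<in>around v. of_bool ((v, w) \<in> X) - of_bool ((w, v) \<in> X)) = (0 :: int)"
    and left: "\<And>k i j. i < L \<Longrightarrow> sg X k (i, j, True) = 0"
  obtains H where "\<And>k f. H f - H (nbr k f) = sg X k f" "\<And>i j. i < L \<Longrightarrow> H (i, j, False) = 0"
proof -
  define r where "r i j = sg X B (i, j, True) - sg X A (i, j, True)" for i j
  define D where "D i j = (\<Sum>i'\<in>{L..i}. r i' j)" for i j
  define H where "H = (\<lambda>(i, j, b). D i j + (if b then sg X A (i, j, True) else 0))"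
  have D_step: "D i j = D (i - 1) j + r i j" for i j
  proof (cases "L \<le> i")
    case True
    then have "{L..i} = insert i {L..i - 1}" by auto
    then show ?thesis by (simp add: D_def)
  next
    case False
    then show ?thesis by (simp add: D_def r_def left)
  qed
  \<comment> \<open>Sides of directions \<open>A\<close> and \<open>B\<close> stay within a row and
    are correct by construction. A side of direction \<open>C\<close> joins two rows; its drop is
    carried from column to column by conservation at the vertex between.\<close>
  have row: "H (i, j, True) - H (i, j - 1, False) = sg X C (i, j, True)" for i j
  proof (cases "L \<le> i")
    case False
    then show ?thesis by (simp add: H_def D_def left)
  next
    case True
    then have "L - 1 \<le> i" by simp
    then show ?thesis
    proof (induction i rule: int_ge_induct)
      case base
      then show ?case by (simp add: H_def D_def left)
    next
      case (step i)
      then show ?case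
        using cons[of "(i + 1, j)"] D_step[of "i + 1" j] D_step[of "i + 1" "j - 1"]
        unfolding sum_around_sg by (simp add: H_def r_def)
    qed
  qed
  have up: "H (i, j, True) - H (nbr k (i, j, True)) = sg X k (i, j, True)" for k i j
    using row[of i j] D_step[of i j] by (cases k) (simp_all add: H_def r_def)
  have "H f - H (nbr k f) = sg X k f" for k f
  proof -
    obtain i j b where f: "f = (i, j, b)" by (cases f) auto
    show ?thesis
    proof (cases b)
      case False
      then obtain i' j' where g: "nbr k f = (i', j', True)" by (cases k) (auto simp: f)
      have "H (nbr k f) - H f = sg X k (nbr k f)"
        using up[of i' j' k] unfolding g[symmetric] by simp
      then show ?thesis by (simp add: sg_nbr)
    qed (simp add: up f)
  qed
  moreover have "H (i, j, False) = 0" if "i < L" for i j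
    using that by (simp add: H_def D_def)
  ultimately show ?thesis using that by blast
qed

section \<open>From heights back to orientations\<close>

definition arcs_of :: "(face \<Rightarrow> int) \<Rightarrow> arc set" where
  "arcs_of H = {carc k f | k f. H f - H (nbr k f) = 1}"

lemma carc_in_arcs_of: "carc k f \<in> arcs_of H \<longleftrightarrow> H f - H (nbr k f) = 1"
proof
  assume "carc k f \<in> arcs_of H"
  then obtain k' f' where "carc k f = carc k' f'" "H f' - H (nbr k' f') = 1"
    unfolding arcs_of_def by blast
  then show "H f - H (nbr k f) = 1" unfolding carc_inj by simp
next
  assume "H f - H (nbr k f) = 1"
  then show "carc k f \<in> arcs_of H" unfolding arcs_of_def by blast
qed

lemma swap_carc_in_arcs_of: "prod.swap (carc k f) \<in> arcs_of H \<longleftrightarrow> H f - H (nbr k f) = - 1"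
  unfolding carc_nbr[symmetric] carc_in_arcs_of by auto

lemma arcs_of_lattice: "(u, v) \<in> arcs_of H \<Longrightarrow> {u, v} \<in> lattice_edges"
proof -
  assume "(u, v) \<in> arcs_of H"
  then obtain k f where "(u, v) = carc k f" by (auto simp: arcs_of_def)
  then have "{u, v} = fedge k f" unfolding fedge_def by (metis fst_conv snd_conv)
  then show ?thesis using fedge_lattice by simp
qed

text \<open>The height drops around a vertex telescope, so its net outflow vanishes.\<close>

lemma arcs_of_balanced:
  assumes "\<And>k f. \<bar>H f - H (nbr k f)\<bar> \<le> 1"
  shows "card {u. (u, v) \<in> arcs_of H} = card {w. (v, w) \<in> arcs_of H}"
proof -
  have sg: "sg (arcs_of H) k f = H f - H (nbr k f)" for k f
    using assms[of f k] unfolding sg_def carc_in_arcs_of swap_carc_in_arcs_of by (auto simp: of_bool_def)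
  obtain i j where v: "v = (i, j)" by (cases v) auto
  show ?thesis
    by (subst balanced_iff) (auto simp: v sum_around_sg sg dest: arcs_of_lattice)
qed

section \<open>Coordinates in the plane\<close>

text \<open>Coordinates with respect to the basis 1, \<open>cis (pi / 3)\<close>. Lattice vertices
  become the integer points, and the lattice lines those on which \<open>c1\<close>,
  \<open>c2\<close> or \<open>c1 + c2\<close> is an integer.\<close>

definition c1 :: "complex \<Rightarrow> real" where "c1 z = Re z - Im z / sqrt 3"
definition c2 :: "complex \<Rightarrow> real" where "c2 z = 2 * Im z / sqrt 3"

lemma c_embed [simp]: "c1 (embed (i, j)) = of_int i" "c2 (embed (i, j)) = of_int j"
  by (simp_all add: c1_def c2_def embed_def sin_60 cos_60)

lemma c_add: "c1 (z + w) = c1 z + c1 w" "c2 (z + w) = c2 z + c2 w"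
  by (simp_all add: c1_def c2_def add_divide_distrib)

lemma c_scaleR: "c1 (t *\<^sub>R z) = t * c1 z" "c2 (t *\<^sub>R z) = t * c2 z"
  by (simp_all add: c1_def c2_def algebra_simps)

lemma c_eqI: "c1 z = c1 w \<Longrightarrow> c2 z = c2 w \<Longrightarrow> z = w"
  by (simp add: c1_def c2_def complex_eq_iff)

lemma embed_inj: "embed u = embed v \<longleftrightarrow> u = v"
  using c_embed by (cases u; cases v) (metis of_int_eq_iff)

lemma c_continuous [continuous_intros]:
  "continuous_on T g \<Longrightarrow> continuous_on T (\<lambda>z. c1 (g z))"
  "continuous_on T g \<Longrightarrow> continuous_on T (\<lambda>z. c2 (g z))"
  unfolding c1_def c2_def by (intro continuous_intros; simp)+

lemma c_abs_le: "\<bar>c1 z\<bar> \<le> 2 * norm z" "\<bar>c2 z\<bar> \<le> 2 * norm z"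
proof -
  have s: "1 \<le> sqrt 3" by simp
  have "\<bar>Im z / sqrt 3\<bar> \<le> \<bar>Im z\<bar>"
    using divide_left_mono[OF s, of "\<bar>Im z\<bar>"] by (simp add: abs_divide)
  then have im: "\<bar>Im z / sqrt 3\<bar> \<le> norm z" using abs_Im_le_cmod[of z] by linarith
  then show "\<bar>c1 z\<bar> \<le> 2 * norm z" using abs_Re_le_cmod[of z] unfolding c1_def by linarith
  show "\<bar>c2 z\<bar> \<le> 2 * norm z" using im by (simp add: c2_def abs_mult)
qed

definition pt :: "real \<Rightarrow> real \<Rightarrow> complex" where
  "pt x y = Complex (x + y / 2) (y * sqrt 3 / 2)"

lemma c_pt [simp]: "c1 (pt x y) = x" "c2 (pt x y) = y"
  by (simp_all add: pt_def c1_def c2_def)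

section \<open>Open and closed triangles\<close>

fun tri :: "face \<Rightarrow> complex set" where
  "tri (i, j, b) = (if b then {z. of_int i < c1 z \<and> of_int j < c2 z \<and> c1 z + c2 z < of_int i + of_int j + 1}
     else {z. c1 z < of_int i + 1 \<and> c2 z < of_int j + 1 \<and> of_int i + of_int j + 1 < c1 z + c2 z})"

fun ctri :: "face \<Rightarrow> complex set" where
  "ctri (i, j, b) = (if b then {z. of_int i \<le> c1 z \<and> of_int j \<le> c2 z \<and> c1 z + c2 z \<le> of_int i + of_int j + 1}
     else {z. c1 z \<le> of_int i + 1 \<and> c2 z \<le> of_int j + 1 \<and> of_int i + of_int j + 1 \<le> c1 z + c2 z})"

fun centre :: "face \<Rightarrow> complex" where
  "centre (i, j, b) = (if b then pt (of_int i + 1 / 3) (of_int j + 1 / 3)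
     else pt (of_int i + 2 / 3) (of_int j + 2 / 3))"

lemma centre_in: "centre f \<in> tri f"
  by (cases f) auto

lemma open_tri: "open (tri f)"
proof -
  obtain i j b where f: "f = (i, j, b)" by (cases f) auto
  show ?thesis unfolding f tri.simps
    by (cases b; simp; intro open_Collect_conj open_Collect_less continuous_intros)
qed

lemma closed_ctri: "closed (ctri f)"
proof -
  obtain i j b where f: "f = (i, j, b)" by (cases f) auto
  show ?thesis unfolding f ctri.simps
    by (cases b; simp; intro closed_Collect_conj closed_Collect_le continuous_intros)
qed

lemma tri_subset_ctri: "tri f \<subseteq> ctri f"
  by (cases f) auto

lemma convex_comb_less:
  fixes a b l t :: real
  assumes "l \<le> a" "l < b" "0 < t" "t \<le> 1"
  shows "l < a + t * (b - a)"
proof -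
  have "0 \<le> (1 - t) * (a - l)" "0 < t * (b - l)" using assms by simp_all
  then show ?thesis by (simp add: algebra_simps)
qed

text \<open>This gives the convexity of \<open>tri f\<close> and, by letting \<open>t\<close> tend
  to 0, its closure.\<close>

lemma ctri_to_tri:
  assumes "z \<in> ctri f" "w \<in> tri f" "0 < t" "t \<le> 1"
  shows "z + t *\<^sub>R (w - z) \<in> tri f"
proof -
  obtain i j b where f: "f = (i, j, b)" by (cases f) auto
  have c: "c1 (z + t *\<^sub>R (w - z)) = c1 z + t * (c1 w - c1 z)" "c2 (z + t *\<^sub>R (w - z)) = c2 z + t * (c2 w - c2 z)"
    using c_add[of "w - z" z] by (simp_all add: c_add c_scaleR)
  have s: "c1 z + t * (c1 w - c1 z) + (c2 z + t * (c2 w - c2 z))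
      = (c1 z + c2 z) + t * ((c1 w + c2 w) - (c1 z + c2 z))" by (simp add: algebra_simps)
  note less = convex_comb_less[OF _ _ assms(3,4)]
  have gt: "a + t * (b - a) < u" if "a \<le> u" "b < u" for a b u :: real
    using less[of "- u" "- a" "- b"] that by (simp add: algebra_simps)
  show ?thesis
    using assms(1,2) unfolding f tri.simps ctri.simps
    by (cases b) (auto simp: c s intro!: less gt)
qed

lemma connected_tri: "connected (tri f)"
proof (rule convex_connected, unfold convex_alt, intro ballI allI impI)
  fix x y u assume a: "x \<in> tri f" "y \<in> tri f" "0 \<le> u \<and> u \<le> (1 :: real)"
  have eq: "(1 - u) *\<^sub>R x + u *\<^sub>R y = x + u *\<^sub>R (y - x)" by (simp add: algebra_simps)
  show "(1 - u) *\<^sub>R x + u *\<^sub>R y \<in> tri f"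
    unfolding eq using a ctri_to_tri[of x f y u] subsetD[OF tri_subset_ctri a(1)] by (cases "u = 0") auto
qed

lemma closure_tri: "closure (tri f) = ctri f"
proof
  show "closure (tri f) \<subseteq> ctri f"
    by (rule closure_minimal[OF tri_subset_ctri closed_ctri])
  show "ctri f \<subseteq> closure (tri f)"
  proof
    fix z assume z: "z \<in> ctri f"
    have "(\<lambda>n. z + (1 / real (Suc n)) *\<^sub>R (centre f - z)) \<longlonglongrightarrow> z + 0 *\<^sub>R (centre f - z)"
      by (intro tendsto_intros LIMSEQ_inverse_real_of_nat[unfolded inverse_eq_divide])
    then have "(\<lambda>n. z + (1 / real (Suc n)) *\<^sub>R (centre f - z)) \<longlonglongrightarrow> z" by simp
    moreover have "z + (1 / real (Suc n)) *\<^sub>R (centre f - z) \<in> tri f" for n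
      by (rule ctri_to_tri[OF z centre_in]) auto
    ultimately show "z \<in> closure (tri f)"
      unfolding closure_sequential by (intro exI[of _ "\<lambda>n. z + (1 / real (Suc n)) *\<^sub>R (centre f - z)"]) blast
  qed
qed

lemma frontier_tri: "frontier (tri f) = ctri f - tri f"
  by (simp add: frontier_def closure_tri interior_open open_tri)

section \<open>Edges in these coordinates\<close>

lemma in_edge_curve_pair:
  "z \<in> edge_curve {(a, b), (c, d)} \<longleftrightarrow>
    (\<exists>u. 0 \<le> u \<and> u \<le> 1 \<and> c1 z = (1 - u) * of_int a + u * of_int c \<and> c2 z = (1 - u) * of_int b + u * of_int d)"
proof -
  have "edge_curve {(a, b), (c, d)} = closed_segment (embed (a, b)) (embed (c, d))"
    by (simp add: edge_curve_def segment_convex_hull)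
  then have "z \<in> edge_curve {(a, b), (c, d)} \<longleftrightarrow>
      (\<exists>u. 0 \<le> u \<and> u \<le> 1 \<and> z = (1 - u) *\<^sub>R embed (a, b) + u *\<^sub>R embed (c, d))"
    by (simp add: in_segment)
  moreover have "z = (1 - u) *\<^sub>R embed (a, b) + u *\<^sub>R embed (c, d) \<longleftrightarrow>
      c1 z = (1 - u) * of_int a + u * of_int c \<and> c2 z = (1 - u) * of_int b + u * of_int d" for u
  proof
    assume "z = (1 - u) *\<^sub>R embed (a, b) + u *\<^sub>R embed (c, d)"
    then show "c1 z = (1 - u) * of_int a + u * of_int c \<and> c2 z = (1 - u) * of_int b + u * of_int d"
      by (simp only: c_add c_scaleR c_embed)
  next
    assume "c1 z = (1 - u) * of_int a + u * of_int c \<and> c2 z = (1 - u) * of_int b + u * of_int d"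
    then show "z = (1 - u) *\<^sub>R embed (a, b) + u *\<^sub>R embed (c, d)"
      by (intro c_eqI) (simp_all only: c_add c_scaleR c_embed)
  qed
  ultimately show ?thesis by simp
qed

lemma edge_curve_A: "z \<in> edge_curve (fedge A (i, j, True)) \<longleftrightarrow>
    c1 z + c2 z = of_int i + of_int j + 1 \<and> of_int i \<le> c1 z \<and> of_int j \<le> c2 z"
proof -
  have "fedge A (i, j, True) = {(i, j + 1), (i + 1, j)}" by (auto simp: fedge_def)
  then show ?thesis
    unfolding in_edge_curve_pair[of z, unfolded] by (simp add: in_edge_curve_pair)
      (auto simp: algebra_simps intro!: exI[of _ "c1 z - of_int i"])
qed

lemma edge_curve_B: "z \<in> edge_curve (fedge B (i, j, True)) \<longleftrightarrow>
    c1 z = of_int i \<and> of_int j \<le> c2 z \<and> c2 z \<le> of_int j + 1"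
proof -
  have "fedge B (i, j, True) = {(i, j), (i, j + 1)}" by (auto simp: fedge_def)
  then show ?thesis
    by (simp add: in_edge_curve_pair) (auto simp: algebra_simps intro!: exI[of _ "c2 z - of_int j"])
qed

lemma edge_curve_C: "z \<in> edge_curve (fedge C (i, j, True)) \<longleftrightarrow>
    c2 z = of_int j \<and> of_int i \<le> c1 z \<and> c1 z \<le> of_int i + 1"
proof -
  have "fedge C (i, j, True) = {(i, j), (i + 1, j)}" by (auto simp: fedge_def)
  then show ?thesis
    by (simp add: in_edge_curve_pair) (auto simp: algebra_simps intro!: exI[of _ "c1 z - of_int i"])
qed

lemmas edge_curve_up = edge_curve_A edge_curve_B edge_curve_C

lemma fedge_down:
  "fedge A (i, j, False) = fedge A (i, j, True)"
  "fedge B (i, j, False) = fedge B (i + 1, j, True)"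
  "fedge C (i, j, False) = fedge C (i, j + 1, True)"
  using fedge_nbr[of A "(i, j, True)"] fedge_nbr[of B "(i + 1, j, True)"] fedge_nbr[of C "(i, j + 1, True)"]
  by simp_all

lemma edge_curve_subset_ctri: "edge_curve (fedge k f) \<subseteq> ctri f"
proof -
  obtain i j b where f: "f = (i, j, b)" by (cases f) auto
  show ?thesis unfolding f
    by (cases k; cases b) (auto simp: edge_curve_up fedge_down)
qed

lemma frontier_tri_edges: "frontier (tri f) \<subseteq> (\<Union>k. edge_curve (fedge k f))"
proof
  fix z assume z: "z \<in> frontier (tri f)"
  obtain i j b where f: "f = (i, j, b)" by (cases f) auto
  have "\<exists>k. z \<in> edge_curve (fedge k f)"
  proof (rule ccontr)
    assume "\<nexists>k. z \<in> edge_curve (fedge k f)"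
    then have "z \<notin> edge_curve (fedge A f)" "z \<notin> edge_curve (fedge B f)" "z \<notin> edge_curve (fedge C f)" by auto
    then show False
      using z unfolding frontier_tri f by (cases b) (auto simp: edge_curve_up fedge_down)
  qed
  then show "z \<in> (\<Union>k. edge_curve (fedge k f))" by blast
qed

lemma not_int_between:
  assumes "of_int n < x" "x < of_int n + 1" shows "x \<noteq> (of_int m :: real)"
proof
  assume x: "x = of_int m"
  then have "n < m" using assms(1) by simp
  then have "of_int (n + 1) \<le> (of_int m :: real)" by (simp only: of_int_le_iff)
  then show False using assms(2) x by simp
qed

lemma tri_bounds:
  assumes "z \<in> tri (i, j, b)"
  shows "of_int i < c1 z" "c1 z < of_int i + 1" "of_int j < c2 z" "c2 z < of_int j + 1"
  using assms by (cases b; simp)+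

lemma ctri_bounds:
  assumes "z \<in> ctri (i, j, b)"
  shows "of_int i \<le> c1 z" "c1 z \<le> of_int i + 1" "of_int j \<le> c2 z" "c2 z \<le> of_int j + 1"
  using assms by (cases b; simp)+

text \<open>Every edge and vertex lies on a lattice line, so none of them meets an open
  triangle.\<close>

lemma tri_not_int:
  assumes "z \<in> tri f"
  shows "c1 z \<noteq> of_int m" "c2 z \<noteq> of_int m" "c1 z + c2 z \<noteq> of_int m"
proof -
  obtain i j b where f: "f = (i, j, b)" by (cases f) auto
  note z = tri_bounds[OF assms[unfolded f]]
  show "c1 z \<noteq> of_int m" "c2 z \<noteq> of_int m"
    using not_int_between[OF z(1,2)] not_int_between[OF z(3,4)] by auto
  show "c1 z + c2 z \<noteq> of_int m"
  proof (cases b)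
    case True
    then show ?thesis
      using not_int_between[of "i + j" "c1 z + c2 z"] assms z by (simp add: f)
  next
    case False
    then show ?thesis
      using not_int_between[of "i + j + 1" "c1 z + c2 z"] assms z by (simp add: f)
  qed
qed

lemma edge_curve_disjoint_tri: "edge_curve (fedge k (p, q, True)) \<inter> tri f = {}"
proof (rule ccontr)
  assume "edge_curve (fedge k (p, q, True)) \<inter> tri f \<noteq> {}"
  then obtain z where z: "z \<in> edge_curve (fedge k (p, q, True))" "z \<in> tri f" by blast
  show False
    using z(1) tri_not_int[OF z(2), of p] tri_not_int[OF z(2), of q] tri_not_int[OF z(2), of "p + q + 1"]
    by (cases k) (simp_all add: edge_curve_up)
qed

lemma lattice_edge_disjoint_tri: "e \<in> lattice_edges \<Longrightarrow> edge_curve e \<inter> tri f = {}"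
  using edge_curve_disjoint_tri lattice_edge_fedge by metis

lemma embed_notin_tri: "embed v \<notin> tri f"
proof -
  obtain i j b where f: "f = (i, j, b)" by (cases f) auto
  obtain p q where v: "v = (p, q)" by (cases v) auto
  show ?thesis unfolding f v
    using tri_not_int(1)[of "embed (p, q)" "(i, j, b)" p] by auto
qed

lemma open_edge_coords:
  assumes "z \<in> edge_curve (fedge k (i, j, True))" "z \<notin> embed ` fedge k (i, j, True)"
  shows "case k of
      A \<Rightarrow> c1 z + c2 z = of_int i + of_int j + 1 \<and> of_int i < c1 z \<and> c1 z < of_int i + 1 \<and> of_int j < c2 z \<and> c2 z < of_int j + 1
    | B \<Rightarrow> c1 z = of_int i \<and> of_int j < c2 z \<and> c2 z < of_int j + 1
    | C \<Rightarrow> c2 z = of_int j \<and> of_int i < c1 z \<and> c1 z < of_int i + 1"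
proof -
  have ne: "c1 z \<noteq> of_int (fst v) \<or> c2 z \<noteq> of_int (snd v)" if "v \<in> fedge k (i, j, True)" for v
    using assms(2) that c_eqI[of z "embed v"] c_embed[of "fst v" "snd v"] by (auto simp: image_iff)
  have mem: "(i, j + 1) \<in> fedge A (i, j, True)" "(i + 1, j) \<in> fedge A (i, j, True)"
    "(i, j + 1) \<in> fedge B (i, j, True)" "(i, j) \<in> fedge B (i, j, True)"
    "(i + 1, j) \<in> fedge C (i, j, True)" "(i, j) \<in> fedge C (i, j, True)"
    by (auto simp: fedge_def)
  show ?thesis
  proof (cases k)
    case A
    have z: "c1 z + c2 z = of_int i + of_int j + 1" "of_int i \<le> c1 z" "of_int j \<le> c2 z"
      using assms(1) A by (simp_all add: edge_curve_up)
    have "c1 z \<noteq> of_int i" "c2 z \<noteq> of_int j"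
      using ne[of "(i, j + 1)"] ne[of "(i + 1, j)"] mem(1,2) A z(1) by auto
    then have "of_int i < c1 z" "of_int j < c2 z" using z by simp_all
    then show ?thesis using z(1) A by simp
  next
    case B
    have z: "c1 z = of_int i" "of_int j \<le> c2 z" "c2 z \<le> of_int j + 1"
      using assms(1) B by (simp_all add: edge_curve_up)
    have "c2 z \<noteq> of_int j" "c2 z \<noteq> of_int j + 1"
      using ne[of "(i, j + 1)"] ne[of "(i, j)"] mem(3,4) B z(1) by auto
    then show ?thesis using z B by simp
  next
    case C
    have z: "c2 z = of_int j" "of_int i \<le> c1 z" "c1 z \<le> of_int i + 1"
      using assms(1) C by (simp_all add: edge_curve_up)
    have "c1 z \<noteq> of_int i" "c1 z \<noteq> of_int i + 1"
      using ne[of "(i + 1, j)"] ne[of "(i, j)"] mem(5,6) C z(1) by auto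
    then show ?thesis using z C by simp
  qed
qed

lemma int_eqI:
  assumes "of_int i < x" "x < of_int i + 1" "of_int p \<le> x" "x \<le> (of_int p + 1 :: real)"
  shows "i = p"
proof -
  have "of_int i < (of_int (p + 1) :: real)" "of_int p < (of_int (i + 1) :: real)" using assms by simp_all
  then have "i < p + 1" "p < i + 1" by (simp_all only: of_int_less_iff)
  then show ?thesis by simp
qed

text \<open>Planarity of the drawing. At an inner point of an edge exactly one of \<open>c1\<close>,
  \<open>c2\<close>, \<open>c1 + c2\<close> is an integer; this determines the direction of the
  edge, and then the integer parts determine its position.\<close>

lemma open_edge_unique:
  assumes "e \<in> lattice_edges" "e' \<in> lattice_edges" "z \<in> edge_curve e - embed ` e" "z \<in> edge_curve e'"
  shows "e = e'"
proof -
  obtain k i j where e: "e = fedge k (i, j, True)" using lattice_edge_fedge assms(1) by metis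
  obtain l p q where e': "e' = fedge l (p, q, True)" using lattice_edge_fedge assms(2) by metis
  have z: "z \<in> edge_curve (fedge l (p, q, True))" using assms(4) e' by simp
  note o = open_edge_coords[of z k i j] and c = assms(3)[unfolded e] z
  have "k = l \<and> i = p \<and> j = q"
  proof (cases k)
    case A
    with o c have z': "c1 z + c2 z = of_int i + of_int j + 1" "of_int i < c1 z" "c1 z < of_int i + 1"
      "of_int j < c2 z" "c2 z < of_int j + 1" by auto
    show ?thesis
    proof (cases l)
      case A' : A
      then have l: "c1 z + c2 z = of_int p + of_int q + 1" "of_int p \<le> c1 z" "of_int q \<le> c2 z"
        using c by (simp_all add: edge_curve_up)
      then have "i = p" "j = q"
        using int_eqI[OF z'(2,3), of p] int_eqI[OF z'(4,5), of q] by auto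
      then show ?thesis using A A' by simp
    qed (use c not_int_between[OF z'(2,3), of p] not_int_between[OF z'(4,5), of q] in \<open>auto simp: edge_curve_up\<close>)
  next
    case B
    with o c have z': "c1 z = of_int i" "of_int j < c2 z" "c2 z < of_int j + 1" by auto
    show ?thesis
    proof (cases l)
      case B' : B
      then have l: "c1 z = of_int p" "of_int q \<le> c2 z" "c2 z \<le> of_int q + 1"
        using c by (simp_all add: edge_curve_up)
      then have "i = p" "j = q"
        using z'(1) int_eqI[OF z'(2,3), of q] by auto
      then show ?thesis using B B' by simp
    next
      case A
      then have "c2 z = of_int (p + q + 1 - i)" using c z'(1) by (simp add: edge_curve_up)
      then show ?thesis using not_int_between[OF z'(2,3)] by blast
    qed (use c not_int_between[OF z'(2,3), of q] in \<open>auto simp: edge_curve_up\<close>)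
  next
    case C
    with o c have z': "c2 z = of_int j" "of_int i < c1 z" "c1 z < of_int i + 1" by auto
    show ?thesis
    proof (cases l)
      case C' : C
      then have l: "c2 z = of_int q" "of_int p \<le> c1 z" "c1 z \<le> of_int p + 1"
        using c by (simp_all add: edge_curve_up)
      then have "i = p" "j = q"
        using z'(1) int_eqI[OF z'(2,3), of p] by auto
      then show ?thesis using C C' by simp
    next
      case A
      then have "c1 z = of_int (p + q + 1 - j)" using c z'(1) by (simp add: edge_curve_up)
      then show ?thesis using not_int_between[OF z'(2,3)] by blast
    qed (use c not_int_between[OF z'(2,3), of p] in \<open>auto simp: edge_curve_up\<close>)
  qed
  then show ?thesis using e e' by simp
qed

lemma embed_in_edge_curve:
  assumes "e \<in> lattice_edges" "embed v \<in> edge_curve e"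
  shows "v \<in> e"
proof (rule ccontr)
  assume "v \<notin> e"
  obtain k i j where e: "e = fedge k (i, j, True)" using lattice_edge_fedge assms(1) by metis
  obtain p q where v: "v = (p, q)" by (cases v) auto
  have "embed v \<notin> embed ` e" using \<open>v \<notin> e\<close> embed_inj by (metis imageE)
  then show False
    using open_edge_coords[of "embed v" k i j] assms(2) not_int_between[of i "of_int p" p] not_int_between[of j "of_int q" q]
    unfolding e v by (cases k) auto
qed

section \<open>The plane as a union of triangles\<close>

lemma ctri_cover: "\<exists>f. z \<in> ctri f"
proof -
  define i j where "i = \<lfloor>c1 z\<rfloor>" and "j = \<lfloor>c2 z\<rfloor>"
  have ij: "of_int i \<le> c1 z" "c1 z < of_int i + 1" "of_int j \<le> c2 z" "c2 z < of_int j + 1"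
    by (auto simp: i_def j_def)
  show ?thesis
  proof (cases "c1 z + c2 z \<le> of_int i + of_int j + 1")
    case True
    then have "z \<in> ctri (i, j, True)" using ij by simp
    then show ?thesis by blast
  next
    case False
    then have "z \<in> ctri (i, j, False)" using ij by simp
    then show ?thesis by blast
  qed
qed

lemma tri_ctri_eq:
  assumes "z \<in> tri f" "z \<in> ctri g" shows "f = g"
proof -
  obtain i j b where f: "f = (i, j, b)" by (cases f) auto
  obtain p q c where g: "g = (p, q, c)" by (cases g) auto
  note z = tri_bounds[OF assms(1)[unfolded f]] and z' = ctri_bounds[OF assms(2)[unfolded g]]
  have "i = p" "j = q" using int_eqI[OF z(1,2) z'(1,2)] int_eqI[OF z(3,4) z'(3,4)] by auto
  moreover have "b = c" using assms \<open>i = p\<close> \<open>j = q\<close> unfolding f g by (cases b; cases c; simp)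
  ultimately show ?thesis by (simp add: f g)
qed

lemma tri_inj: "tri f = tri g \<longleftrightarrow> f = g"
  using tri_ctri_eq centre_in tri_subset_ctri by blast

lemma norm_le_c: "norm z \<le> \<bar>c1 z\<bar> + 2 * \<bar>c2 z\<bar>"
proof -
  have im: "Im z = c2 z * (sqrt 3 / 2)" by (simp add: c2_def)
  have re: "Re z = c1 z + c2 z / 2" by (simp add: c1_def c2_def)
  have "sqrt 3 \<le> sqrt 4" by (rule real_sqrt_le_mono) simp
  then have s: "sqrt 3 / 2 \<le> 1" by simp
  have "\<bar>Im z\<bar> = \<bar>c2 z\<bar> * (sqrt 3 / 2)" unfolding im by (simp add: abs_mult)
  also have "\<dots> \<le> \<bar>c2 z\<bar> * 1" by (intro mult_left_mono s) simp
  finally have "\<bar>Im z\<bar> \<le> \<bar>c2 z\<bar>" by simp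
  moreover have "\<bar>Re z\<bar> \<le> \<bar>c1 z\<bar> + \<bar>c2 z\<bar> / 2" unfolding re by linarith
  ultimately show ?thesis using cmod_le[of z] by linarith
qed

lemma bounded_tri: "bounded (tri f)"
proof -
  obtain i j b where f: "f = (i, j, b)" by (cases f) auto
  have "norm z \<le> (\<bar>of_int i\<bar> + 1) + 2 * (\<bar>of_int j\<bar> + 1)" if "z \<in> tri f" for z
  proof -
    note z = tri_bounds[OF that[unfolded f]]
    have "\<bar>c1 z\<bar> \<le> \<bar>of_int i\<bar> + 1" using z by arith
    moreover have "\<bar>c2 z\<bar> \<le> \<bar>of_int j\<bar> + 1" using z by arith
    ultimately have "\<bar>c1 z\<bar> + 2 * \<bar>c2 z\<bar> \<le> (\<bar>of_int i\<bar> + 1) + 2 * (\<bar>of_int j\<bar> + 1)"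
      by (intro add_mono mult_left_mono) auto
    then show ?thesis by (rule order_trans[OF norm_le_c])
  qed
  then show ?thesis unfolding bounded_iff by blast
qed

lemma finite_ctri_meets:
  assumes "bounded T" shows "finite {f. ctri f \<inter> T \<noteq> {}}"
proof -
  obtain M where M: "\<And>z. z \<in> T \<Longrightarrow> norm z \<le> M" using assms unfolding bounded_iff by blast
  define N where "N = \<lceil>2 * M\<rceil> + 1"
  have "{f. ctri f \<inter> T \<noteq> {}} \<subseteq> {- N..N} \<times> {- N..N} \<times> UNIV"
  proof
    fix f assume "f \<in> {f. ctri f \<inter> T \<noteq> {}}"
    then obtain z where z: "z \<in> ctri f" "z \<in> T" by blast
    obtain i j b where f: "f = (i, j, b)" by (cases f) auto
    note zb = ctri_bounds[OF z(1)[unfolded f]]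
    have "\<bar>c1 z\<bar> \<le> 2 * M" "\<bar>c2 z\<bar> \<le> 2 * M" using c_abs_le[of z] M[OF z(2)] by auto
    moreover have "2 * M \<le> of_int (N - 1)" by (simp add: N_def)
    ultimately have "of_int i \<le> (of_int (N - 1) :: real)" "of_int (- (N - 1)) \<le> (of_int (i + 1) :: real)"
      "of_int j \<le> (of_int (N - 1) :: real)" "of_int (- (N - 1)) \<le> (of_int (j + 1) :: real)"
      using zb by (simp_all add: abs_le_iff)
    then have "i \<le> N - 1" "- (N - 1) \<le> i + 1" "j \<le> N - 1" "- (N - 1) \<le> j + 1"
      by (simp_all only: of_int_le_iff)
    then show "f \<in> {- N..N} \<times> {- N..N} \<times> UNIV" by (simp add: f)
  qed
  then show ?thesis by (rule finite_subset) simp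
qed

text \<open>The triangles are locally finite, so those that miss \<open>z\<close> keep a positive
  distance from it.\<close>

lemma ctri_locally:
  obtains e where "0 < e" "\<And>w f. w \<in> ball z e \<Longrightarrow> w \<in> ctri f \<Longrightarrow> z \<in> ctri f"
proof -
  let ?Fs = "{f. ctri f \<inter> ball z 1 \<noteq> {}} - {f. z \<in> ctri f}"
  have fin: "finite ?Fs" using finite_ctri_meets[of "ball z 1"] by simp
  have "closed (\<Union>f\<in>?Fs. ctri f)" using fin closed_ctri by (intro closed_UN) auto
  then have "open (- (\<Union>f\<in>?Fs. ctri f))" by (rule open_Compl)
  moreover have "z \<in> - (\<Union>f\<in>?Fs. ctri f)" by blast
  ultimately obtain e where e: "0 < e" "ball z e \<subseteq> - (\<Union>f\<in>?Fs. ctri f)"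
    by (meson open_contains_ball)
  show ?thesis
  proof (rule that[of "min e 1"])
    show "0 < min e 1" using e by simp
    fix w f assume w: "w \<in> ball z (min e 1)" "w \<in> ctri f"
    show "z \<in> ctri f"
    proof (rule ccontr)
      assume "z \<notin> ctri f"
      then have "f \<in> ?Fs" using w by auto
      moreover have "w \<in> ball z e" using w(1) by simp
      ultimately show False using w(2) e(2) by blast
    qed
  qed
qed

text \<open>All triangles at \<open>z\<close> are linked by crossing sides through \<open>z\<close>.
  Each is compared with the triangle \<open>f0\<close> given by the integer parts of the
  coordinates; a cell with a different offset contains \<open>z\<close> only if \<open>z\<close> is
  on the left or lower side of the cell of \<open>f0\<close>, or at its corner.\<close>

lemma same_height_at_point:
  assumes same: "\<And>k f. z \<in> edge_curve (fedge k f) \<Longrightarrow> H (nbr k f) = (H f :: int)"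
    and "z \<in> ctri f" "z \<in> ctri g"
  shows "H f = H g"
proof -
  define p q where "p = \<lfloor>c1 z\<rfloor>" and "q = \<lfloor>c2 z\<rfloor>"
  have pq: "of_int p \<le> c1 z" "c1 z < of_int p + 1" "of_int q \<le> c2 z" "c2 z < of_int q + 1"
    by (auto simp: p_def q_def)
  define f0 where "f0 = (p, q, c1 z + c2 z \<le> of_int p + of_int q + 1)"
  have A: "H (i, j, False) = H (i, j, True)"
    if "c1 z + c2 z = of_int i + of_int j + 1" "of_int i \<le> c1 z" "of_int j \<le> c2 z" for i j
    using same[of A "(i, j, True)"] that by (simp add: edge_curve_up)
  have B: "H (i - 1, j, False) = H (i, j, True)"
    if "c1 z = of_int i" "of_int j \<le> c2 z" "c2 z \<le> of_int j + 1" for i j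
    using same[of B "(i, j, True)"] that by (simp add: edge_curve_up)
  have C: "H (i, j - 1, False) = H (i, j, True)"
    if "c2 z = of_int j" "of_int i \<le> c1 z" "c1 z \<le> of_int i + 1" for i j
    using same[of C "(i, j, True)"] that by (simp add: edge_curve_up)
  have "H h = H f0" if h: "z \<in> ctri h" for h
  proof -
    obtain i j b where h_eq: "h = (i, j, b)" by (cases h) auto
    note zb = ctri_bounds[OF h[unfolded h_eq]]
    have "of_int i < (of_int (p + 1) :: real)" "of_int p \<le> (of_int (i + 1) :: real)"
      "of_int j < (of_int (q + 1) :: real)" "of_int q \<le> (of_int (j + 1) :: real)" using zb pq by simp_all
    then have "i < p + 1" "p \<le> i + 1" "j < q + 1" "q \<le> j + 1"
      by (simp_all only: of_int_le_iff of_int_less_iff)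
    then consider "i = p" "j = q" | "i = p - 1" "j = q" | "i = p" "j = q - 1" | "i = p - 1" "j = q - 1"
      by linarith
    then show ?thesis
    proof cases
      case 1
      show ?thesis
      proof (cases "c1 z + c2 z \<le> of_int p + of_int q + 1")
        case True
        then show ?thesis using h 1 A[of p q] pq by (cases b) (simp_all add: h_eq f0_def)
      next
        case False
        then show ?thesis using h 1 by (cases b) (simp_all add: h_eq f0_def)
      qed
    next
      case 2
      then have x: "c1 z = of_int p" using zb pq by simp
      have f0: "f0 = (p, q, True)" using x pq by (simp add: f0_def)
      have d: "H (p - 1, q, False) = H (p, q, True)" using B[of p q] x pq by simp
      show ?thesis
      proof (cases b)
        case True
        then have "c2 z = of_int q" using h x 2 pq by (simp add: h_eq)
        then have "H (p - 1, q, False) = H (p - 1, q, True)" using A[of "p - 1" q] x by simp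
        then show ?thesis using d f0 True 2 by (simp add: h_eq)
      qed (use d f0 2 in \<open>simp add: h_eq\<close>)
    next
      case 3
      then have y: "c2 z = of_int q" using zb pq by simp
      have f0: "f0 = (p, q, True)" using y pq by (simp add: f0_def)
      have d: "H (p, q - 1, False) = H (p, q, True)" using C[of q p] y pq by simp
      show ?thesis
      proof (cases b)
        case True
        then have "c1 z = of_int p" using h y 3 pq by (simp add: h_eq)
        then have "H (p, q - 1, False) = H (p, q - 1, True)" using A[of p "q - 1"] y by simp
        then show ?thesis using d f0 True 3 by (simp add: h_eq)
      qed (use d f0 3 in \<open>simp add: h_eq\<close>)
    next
      case 4
      then have xy: "c1 z = of_int p" "c2 z = of_int q" using zb pq by simp_all
      have f0: "f0 = (p, q, True)" using xy by (simp add: f0_def)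
      have "\<not> b" using h xy 4 by (auto simp: h_eq)
      moreover have "H (p - 1, q, False) = H (p, q, True)" using B[of p q] xy by simp
      moreover have "H (p - 1, q, False) = H (p - 1, q, True)" using A[of "p - 1" q] xy by simp
      moreover have "H (p - 1, q - 1, False) = H (p - 1, q, True)" using C[of q "p - 1"] xy by simp
      ultimately show ?thesis using f0 4 by (simp add: h_eq)
    qed
  qed
  then show ?thesis using assms(2,3) by metis
qed

text \<open>A locally constant function on a connected set is constant. Working with points instead
  of faces avoids constructing a chain of adjacent faces along \<open>T\<close>.\<close>

lemma same_height_connected:
  assumes conn: "connected T"
    and same: "\<And>z k f. z \<in> T \<Longrightarrow> z \<in> edge_curve (fedge k f) \<Longrightarrow> H (nbr k f) = (H f :: int)"
    and "tri f \<inter> T \<noteq> {}" "tri g \<inter> T \<noteq> {}"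
  shows "H f = H g"
proof -
  define R where "R = (\<lambda>x y. \<forall>f g. x \<in> ctri f \<longrightarrow> y \<in> ctri g \<longrightarrow> H f = H g)"
  obtain a b where ab: "a \<in> T" "b \<in> T" "a \<in> tri f" "b \<in> tri g" using assms(3,4) by blast
  have "R a b"
  proof (rule connected_equivalence_relation[OF conn ab(1,2)])
    show "R y x" if "R x y" for x y using that by (auto simp: R_def)
    show "R x z" if "R x y" "R y z" for x y z
      using that ctri_cover[of y] unfolding R_def by metis
    fix x assume "x \<in> T"
    obtain e where e: "0 < e" "\<And>w f. w \<in> ball x e \<Longrightarrow> w \<in> ctri f \<Longrightarrow> x \<in> ctri f"
      using ctri_locally by metis
    have "R x w" if "w \<in> ball x e" for w
      unfolding R_def using same_height_at_point[of x H] same[OF \<open>x \<in> T\<close>] e(2)[OF that] by blast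
    then have "openin (top_of_set T) (T \<inter> ball x e) \<and> x \<in> T \<inter> ball x e \<and> (\<forall>w\<in>T \<inter> ball x e. R x w)"
      using \<open>x \<in> T\<close> e(1) by (auto intro: openin_open_Int)
    then show "\<exists>U. openin (top_of_set T) U \<and> x \<in> U \<and> (\<forall>w\<in>U. R x w)" by blast
  qed
  then show ?thesis using ab tri_subset_ctri unfolding R_def by blast
qed

section \<open>Bounded faces of a solid subgraph\<close>

locale solid =
  fixes V :: "vertex set" and E Bd :: "edge set"
  assumes cycle: "lattice_cycle Bd"
    and V_eq: "V = \<Union>Bd \<union> {v. embed v \<in> inside (drawing (\<Union>Bd) Bd)}"
    and E_eq: "E = Bd \<union> {e \<in> lattice_edges. edge_curve e - embed ` e \<subseteq> inside (drawing (\<Union>Bd) Bd)}"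
begin

abbreviation "DB \<equiv> drawing (\<Union>Bd) Bd"

text \<open>A combinatorial description of the bounded faces, justified by
  \<open>bounded_faces_eq\<close>.\<close>

definition Sf :: "face set" where
  "Sf = {f. \<forall>k. fedge k f \<in> E}"

lemma Bd_lattice: "Bd \<subseteq> lattice_edges"
  using cycle by (simp add: lattice_cycle_def)

lemma E_lattice: "E \<subseteq> lattice_edges"
  using Bd_lattice by (auto simp: E_eq)

lemma finite_Bd: "finite Bd" and Bd_nonempty: "Bd \<noteq> {}"
proof -
  obtain vs where vs: "3 \<le> length vs" "Bd = arc_edges (cycle_arcs vs)"
    using cycle by (auto simp: lattice_cycle_def directed_cycle_def)
  have "cycle_arcs vs = (\<lambda>i. (vs ! i, vs ! (Suc i mod length vs))) ` {..<length vs}"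
    by (auto simp: cycle_arcs_def)
  moreover have "Bd = (\<lambda>(u, v). {u, v}) ` cycle_arcs vs"
    unfolding vs(2) arc_edges_def by (auto simp: image_iff)
  ultimately have Bd: "Bd = (\<lambda>(u, v). {u, v}) ` (\<lambda>i. (vs ! i, vs ! (Suc i mod length vs))) ` {..<length vs}"
    by simp
  show "finite Bd" unfolding Bd by simp
  have "0 < length vs" using vs(1) by linarith
  then have "{..<length vs} \<noteq> {}" by blast
  then show "Bd \<noteq> {}" unfolding Bd by simp
qed

lemma edge_curve_segment: "edge_curve {u, v} = closed_segment (embed u) (embed v)"
  by (simp add: edge_curve_def segment_convex_hull)

lemma embed_edge_curve: "v \<in> e \<Longrightarrow> embed v \<in> edge_curve e"
  by (simp add: edge_curve_def hull_inc)

lemma lattice_edge_pair: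
  assumes "e \<in> lattice_edges" obtains u v where "e = {u, v}" "u \<noteq> v"
proof -
  obtain k i j where e: "e = fedge k (i, j, True)" using lattice_edge_fedge assms by metis
  show ?thesis
    by (rule that[of "fst (carc k (i, j, True))" "snd (carc k (i, j, True))"])
      (use e in \<open>cases k; auto simp: fedge_def\<close>)+
qed

lemma DB_eq: "DB = (\<Union>e\<in>Bd. edge_curve e)"
  using embed_edge_curve by (auto simp: drawing_def)

lemma bounded_DB: "bounded DB"
  unfolding DB_eq
proof (rule bounded_UN[OF finite_Bd], rule ballI)
  fix e assume "e \<in> Bd"
  then obtain u v where "e = {u, v}" using lattice_edge_pair Bd_lattice by blast
  then show "bounded (edge_curve e)"
    unfolding \<open>e = {u, v}\<close> edge_curve_segment by (intro compact_imp_bounded compact_segment)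
qed

lemma bounded_inside_DB: "bounded (inside DB)"
  by (rule bounded_inside[OF bounded_DB])

section \<open>Position of triangles and edges relative to the boundary cycle\<close>

lemma inside_connected:
  assumes "connected T" "T \<inter> DB = {}" "z \<in> T" "z \<in> inside DB"
  shows "T \<subseteq> inside DB"
proof
  fix w assume w: "w \<in> T"
  have "connected_component (- DB) z w"
    unfolding connected_component_def using assms w by blast
  then have "connected_component_set (- DB) z = connected_component_set (- DB) w"
    by (simp add: connected_component_eq)
  then show "w \<in> inside DB" using assms(2,4) w by (auto simp: inside_def)
qed

lemma open_edge_connected:
  assumes "e \<in> lattice_edges"
  shows "connected (edge_curve e - embed ` e)" "edge_curve e - embed ` e \<noteq> {}"
    "closure (edge_curve e - embed ` e) = edge_curve e"
proof -
  obtain u v where e: "e = {u, v}" "u \<noteq> v" using lattice_edge_pair assms by blast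
  then have ne: "embed u \<noteq> embed v" using embed_inj by simp
  have eq: "edge_curve e - embed ` e = open_segment (embed u) (embed v)"
    by (simp add: e edge_curve_segment open_segment_def)
  show "connected (edge_curve e - embed ` e)"
    unfolding eq by (intro convex_connected convex_open_segment)
  show "edge_curve e - embed ` e \<noteq> {}" unfolding eq using ne by simp
  show "closure (edge_curve e - embed ` e) = edge_curve e"
    unfolding eq closure_open_segment using ne by (simp add: e edge_curve_segment)
qed

text \<open>An endpoint of an inner edge is a limit of its open segment; if it is not on the
  boundary cycle, it lies inside together with the segment.\<close>

lemma UE_subset: "\<Union>E \<subseteq> V"
proof
  fix v assume "v \<in> \<Union>E"
  then obtain e where e: "e \<in> E" "v \<in> e" by blast
  show "v \<in> V"
  proof (cases "e \<in> Bd \<or> embed v \<in> DB")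
    case True
    then have "v \<in> \<Union>Bd"
      using e embed_in_edge_curve Bd_lattice unfolding DB_eq by blast
    then show ?thesis by (simp add: V_eq)
  next
    case False
    then have e': "e \<in> lattice_edges" "edge_curve e - embed ` e \<subseteq> inside DB" using e by (auto simp: E_eq)
    let ?T = "insert (embed v) (edge_curve e - embed ` e)"
    obtain z where z: "z \<in> edge_curve e - embed ` e" using open_edge_connected(2)[OF e'(1)] by blast
    have "?T \<subseteq> inside DB"
    proof (rule inside_connected)
      show "connected ?T"
        by (rule connected_intermediate_closure[OF open_edge_connected(1)[OF e'(1)]])
          (use open_edge_connected(3)[OF e'(1)] embed_edge_curve[OF e(2)] in auto)
      show "?T \<inter> DB = {}" using False e'(2) inside_no_overlap[of DB] by blast
      show "z \<in> ?T" "z \<in> inside DB" using z e'(2) by auto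
    qed
    then show ?thesis by (simp add: V_eq)
  qed
qed

lemma embed_V: "v \<in> V \<Longrightarrow> embed v \<in> DB \<union> inside DB"
proof -
  assume "v \<in> V"
  then consider "v \<in> \<Union>Bd" | "embed v \<in> inside DB" unfolding V_eq by blast
  then show ?thesis
  proof cases
    case 1
    then have "embed v \<in> DB" using embed_edge_curve unfolding DB_eq by blast
    then show ?thesis by blast
  qed blast
qed

lemma drawing_subset: "drawing V E \<subseteq> DB \<union> inside DB"
proof
  fix z assume "z \<in> drawing V E"
  then consider v where "v \<in> V" "z = embed v" | e where "e \<in> E" "z \<in> edge_curve e"
    by (auto simp: drawing_def)
  then show "z \<in> DB \<union> inside DB"
  proof cases
    case 1
    then show ?thesis using embed_V by blast
  next
    case 2
    show ?thesis
    proof (cases "e \<in> Bd")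
      case True
      then show ?thesis using 2 by (auto simp: DB_eq)
    next
      case False
      show ?thesis
      proof (cases "z \<in> embed ` e")
        case True
        then obtain v where "v \<in> e" "z = embed v" by blast
        then have "v \<in> V" using UE_subset 2 by blast
        then show ?thesis using \<open>z = embed v\<close> embed_V by blast
      next
        case zF: False
        then show ?thesis using False 2 by (auto simp: E_eq)
      qed
    qed
  qed
qed

lemma outside_disjoint: "outside DB \<inter> drawing V E = {}"
  using drawing_subset inside_Int_outside[of DB] outside_no_overlap[of DB] by blast

lemma tri_disjoint_drawing: "E' \<subseteq> lattice_edges \<Longrightarrow> tri f \<inter> drawing V' E' = {}"
  unfolding drawing_def using lattice_edge_disjoint_tri embed_notin_tri by blast

lemma connected_outside_DB: "connected (outside DB)"
  by (rule connected_outside[OF bounded_DB]) simp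

lemma unbounded_outside_DB: "\<not> bounded (outside DB)"
  by (rule unbounded_outside[OF bounded_DB])

lemma tri_inside_or_outside: "tri f \<subseteq> inside DB \<or> tri f \<subseteq> outside DB"
proof -
  have dis: "tri f \<inter> DB = {}" by (rule tri_disjoint_drawing[OF Bd_lattice])
  show ?thesis
  proof (cases "centre f \<in> inside DB")
    case True
    then show ?thesis using inside_connected[OF connected_tri dis centre_in] by blast
  next
    case False
    have "tri f \<subseteq> outside DB"
    proof
      fix w assume w: "w \<in> tri f"
      then have "w \<notin> inside DB"
        using inside_connected[OF connected_tri dis w] False centre_in by blast
      then show "w \<in> outside DB" using w dis inside_Un_outside[of DB] by blast
    qed
    then show ?thesis by blast
  qed
qed

text \<open>A side off the boundary cycle has its open segment in the closure of the triangle and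
  disjoint from the cycle, so connectedness puts the segment inside as well.\<close>

lemma inside_Sf:
  assumes "tri f \<subseteq> inside DB" shows "f \<in> Sf"
proof -
  have "fedge k f \<in> E" for k
  proof (cases "fedge k f \<in> Bd")
    case True
    then show ?thesis by (simp add: E_eq)
  next
    case False
    let ?e = "fedge k f"
    let ?o = "edge_curve ?e - embed ` ?e"
    have dis: "?o \<inter> DB = {}"
      using open_edge_unique[OF fedge_lattice] Bd_lattice False unfolding DB_eq by blast
    have "tri f \<union> ?o \<subseteq> inside DB"
    proof (rule inside_connected)
      show "connected (tri f \<union> ?o)"
        by (rule connected_intermediate_closure[OF connected_tri])
          (use edge_curve_subset_ctri[of k f] tri_subset_ctri[of f] in \<open>auto simp: closure_tri\<close>)
      show "(tri f \<union> ?o) \<inter> DB = {}" using dis tri_disjoint_drawing[OF Bd_lattice, of f] by blast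
      show "centre f \<in> tri f \<union> ?o" using centre_in by blast
      show "centre f \<in> inside DB" by (rule subsetD[OF assms centre_in])
    qed
    then show ?thesis using fedge_lattice by (simp add: E_eq)
  qed
  then show ?thesis by (simp add: Sf_def)
qed

lemma notin_Sf_outside: "f \<notin> Sf \<Longrightarrow> tri f \<subseteq> outside DB"
  using tri_inside_or_outside inside_Sf by blast

lemma frontier_drawing: "f \<in> Sf \<Longrightarrow> frontier (tri f) \<subseteq> drawing V E"
  using frontier_tri_edges[of f] by (fastforce simp: Sf_def drawing_def)

lemma tri_component:
  assumes "f \<in> Sf" shows "tri f \<in> components (- drawing V E)"
  unfolding in_components_maximal
proof (intro conjI allI impI)
  show "tri f \<noteq> {}" using centre_in by blast
  show "tri f \<subseteq> - drawing V E" using tri_disjoint_drawing[OF E_lattice] by blast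
  show "connected (tri f)" by (rule connected_tri)
  fix D assume D: "D \<noteq> {} \<and> tri f \<subseteq> D \<and> D \<subseteq> - drawing V E \<and> connected D"
  show "D = tri f"
  proof (rule ccontr)
    assume "D \<noteq> tri f"
    then have "D \<inter> frontier (tri f) \<noteq> {}"
      by (intro connected_Int_frontier) (use D centre_in[of f] in blast)+
    then show False using frontier_drawing[OF assms] D by blast
  qed
qed

text \<open>A component contains the open triangle next to any of its points. If that triangle is
  not in \<open>Sf\<close>, it lies outside the boundary cycle, and the component swallows the whole
  unbounded outside.\<close>

lemma bounded_faces_eq: "bounded_faces V E = tri ` Sf"
proof
  show "tri ` Sf \<subseteq> bounded_faces V E"
    using tri_component bounded_tri by (auto simp: bounded_faces_def)
  show "bounded_faces V E \<subseteq> tri ` Sf"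
  proof
    fix F assume "F \<in> bounded_faces V E"
    then have F: "F \<in> components (- drawing V E)" "bounded F" by (auto simp: bounded_faces_def)
    obtain z where z: "z \<in> F" using in_components_nonempty[OF F(1)] by blast
    obtain f where f: "z \<in> ctri f" using ctri_cover by blast
    have "connected (insert z (tri f))"
      by (rule connected_intermediate_closure[OF connected_tri])
        (use f closure_subset[of "tri f"] in \<open>auto simp: closure_tri\<close>)
    moreover have "insert z (tri f) \<subseteq> - drawing V E"
      using tri_disjoint_drawing[OF E_lattice, of f] in_components_subset[OF F(1)] z by blast
    ultimately have sub: "insert z (tri f) \<subseteq> F"
      using components_maximal[OF F(1)] z by blast
    have "f \<in> Sf"
    proof (rule ccontr)
      assume "f \<notin> Sf"
      then have "tri f \<subseteq> outside DB" by (rule notin_Sf_outside)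
      then have "outside DB \<subseteq> F"
        using components_maximal[OF F(1) connected_outside_DB] outside_disjoint sub centre_in by blast
      then show False using F(2) unbounded_outside_DB bounded_subset by blast
    qed
    then have "F = tri f"
      using components_eq[OF F(1) tri_component] sub centre_in by blast
    then show "F \<in> tri ` Sf" using \<open>f \<in> Sf\<close> by blast
  qed
qed

lemma inj_tri: "inj_on tri Sf"
  by (simp add: inj_on_def tri_inj)

lemma face_edges_tri:
  assumes "f \<in> Sf" shows "face_edges E (tri f) = range (\<lambda>k. fedge k f)"
proof
  show "range (\<lambda>k. fedge k f) \<subseteq> face_edges E (tri f)"
    using assms edge_curve_subset_ctri[of _ f] lattice_edge_disjoint_tri[OF fedge_lattice, of _ f f]
    by (fastforce simp: face_edges_def Sf_def frontier_tri)
  show "face_edges E (tri f) \<subseteq> range (\<lambda>k. fedge k f)"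
  proof
    fix e assume "e \<in> face_edges E (tri f)"
    then have e: "e \<in> lattice_edges" "edge_curve e \<subseteq> frontier (tri f)"
      using E_lattice by (auto simp: face_edges_def)
    obtain z where z: "z \<in> edge_curve e - embed ` e" using open_edge_connected(2)[OF e(1)] by blast
    then obtain k where "z \<in> edge_curve (fedge k f)" using e(2) frontier_tri_edges[of f] by blast
    then show "e \<in> range (\<lambda>k. fedge k f)"
      using open_edge_unique[OF e(1) fedge_lattice z] by blast
  qed
qed

lemma bounded_drawing: "bounded (drawing V E)"
  using drawing_subset bounded_DB bounded_inside_DB bounded_Un bounded_subset by metis

lemma finite_Sf: "finite Sf"
proof (rule finite_subset)
  show "finite {f. ctri f \<inter> drawing V E \<noteq> {}}" by (rule finite_ctri_meets[OF bounded_drawing])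
  show "Sf \<subseteq> {f. ctri f \<inter> drawing V E \<noteq> {}}"
  proof
    fix f assume f: "f \<in> Sf"
    obtain z where "z \<in> edge_curve (fedge A f)" using open_edge_connected(2)[OF fedge_lattice] by blast
    then have "z \<in> ctri f \<inter> drawing V E"
      using f edge_curve_subset_ctri[of A f] by (auto simp: Sf_def drawing_def)
    then show "f \<in> {f. ctri f \<inter> drawing V E \<noteq> {}}" by blast
  qed
qed

sublocale hex_region nbr Sf
proof
  show "inj (\<lambda>(i, j). ((nbr A \<circ> nbr B) ^^ i) (((nbr A \<circ> nbr C) ^^ j) f))" for f
    by (rule nbr_translations_inj)
  show "f \<in> Sf" if "\<And>k. nbr k f \<in> Sf" for f
  proof -
    have "fedge k f \<in> E" for k
    proof -
      have "fedge k (nbr k f) \<in> E" using that[of k] by (simp only: Sf_def mem_Collect_eq)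
      then show ?thesis by simp
    qed
    then show ?thesis by (simp add: Sf_def)
  qed
qed (simp_all add: nbr_hexagon finite_Sf)

section \<open>Eulerian orientations correspond to height functions\<close>

lemma carc_fedge: "(u, v) = carc k f \<Longrightarrow> {u, v} = fedge k f"
  unfolding fedge_def by (metis fst_conv snd_conv)

text \<open>The outside of the boundary cycle is connected and crossed by no edge, so the heights
  are constant there and agree with the value 0 on the far left.\<close>

lemma EO_height:
  assumes X: "X \<in> EO V E"
  obtains H where "H \<in> states" "arcs_of H = X" "\<And>k f. fedge k f \<in> E \<Longrightarrow> H f \<noteq> H (nbr k f)"
proof -
  have arc_E: "{u, v} \<in> E" if "(u, v) \<in> X" for u v
    using X that unfolding EO_def orientation_def arc_edges_def by blast
  have anti: "(v, u) \<notin> X" if "(u, v) \<in> X" for u v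
    using X that unfolding EO_def orientation_def by blast
  have E_arc: "carc k f \<in> X \<or> prod.swap (carc k f) \<in> X" if "fedge k f \<in> E" for k f
  proof -
    have "fedge k f \<in> arc_edges X" using X that by (simp add: EO_def orientation_def)
    then obtain u v where "(u, v) \<in> X" "fedge k f = {u, v}" unfolding arc_edges_def by blast
    then show ?thesis by (auto simp: fedge_def doubleton_eq_iff prod.swap_def)
  qed
  have arc_fedge: "fedge k f \<in> E" if "carc k f \<in> X \<or> prod.swap (carc k f) \<in> X" for k f
    using that arc_E[of "fst (carc k f)" "snd (carc k f)"] arc_E[of "snd (carc k f)" "fst (carc k f)"]
    by (auto simp: fedge_def prod.swap_def insert_commute)
  have anti': "\<not> (carc k f \<in> X \<and> prod.swap (carc k f) \<in> X)" for k f
    using anti[of "fst (carc k f)" "snd (carc k f)"] by (auto simp: prod.swap_def)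
  have lat: "{u, v} \<in> lattice_edges" if "(u, v) \<in> X" for u v using arc_E[OF that] E_lattice by blast
  have cons: "(\<Sum>w\<in>around v. of_bool ((v, w) \<in> X) - of_bool ((w, v) \<in> X)) = (0 :: int)" for v
  proof (cases "v \<in> V")
    case True
    then have "card {u. (u, v) \<in> X} = card {w. (v, w) \<in> X}" using X by (simp add: EO_def)
    then show ?thesis using balanced_iff[OF lat] by blast
  next
    case False
    have "(v, w) \<notin> X" for w using False arc_E[of v w] UE_subset by blast
    moreover have "(w, v) \<notin> X" for w using False arc_E[of w v] UE_subset by blast
    ultimately show ?thesis by simp
  qed
  obtain M where M: "\<And>z. z \<in> drawing V E \<Longrightarrow> norm z \<le> M"
    using bounded_drawing unfolding bounded_iff by blast
  \<comment> \<open>As \<open>c1 z\<close> is at most twice the norm of \<open>z\<close> in absolute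
    value, no vertex of an edge has a first coordinate below \<open>L\<close>.\<close>
  define L where "L = - \<lceil>2 * M\<rceil>"
  have left: "sg X k (i, j, True) = 0" if "i < L" for k i j
  proof -
    have "fedge k (i, j, True) \<notin> E"
    proof
      assume e: "fedge k (i, j, True) \<in> E"
      have "\<exists>v\<in>fedge k (i, j, True). fst v = i" by (cases k) (auto simp: fedge_def)
      then obtain v where v: "v \<in> fedge k (i, j, True)" "fst v = i" by blast
      then have "embed v \<in> drawing V E" using e UE_subset by (auto simp: drawing_def)
      then have "\<bar>c1 (embed v)\<bar> \<le> 2 * M" using M c_abs_le(1)[of "embed v"] by fastforce
      then have "- 2 * M \<le> of_int i" using v(2) c_embed(1)[of i "snd v"] by (cases v) auto
      then show False using that unfolding L_def by linarith
    qed
    then show ?thesis using arc_fedge by (auto simp: sg_def)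
  qed
  obtain H where H: "\<And>k f. H f - H (nbr k f) = sg X k f" "\<And>i j. i < L \<Longrightarrow> H (i, j, False) = 0"
    using height_exists[OF cons left] by blast
  have zero: "H f = 0" if "f \<notin> Sf" for f
  proof -
    obtain R where R: "\<And>z. z \<in> DB \<union> inside DB \<Longrightarrow> norm z \<le> R"
      using bounded_DB bounded_inside_DB unfolding bounded_iff by (metis bounded_Un bounded_iff)
    \<comment> \<open>This column is to the left of \<open>L\<close>, and far enough for the centre
      below to have norm greater than \<open>R\<close>.\<close>
    define i where "i = min (L - 1) (- \<lceil>2 * R\<rceil> - 2)"
    have "centre (i, 0, False) \<in> outside DB"
    proof -
      have "norm (centre (i, 0, False)) > R"
      proof -
        have "of_int i \<le> - (2 * R) - 2" by (simp add: i_def) linarith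
        moreover have "\<bar>c1 (centre (i, 0, False))\<bar> = \<bar>of_int i + 2 / 3\<bar>" by simp
        ultimately show ?thesis using c_abs_le(1)[of "centre (i, 0, False)"] by linarith
      qed
      then have "centre (i, 0, False) \<notin> DB \<union> inside DB" using R by force
      then show ?thesis using inside_Un_outside[of DB] by blast
    qed
    then have far: "tri (i, 0, False) \<inter> outside DB \<noteq> {}" using centre_in by blast
    have near: "tri f \<inter> outside DB \<noteq> {}" using notin_Sf_outside[OF that] centre_in by blast
    have "H f = H (i, 0, False)"
    proof (rule same_height_connected[OF connected_outside_DB _ near far])
      fix z k g assume z: "z \<in> outside DB" "z \<in> edge_curve (fedge k g)"
      then have "fedge k g \<notin> E" using outside_disjoint by (auto simp: drawing_def)
      then have "sg X k g = 0" using arc_fedge[of k g] by (auto simp: sg_def)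
      then show "H (nbr k g) = H g" using H(1)[of g k] by simp
    qed
    then show ?thesis using H(2)[of i 0] by (simp add: i_def)
  qed
  have one: "\<bar>H f - H (nbr k f)\<bar> = 1" if "fedge k f \<in> E" for k f
    using E_arc[OF that] anti'[of k f] H(1)[of f k] by (auto simp: sg_def)
  have "H \<in> states"
    unfolding states_def
  proof (intro CollectI conjI allI impI ballI)
    show "H f = 0" if "f \<notin> Sf" for f by (rule zero[OF that])
    show "\<bar>H (nbr k f) - H f\<bar> = 1" if "f \<in> Sf" for f k
      using one[of k f] that by (simp add: Sf_def abs_minus_commute)
  qed
  moreover have "arcs_of H = X"
  proof -
    have c: "carc k f \<in> arcs_of H \<longleftrightarrow> carc k f \<in> X" for k f
      unfolding carc_in_arcs_of H(1) using anti'[of k f] by (auto simp: sg_def)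
    have "(u, v) \<in> arcs_of H \<longleftrightarrow> (u, v) \<in> X" for u v
    proof
      assume a: "(u, v) \<in> arcs_of H"
      then obtain k f where "(u, v) = carc k f" by (auto simp: arcs_of_def)
      then show "(u, v) \<in> X" using a c by metis
    next
      assume a: "(u, v) \<in> X"
      then obtain k f where "(u, v) = carc k f" using lat lattice_arc_carc by metis
      then show "(u, v) \<in> arcs_of H" using a c by metis
    qed
    then show ?thesis by auto
  qed
  moreover have "H f \<noteq> H (nbr k f)" if "fedge k f \<in> E" for k f using one[OF that] by auto
  ultimately show ?thesis using that by blast
qed

text \<open>The heights of an Eulerian orientation differ on the two sides of an edge, so they
  cannot both have the outside value 0. An orientation thus takes the place of a Jordan curve
  argument.\<close>

lemma E_adjacent:
  assumes "EO V E \<noteq> {}" "fedge k f \<in> E"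
  shows "f \<in> Sf \<or> nbr k f \<in> Sf"
proof -
  obtain X where "X \<in> EO V E" using assms(1) by blast
  then obtain H where H: "H \<in> states" "H f \<noteq> H (nbr k f)" using EO_height assms(2) by metis
  then show ?thesis using states_outside by metis
qed

lemma arcs_of_EO:
  assumes "EO V E \<noteq> {}" "H \<in> states"
  shows "arcs_of H \<in> EO V E"
proof -
  have one: "\<bar>H f - H (nbr k f)\<bar> \<le> 1" for k f
    using states_lip[OF assms(2), of k f] by (simp add: abs_minus_commute)
  have live: "fedge k f \<in> E \<longleftrightarrow> H f - H (nbr k f) = 1 \<or> H f - H (nbr k f) = -1" for k f
  proof
    assume "fedge k f \<in> E"
    then have "f \<in> Sf \<or> nbr k f \<in> Sf" using E_adjacent assms(1) by blast
    then show "H f - H (nbr k f) = 1 \<or> H f - H (nbr k f) = -1"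
      using states_step_iff[OF assms(2), of f k] by auto
  next
    assume "H f - H (nbr k f) = 1 \<or> H f - H (nbr k f) = -1"
    then have "\<not> (H f = 0 \<and> H (nbr k f) = 0)" by auto
    then have "f \<in> Sf \<or> nbr k f \<in> Sf" using states_outside[OF assms(2)] by blast
    then have "fedge k f \<in> E \<or> fedge k (nbr k f) \<in> E" unfolding Sf_def by blast
    then show "fedge k f \<in> E" by simp
  qed
  have "arc_edges (arcs_of H) = E"
  proof
    show "arc_edges (arcs_of H) \<subseteq> E"
    proof
      fix e assume "e \<in> arc_edges (arcs_of H)"
      then obtain u v where uv: "e = {u, v}" "(u, v) \<in> arcs_of H" unfolding arc_edges_def by blast
      then obtain k f where kf: "(u, v) = carc k f" "H f - H (nbr k f) = 1" unfolding arcs_of_def by blast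
      then show "e \<in> E" using live[of k f] carc_fedge[OF kf(1)] uv(1) by simp
    qed
    show "E \<subseteq> arc_edges (arcs_of H)"
    proof
      fix e assume e: "e \<in> E"
      then obtain k f where kf: "e = fedge k f" using E_lattice lattice_edge_fedge by (metis subsetD)
      then have "carc k f \<in> arcs_of H \<or> prod.swap (carc k f) \<in> arcs_of H"
        using live[of k f] e unfolding carc_in_arcs_of swap_carc_in_arcs_of by blast
      then show "e \<in> arc_edges (arcs_of H)"
      proof
        assume "carc k f \<in> arcs_of H"
        then have "(fst (carc k f), snd (carc k f)) \<in> arcs_of H" by simp
        then show ?thesis unfolding arc_edges_def kf fedge_def by blast
      next
        assume "prod.swap (carc k f) \<in> arcs_of H"
        then have "(snd (carc k f), fst (carc k f)) \<in> arcs_of H" by (simp add: prod.swap_def)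
        moreover have "e = {snd (carc k f), fst (carc k f)}" by (auto simp: kf fedge_def)
        ultimately show ?thesis unfolding arc_edges_def by blast
      qed
    qed
  qed
  moreover have "(v, u) \<notin> arcs_of H" if "(u, v) \<in> arcs_of H" for u v
  proof -
    obtain k f where kf: "(u, v) = carc k f" "H f - H (nbr k f) = 1" using \<open>(u, v) \<in> arcs_of H\<close> unfolding arcs_of_def by blast
    have "(v, u) = prod.swap (carc k f)" using kf(1) by (metis swap_simp)
    then show ?thesis using kf(2) swap_carc_in_arcs_of by simp
  qed
  ultimately show ?thesis
    using arcs_of_balanced[OF one] by (simp add: EO_def orientation_def)
qed

lemma bij_arcs_of:
  assumes "EO V E \<noteq> {}" shows "bij_betw arcs_of states (EO V E)"
proof (rule bij_betwI')
  show "arcs_of H = arcs_of H' \<longleftrightarrow> H = H'" if "H \<in> states" "H' \<in> states" for H H'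
    using states_eqI[OF that] carc_in_arcs_of by metis
  show "arcs_of H \<in> EO V E" if "H \<in> states" for H by (rule arcs_of_EO[OF assms that])
  show "\<exists>H\<in>states. X = arcs_of H" if "X \<in> EO V E" for X using EO_height[OF that] by metis
qed

lemma Sf_nonempty:
  assumes "EO V E \<noteq> {}" shows "Sf \<noteq> {}"
proof -
  obtain e where "e \<in> Bd" using Bd_nonempty by blast
  then have "e \<in> lattice_edges" "e \<in> E" using Bd_lattice by (auto simp: E_eq)
  then obtain k f where "fedge k f \<in> E" using lattice_edge_fedge by metis
  then show ?thesis using E_adjacent[OF assms] by blast
qed

lemma finite_states:
  assumes "EO V E \<noteq> {}" shows "finite states"
proof -
  have "finite {e \<in> lattice_edges. e \<in> E}"
  proof (rule finite_subset)
    show "finite ((\<lambda>(k, f). fedge k f) ` (UNIV \<times> Sf))" using finite_Sf by simp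
    show "{e \<in> lattice_edges. e \<in> E} \<subseteq> (\<lambda>(k, f). fedge k f) ` (UNIV \<times> Sf)"
    proof clarify
      fix e assume e: "e \<in> lattice_edges" "e \<in> E"
      then obtain k f where kf: "e = fedge k f" using lattice_edge_fedge by metis
      then have "f \<in> Sf \<or> nbr k f \<in> Sf" using E_adjacent[OF assms] e(2) by blast
      then obtain g where "g \<in> Sf" "e = fedge k g" using kf fedge_nbr[of k f] by metis
      then show "e \<in> (\<lambda>(k, f). fedge k f) ` (UNIV \<times> Sf)" by auto
    qed
  qed
  then have "finite E" using E_lattice by (simp add: Collect_conj_eq Int_absorb1)
  moreover have "finite e" if "e \<in> E" for e using that E_lattice lattice_edge_pair by (metis finite.emptyI finite_insert subsetD)
  ultimately have "finite (\<Union>E)" by blast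
  have "EO V E \<subseteq> Pow (\<Union>E \<times> \<Union>E)"
  proof
    fix X assume "X \<in> EO V E"
    then have E: "E = arc_edges X" by (simp add: EO_def orientation_def)
    have "X \<subseteq> \<Union>E \<times> \<Union>E"
    proof (rule subrelI)
      fix u v assume "(u, v) \<in> X"
      then have "{u, v} \<in> E" unfolding E arc_edges_def by blast
      then show "(u, v) \<in> \<Union>E \<times> \<Union>E" by blast
    qed
    then show "X \<in> Pow (\<Union>E \<times> \<Union>E)" by blast
  qed
  then have "finite (EO V E)" using \<open>finite (\<Union>E)\<close> finite_subset by blast
  then show ?thesis using bij_betw_finite[OF bij_arcs_of[OF assms]] by simp
qed

end

section \<open>The tower chain\<close>

lemma cycle_arcs_triangle: "cycle_arcs [a, b, c] = {(a, b), (b, c), (c, a)}"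
proof -
  have "{i. i < length [a, b, c]} = {0, 1, 2}" by auto
  then have "cycle_arcs [a, b, c] = (\<lambda>i. ([a, b, c] ! i, [a, b, c] ! (Suc i mod length [a, b, c]))) ` {0, 1, 2}"
    unfolding cycle_arcs_def by blast
  then show ?thesis by (simp add: numeral_2_eq_2)
qed

lemma arc_edges_image: "arc_edges D = (\<lambda>(u, v). {u, v}) ` D"
  by (auto simp: arc_edges_def)

lemma Union_arc_edges_cycle:
  assumes "3 \<le> length vs" shows "\<Union>(arc_edges (cycle_arcs vs)) = set vs"
proof
  show "\<Union>(arc_edges (cycle_arcs vs)) \<subseteq> set vs"
  proof
    fix x assume "x \<in> \<Union>(arc_edges (cycle_arcs vs))"
    then obtain i where i: "i < length vs" "x = vs ! i \<or> x = vs ! (Suc i mod length vs)"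
      unfolding arc_edges_def cycle_arcs_def by blast
    have "Suc i mod length vs < length vs" using assms by (intro mod_less_divisor) linarith
    then show "x \<in> set vs" using i by auto
  qed
  show "set vs \<subseteq> \<Union>(arc_edges (cycle_arcs vs))"
  proof
    fix x assume "x \<in> set vs"
    then obtain i where "i < length vs" "x = vs ! i" by (auto simp: in_set_conv_nth)
    then show "x \<in> \<Union>(arc_edges (cycle_arcs vs))"
      unfolding arc_edges_def cycle_arcs_def by blast
  qed
qed

lemma directed_cycle_triangle:
  assumes "distinct [a, b, c]"
  shows "directed_cycle D \<and> arc_edges D = {{a, b}, {b, c}, {c, a}} \<longleftrightarrow>
    D = {(a, b), (b, c), (c, a)} \<or> D = {(b, a), (c, b), (a, c)}"
proof
  assume D: "directed_cycle D \<and> arc_edges D = {{a, b}, {b, c}, {c, a}}"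
  then obtain vs where vs: "3 \<le> length vs" "distinct vs" "D = cycle_arcs vs"
    unfolding directed_cycle_def by blast
  have set: "set vs = {a, b, c}"
    using Union_arc_edges_cycle[OF vs(1)] D vs(3) by auto
  then have "length vs = 3" using distinct_card[OF vs(2)] assms by simp
  then obtain x y z where xyz: "vs = [x, y, z]" by (auto simp: length_Suc_conv numeral_3_eq_3)
  then have D': "D = {(x, y), (y, z), (z, x)}" using vs(3) cycle_arcs_triangle by simp
  have "x \<in> {a, b, c}" "y \<in> {a, b, c}" "z \<in> {a, b, c}" "x \<noteq> y" "y \<noteq> z" "x \<noteq> z"
    using set vs(2) xyz by auto
  then show "D = {(a, b), (b, c), (c, a)} \<or> D = {(b, a), (c, b), (a, c)}"
    unfolding D' by (elim insertE emptyE; simp; blast)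
next
  assume "D = {(a, b), (b, c), (c, a)} \<or> D = {(b, a), (c, b), (a, c)}"
  then show "directed_cycle D \<and> arc_edges D = {{a, b}, {b, c}, {c, a}}"
  proof
    assume D: "D = {(a, b), (b, c), (c, a)}"
    have "directed_cycle D"
      unfolding directed_cycle_def
      by (rule exI[of _ "[a, b, c]"]) (use assms D cycle_arcs_triangle in simp)
    moreover have "arc_edges D = {{a, b}, {b, c}, {c, a}}" unfolding D arc_edges_image by simp
    ultimately show ?thesis by blast
  next
    assume D: "D = {(b, a), (c, b), (a, c)}"
    have "directed_cycle D"
      unfolding directed_cycle_def
      by (rule exI[of _ "[b, a, c]"]) (use assms D cycle_arcs_triangle in auto)
    moreover have "arc_edges D = {{a, b}, {b, c}, {c, a}}" unfolding D arc_edges_image by (simp add: insert_commute)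
    ultimately show ?thesis by blast
  qed
qed

definition ccw :: "face \<Rightarrow> arc set" where "ccw f = range (\<lambda>k. carc k f)"
definition cw :: "face \<Rightarrow> arc set" where "cw f = range (\<lambda>k. prod.swap (carc k f))"

lemma directed_cycle_face:
  "directed_cycle D \<and> arc_edges D = range (\<lambda>k. fedge k f) \<longleftrightarrow> D = ccw f \<or> D = cw f"
proof -
  define a b c where "a = fst (carc C f)" and "b = fst (carc A f)" and "c = fst (carc B f)"
  have carcs: "carc C f = (a, b)" "carc A f = (b, c)" "carc B f = (c, a)"
    by (cases f; auto simp: a_def b_def c_def)+
  have dist: "distinct [a, b, c]" by (cases f) (auto simp: a_def b_def c_def)
  have 1: "range (\<lambda>k. fedge k f) = {{a, b}, {b, c}, {c, a}}"
    unfolding dir_UNIV by (auto simp: fedge_def carcs)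
  have 2: "ccw f = {(a, b), (b, c), (c, a)}" "cw f = {(b, a), (c, b), (a, c)}"
    unfolding ccw_def cw_def dir_UNIV by (auto simp: carcs)
  show ?thesis unfolding 1 2 by (rule directed_cycle_triangle[OF dist])
qed

lemma tv_dist_map_le:
  assumes "tv_dist p q \<le> c" shows "tv_dist (map_pmf g p) (map_pmf g q) \<le> c"
  unfolding tv_dist_def
proof (rule cSUP_least)
  fix A
  have "\<bar>measure_pmf.prob p B - measure_pmf.prob q B\<bar> \<le> 1" for B
    using measure_pmf.prob_le_1[of p B] measure_pmf.prob_le_1[of q B]
      measure_nonneg[of "measure_pmf p" B] measure_nonneg[of "measure_pmf q" B] by linarith
  then have "bdd_above (range (\<lambda>B. \<bar>measure_pmf.prob p B - measure_pmf.prob q B\<bar>))"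
    by (auto intro!: bdd_aboveI2[where M = 1])
  then have "\<bar>measure_pmf.prob p (g -` A) - measure_pmf.prob q (g -` A)\<bar> \<le> tv_dist p q"
    unfolding tv_dist_def by (intro cSUP_upper) auto
  then show "\<bar>measure_pmf.prob (map_pmf g p) A - measure_pmf.prob (map_pmf g q) A\<bar> \<le> c"
    using assms by simp
qed simp

lemma pmf_of_set_Times:
  assumes "finite P" "P \<noteq> {}" "finite Q" "Q \<noteq> {}"
  shows "pmf_of_set (P \<times> Q) = bind_pmf (pmf_of_set P) (\<lambda>x. map_pmf (Pair x) (pmf_of_set Q))"
proof -
  have "pmf_of_set (P \<times> Q) = pair_pmf (pmf_of_set P) (pmf_of_set Q)"
  proof (rule pmf_eqI)
    fix z
    show "pmf (pmf_of_set (P \<times> Q)) z = pmf (pair_pmf (pmf_of_set P) (pmf_of_set Q)) z"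
      using assms by (cases z) (simp add: pmf_pair indicator_times card_cartesian_product)
  qed
  then show ?thesis by (simp add: pair_pmf_def map_pmf_def)
qed

context solid
begin

section \<open>Directed faces, blocking edges and towers in terms of heights\<close>

lemma diff_iff:
  fixes H :: "face \<Rightarrow> int"
  shows "H g = H f + 1 \<longleftrightarrow> H f - H g = - 1" "H g = H f - 1 \<longleftrightarrow> H f - H g = 1"
    "(- H) g = (- H) f + 1 \<longleftrightarrow> H f - H g = 1" "(- H) g = (- H) f - 1 \<longleftrightarrow> H f - H g = - 1"
  unfolding uminus_apply by (intro iffI; linarith)+

lemma ccw_subset: "ccw f \<subseteq> arcs_of H \<longleftrightarrow> lmin (- H) f"
  unfolding ccw_def lmin_def image_subset_iff carc_in_arcs_of diff_iff(3) by simp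

lemma cw_subset: "cw f \<subseteq> arcs_of H \<longleftrightarrow> lmin H f"
  unfolding cw_def lmin_def image_subset_iff swap_carc_in_arcs_of diff_iff(1) by simp

lemma directed_face_iff:
  assumes "f \<in> Sf"
  shows "directed_face E (arcs_of H) (tri f) \<longleftrightarrow> lmin H f \<or> lmin (- H) f"
  unfolding directed_face_def face_edges_tri[OF assms]
  using directed_cycle_face[of _ f] ccw_subset[of f H] cw_subset[of f H] by metis

lemma swap_carc_inj: "prod.swap (carc k f) = prod.swap (carc l f) \<longleftrightarrow> k = l"
  using carc_inj[of k f l f] by (metis swap_swap)

lemma ex_range_pair: "(\<exists>u v. (u, v) \<in> range g \<and> P u v) \<longleftrightarrow> (\<exists>k. P (fst (g k)) (snd (g k)))"
proof
  assume "\<exists>u v. (u, v) \<in> range g \<and> P u v"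
  then obtain u v k where "(u, v) = g k" "P u v" by blast
  then show "\<exists>k. P (fst (g k)) (snd (g k))" by (metis fst_conv snd_conv)
next
  assume "\<exists>k. P (fst (g k)) (snd (g k))"
  then obtain k where "P (fst (g k)) (snd (g k))" by blast
  moreover have "(fst (g k), snd (g k)) \<in> range g" by simp
  ultimately show "\<exists>u v. (u, v) \<in> range g \<and> P u v" by blast
qed

lemma ccw_blocking:
  "D = ccw f \<Longrightarrow> (\<exists>u v. (u, v) \<in> D \<and> e = {u, v} \<and> (v, u) \<in> arcs_of H \<and> D - {(u, v)} \<subseteq> arcs_of H)
    \<longleftrightarrow> (\<exists>k. e = fedge k f \<and> points (- H) f k)"
proof -
  assume D: "D = ccw f"
  have "(\<exists>u v. (u, v) \<in> D \<and> e = {u, v} \<and> (v, u) \<in> arcs_of H \<and> D - {(u, v)} \<subseteq> arcs_of H)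
    \<longleftrightarrow> (\<exists>k. e = fedge k f \<and> prod.swap (carc k f) \<in> arcs_of H \<and> D - {carc k f} \<subseteq> arcs_of H)"
    unfolding D ccw_def fedge_def prod.swap_def ex_range_pair by simp
  also have "\<dots> \<longleftrightarrow> (\<exists>k. e = fedge k f \<and> points (- H) f k)"
  proof -
    have "D - {carc k f} \<subseteq> arcs_of H \<longleftrightarrow> (\<forall>j. j \<noteq> k \<longrightarrow> H f - H (nbr j f) = 1)" for k
      unfolding D ccw_def using carc_in_arcs_of[of _ f H] carc_inj[of _ f _ f] by fastforce
    then show ?thesis
      unfolding swap_carc_in_arcs_of points_def diff_iff(3,4) by simp
  qed
  finally show ?thesis .
qed

lemma cw_blocking:
  "D = cw f \<Longrightarrow> (\<exists>u v. (u, v) \<in> D \<and> e = {u, v} \<and> (v, u) \<in> arcs_of H \<and> D - {(u, v)} \<subseteq> arcs_of H)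
    \<longleftrightarrow> (\<exists>k. e = fedge k f \<and> points H f k)"
proof -
  assume D: "D = cw f"
  have "(\<exists>u v. (u, v) \<in> D \<and> e = {u, v} \<and> (v, u) \<in> arcs_of H \<and> D - {(u, v)} \<subseteq> arcs_of H)
    \<longleftrightarrow> (\<exists>k. e = fedge k f \<and> carc k f \<in> arcs_of H \<and> D - {prod.swap (carc k f)} \<subseteq> arcs_of H)"
    unfolding D cw_def fedge_def prod.swap_def ex_range_pair by (simp add: insert_commute)
  also have "\<dots> \<longleftrightarrow> (\<exists>k. e = fedge k f \<and> points H f k)"
  proof -
    have "D - {prod.swap (carc k f)} \<subseteq> arcs_of H \<longleftrightarrow> (\<forall>j. j \<noteq> k \<longrightarrow> H f - H (nbr j f) = -1)" for k
      unfolding D cw_def using swap_carc_in_arcs_of[of _ f H] swap_carc_inj[of _ f] by fastforce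
    then show ?thesis
      unfolding carc_in_arcs_of points_def diff_iff(1,2) by simp
  qed
  finally show ?thesis .
qed

lemma blocking_edge_iff:
  assumes "f \<in> Sf"
  shows "blocking_edge E (arcs_of H) (tri f) e \<longleftrightarrow> (\<exists>k. e = fedge k f \<and> (points H f k \<or> points (- H) f k))"
proof -
  have "blocking_edge E (arcs_of H) (tri f) e \<longleftrightarrow>
      (\<exists>D. (D = ccw f \<or> D = cw f) \<and> (\<exists>u v. (u, v) \<in> D \<and> e = {u, v} \<and> (v, u) \<in> arcs_of H \<and> D - {(u, v)} \<subseteq> arcs_of H))"
    unfolding blocking_edge_def face_edges_tri[OF assms] directed_cycle_face[symmetric] by blast
  also have "\<dots> \<longleftrightarrow> (\<exists>k. e = fedge k f \<and> (points H f k \<or> points (- H) f k))"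
    using ccw_blocking[of "ccw f" f e H] cw_blocking[of "cw f" f e H] by blast
  finally show ?thesis .
qed

lemma face_edges_Int:
  assumes "f \<in> Sf" "nbr k f \<in> Sf"
  shows "face_edges E (tri f) \<inter> face_edges E (tri (nbr k f)) = {fedge k f}"
proof -
  have "fedge l f = fedge k f" if "fedge l f = fedge m (nbr k f)" for l m
    using that unfolding fedge_eq by auto
  moreover have "fedge k f \<in> range (\<lambda>l. fedge l (nbr k f))" using fedge_nbr[of k f] by (metis rangeI)
  ultimately show ?thesis unfolding face_edges_tri[OF assms(1)] face_edges_tri[OF assms(2)] by blast
qed

lemma tower_single: "tower V E X [F] \<longleftrightarrow> F \<in> bounded_faces V E \<and> directed_face E X F"
  by (simp add: tower_def)

lemma tower_Cons_Cons:
  "tower V E X (F # G # T) \<longleftrightarrow> F \<in> bounded_faces V E \<and>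
    (\<exists>e. face_edges E F \<inter> face_edges E G = {e} \<and> blocking_edge E X F e) \<and> tower V E X (G # T)"
proof -
  have all: "(\<forall>i. Suc i < length (F # G # T) \<longrightarrow> P i) \<longleftrightarrow> P 0 \<and> (\<forall>i. Suc i < length (G # T) \<longrightarrow> P (Suc i))" for P
    by (metis Suc_less_eq Zero_not_Suc length_Cons not0_implies_Suc zero_less_Suc)
  show ?thesis unfolding tower_def all by auto
qed

lemma tower_of_utower:
  "utower Z L \<Longrightarrow> Z = H \<or> Z = - H \<Longrightarrow> tower V E (arcs_of H) (map tri L)"
proof (induction rule: utower.induct)
  case (utower_single f)
  then have "lmin H f \<or> lmin (- H) f" by blast
  then show ?case
    using directed_face_iff[of f H] utower_single(1) by (simp add: tower_single bounded_faces_eq)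
next
  case (utower_Cons f k L)
  have "nbr k f \<in> Sf" using utower_subset[OF utower_Cons(3)] by simp
  then have "face_edges E (tri f) \<inter> face_edges E (tri (nbr k f)) = {fedge k f}"
    using face_edges_Int utower_Cons(1) by blast
  moreover have "blocking_edge E (arcs_of H) (tri f) (fedge k f)"
    using utower_Cons(1,2,5) blocking_edge_iff by blast
  ultimately show ?case
    using utower_Cons by (auto simp: tower_Cons_Cons bounded_faces_eq)
qed

lemma tower_face:
  assumes "tower V E X T" obtains f T' where "T = tri f # T'" "f \<in> Sf"
  using assms by (cases T) (auto simp: tower_def bounded_faces_eq)

text \<open>\<open>tower\<close> does not prescribe a common direction for its faces. If the tail
  had the opposite direction, its first face would have to point straight back to \<open>f\<close>,
  and \<open>f\<close> would have a tower in the opposite direction, which its own pointer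
  excludes.\<close>

lemma utower_of_tower:
  assumes N: "N = - H" and "tower V E (arcs_of H) T"
  shows "\<exists>L. T = map tri L \<and> (utower H L \<or> utower N L)"
  using assms(2)
proof (induction T)
  case Nil
  then show ?case by (simp add: tower_def)
next
  case (Cons F T)
  obtain f where f: "F = tri f" "f \<in> Sf" using tower_face[OF Cons.prems] by auto
  show ?case
  proof (cases T)
    case Nil
    then have "lmin H f \<or> lmin N f"
      using Cons.prems directed_face_iff[OF f(2), of H] f N by (simp add: tower_single)
    then have "utower H [f] \<or> utower N [f]" using utower.utower_single f(2) by blast
    moreover have "F # T = map tri [f]" using Nil f(1) by simp
    ultimately have "F # T = map tri [f] \<and> (utower H [f] \<or> utower N [f])" by blast
    then show ?thesis by (rule exI)
  next
    case T: (Cons G T')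
    then obtain e where e: "face_edges E F \<inter> face_edges E G = {e}" "blocking_edge E (arcs_of H) F e"
      and tow: "tower V E (arcs_of H) T" using Cons.prems by (auto simp: tower_Cons_Cons)
    from Cons.IH[OF tow] obtain L where L: "T = map tri L" "utower H L \<or> utower N L" by blast
    obtain g L' where gL: "L = g # L'" "G = tri g" using L(1) T by (cases L) auto
    have g: "g \<in> Sf" using L(2) utower_hd gL(1) by fastforce
    obtain k where k: "e = fedge k f" "points H f k \<or> points N f k"
      using e(2) blocking_edge_iff[OF f(2), of H] f(1) N by blast
    have "e \<in> range (\<lambda>l. fedge l g)" using e(1) face_edges_tri[OF g] gL(2) by blast
    then obtain l where "fedge k f = fedge l g" using k(1) by blast
    then have "g = f \<or> g = nbr k f" using fedge_eq by blast
    \<comment> \<open>Equal consecutive faces would share three edges instead of one.\<close>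
    moreover have "g \<noteq> f"
    proof
      assume "g = f"
      then have "range (\<lambda>l. fedge l f) = {e}" using e(1) face_edges_tri[OF f(2)] f(1) gL(2) by simp
      then have "fedge A f = fedge B f" by (metis rangeI singletonD)
      then show False by (simp add: fedge_eq)
    qed
    ultimately have gk: "g = nbr k f" by blast
    have ext: "utower Z (f # L)" if Z: "points Z f k" "utower Z L \<or> utower (- Z) L" for Z
    proof -
      have "utower Z L"
      proof (rule ccontr)
        assume "\<not> utower Z L"
        then have neg: "utower (- Z) (nbr k f # L')" using Z(2) gL(1) gk by simp
        have up: "Z f = Z (nbr k f) + 1" using points_at[OF Z(1)] by simp
        from neg show False
        proof (cases rule: utower.cases)
          case utower_single
          then show ?thesis using lminD[of "- Z" "nbr k f" k] up by simp
        next
          case (utower_Cons l L'')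
          have "l = k"
          proof (rule ccontr)
            assume "l \<noteq> k"
            then show False using points_off[OF utower_Cons(3), of k] up by simp
          qed
          then have "hasU (- Z) f" using utower_Cons(4) by (auto simp: hasU_iff)
          then show ?thesis using hasU_neg_points[OF Z(1)] by simp
        qed
      qed
      then show ?thesis using utower.utower_Cons[OF f(2) Z(1)] gL(1) gk by simp
    qed
    have "utower H (f # L) \<or> utower N (f # L)"
      using k(2) ext[of H] ext[of N] L(2) N by auto
    moreover have "F # T = map tri (f # L)" using L(1) f(1) by simp
    ultimately have "F # T = map tri (f # L) \<and> (utower H (f # L) \<or> utower N (f # L))" by blast
    then show ?thesis by (rule exI)
  qed
qed

lemma tower_iff:
  "tower V E (arcs_of H) T \<longleftrightarrow> (\<exists>L. T = map tri L \<and> (utower H L \<or> utower (- H) L))"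
  using tower_of_utower utower_of_tower[OF refl] by blast

lemma tower_cycle_mem:
  assumes "set L \<subseteq> Sf" "distinct L"
  shows "fedge k f \<in> tower_cycle E (map tri L) \<longleftrightarrow> (f \<in> set L) \<noteq> (nbr k f \<in> set L)"
  using assms
proof (induction L)
  case Nil
  then show ?case by (simp add: tower_cycle_def)
next
  case (Cons g L)
  have g: "g \<in> Sf" using Cons.prems by simp
  have "fedge k f \<in> face_edges E (tri g) \<longleftrightarrow> g = f \<or> g = nbr k f"
    unfolding face_edges_tri[OF g] using fedge_eq[of k f _ g] by blast
  moreover have "fedge k f \<in> tower_cycle E (map tri (g # L)) \<longleftrightarrow>
      (fedge k f \<in> face_edges E (tri g)) \<noteq> (fedge k f \<in> tower_cycle E (map tri L))"
    by (auto simp: tower_cycle_def)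
  moreover have "fedge k f \<in> tower_cycle E (map tri L) \<longleftrightarrow> (f \<in> set L) \<noteq> (nbr k f \<in> set L)"
    using Cons by simp
  moreover have "g \<notin> set L" using Cons.prems by simp
  then have "g = f \<longrightarrow> f \<notin> set L" "g = nbr k f \<longrightarrow> nbr k f \<notin> set L" by blast+
  moreover have "\<not> (g = f \<and> g = nbr k f)" using nbr_neq[of k f] by metis
  ultimately show ?case
    by (simp only: list.set insert_iff eq_commute[of f g] eq_commute[of "nbr k f" g]) blast
qed

text \<open>Across an edge of the cycle exactly one of the two heights changes, by 2, which turns a
  step of 1 into the opposite step; across every other edge the step stays the same.\<close>

lemma reverse_tower:
  assumes H: "H \<in> states" and H': "H' \<in> states" and L: "set L \<subseteq> Sf" "distinct L"
    and diff: "\<And>f. H' f - H f = (if f \<in> set L then c else 0)" and c: "c = 2 \<or> c = -2"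
  shows "reverse_edges (tower_cycle E (map tri L)) (arcs_of H) = arcs_of H'"
proof -
  let ?C = "tower_cycle E (map tri L)"
  have arc: "carc k f \<in> reverse_edges ?C (arcs_of H) \<longleftrightarrow> carc k f \<in> arcs_of H'" for k f
  proof -
    have rev: "carc k f \<in> reverse_edges ?C (arcs_of H) \<longleftrightarrow>
        (if fedge k f \<in> ?C then prod.swap (carc k f) \<in> arcs_of H else carc k f \<in> arcs_of H)"
      unfolding reverse_edges_def fedge_def prod.swap_def by (auto simp: case_prod_beta)
    show ?thesis
    proof (cases "(f \<in> set L) \<noteq> (nbr k f \<in> set L)")
      case False
      then have "H' f - H' (nbr k f) = H f - H (nbr k f)" using diff[of f] diff[of "nbr k f"] by auto
      then show ?thesis using False unfolding rev tower_cycle_mem[OF L] carc_in_arcs_of by simp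
    next
      case True
      then have live: "f \<in> Sf \<or> nbr k f \<in> Sf" using L(1) by blast
      then have "H (nbr k f) = H f + 1 \<or> H (nbr k f) = H f - 1" by (rule states_step_iff[OF H])
      moreover have "H' (nbr k f) = H' f + 1 \<or> H' (nbr k f) = H' f - 1"
        by (rule states_step_iff[OF H' live])
      ultimately have "H f - H (nbr k f) = - 1 \<longleftrightarrow> H' f - H' (nbr k f) = 1"
        using True c diff[of f] diff[of "nbr k f"] by auto
      then show ?thesis using True unfolding rev tower_cycle_mem[OF L] carc_in_arcs_of swap_carc_in_arcs_of by simp
    qed
  qed
  have "(u, v) \<in> reverse_edges ?C (arcs_of H) \<longleftrightarrow> (u, v) \<in> arcs_of H'" for u v
  proof (cases "{u, v} \<in> lattice_edges")
    case True
    then obtain k f where "(u, v) = carc k f" using lattice_arc_carc by blast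
    then show ?thesis using arc[of k f] by simp
  next
    case False
    then have "{v, u} \<notin> lattice_edges" by (simp add: insert_commute)
    then have "(u, v) \<notin> arcs_of H" "(v, u) \<notin> arcs_of H" "(u, v) \<notin> arcs_of H'"
      using False arcs_of_lattice[of u v H] arcs_of_lattice[of v u H] arcs_of_lattice[of u v H'] by argo+
    then show ?thesis by (simp add: reverse_edges_def)
  qed
  then show ?thesis by (intro equalityI subrelI) simp_all
qed

section \<open>Comparison of the chain with the random map\<close>

lemma acc_bernoulli:
  assumes "2 \<le> h" "h \<le> card Sf"
  shows "map_pmf (acc h) (pmf_of_set {..<ub}) = bernoulli_pmf (1 / (3 * real h))"
proof -
  have p: "0 \<le> 1 / (3 * real h)" "1 / (3 * real h) \<le> 1" using assms by (auto simp: field_simps)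
  have sets: "{..<ub} \<inter> acc h -` {True} = {u. u < ub \<and> acc h u}" by auto
  have ne: "{..<ub} \<noteq> {}" using ub_pos by blast
  have T: "pmf (map_pmf (acc h) (pmf_of_set {..<ub})) True = 1 / (3 * real h)"
    unfolding pmf_map measure_pmf_of_set[OF ne finite_lessThan] sets card_acc[OF assms]
    using ub_pos by simp
  have F: "pmf q False = 1 - pmf q True" for q :: "bool pmf"
  proof -
    have "sum (pmf q) UNIV = 1" by (rule sum_pmf_eq_1) auto
    then show ?thesis by (simp add: UNIV_bool)
  qed
  show ?thesis
  proof (rule pmf_eqI)
    fix b
    show "pmf (map_pmf (acc h) (pmf_of_set {..<ub})) b = pmf (bernoulli_pmf (1 / (3 * real h))) b"
      using T F[of "map_pmf (acc h) (pmf_of_set {..<ub})"] p by (cases b) auto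
  qed
qed

abbreviation tp :: "complex set list \<Rightarrow> real" where
  "tp \<equiv> (\<lambda>T. 1 / (3 * real (length T)))"

text \<open>The tower at a face is unique, so \<open>SOME\<close> picks the one in direction
  \<open>b\<close>; a directed face is a tower of length 1, reversed with certainty on both
  sides.\<close>

lemma tower_move_eq:
  assumes H: "H \<in> states" and f: "f \<in> Sf" and ne: "tow (if b then H else - H) f \<noteq> []"
  shows "tower_move V E tp (arcs_of H) (tri f) = map_pmf (\<lambda>u. arcs_of (act (f, b, u) H)) (pmf_of_set {..<ub})"
proof -
  define Z where "Z = (if b then H else - H)"
  define L where "L = tow Z f"
  have Z: "Z \<in> states" using H states_neg by (simp add: Z_def)
  have "tow Z f \<noteq> []" using ne by (simp add: Z_def)
  then have "hasU Z f" using tow_Nil by blast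
  then have L: "utower Z L" "hd L = f" using tow_utower by (auto simp: L_def)
  have Lne: "L \<noteq> []" using utower_not_Nil[OF L(1)] .
  define H' where "H' = (if b then raise (set L) H else - raise (set L) (- H))"
  have H': "H' \<in> states"
    using utower_raise[OF Z L(1)] states_neg by (auto simp: H'_def Z_def)
  have act: "act (f, b, u) H = (if acc (length L) u then H' else H)" for u
    by (auto simp: upmove_def H'_def L_def Z_def)
  have rev: "reverse_edges (tower_cycle E (map tri L)) (arcs_of H) = arcs_of H'"
  proof (rule reverse_tower[OF H H'])
    show "set L \<subseteq> Sf" "distinct L" using utower_subset[OF L(1)] utower_distinct[OF L(1)] by auto
    show "H' g - H g = (if g \<in> set L then if b then 2 else -2 else 0)" for g
      by (auto simp: H'_def raise_def)
  qed simp
  have uniq: "T = map tri L" if T: "tower V E (arcs_of H) T" "hd T = tri f" for T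
  proof -
    obtain M where M: "T = map tri M" "utower H M \<or> utower (- H) M" using T(1) tower_iff by blast
    then have "M \<noteq> []" using utower_not_Nil by blast
    then have hd: "hd M = f" using T(2) M(1) tri_inj by (simp add: hd_map)
    have "utower Z M"
    proof (rule ccontr)
      assume "\<not> utower Z M"
      then have "utower (- Z) M" using M(2) by (auto simp: Z_def split: if_splits)
      from utower_neg_disjoint[OF L(1) this] show False using hd L(2) by simp
    qed
    then have "M = L" using utower_unique[OF _ L(1)] hd L(2) by simp
    then show ?thesis using M(1) by simp
  qed
  have towL: "tower V E (arcs_of H) (map tri L) \<and> hd (map tri L) = tri f"
    using tower_of_utower[OF L(1), of H] Lne L(2) by (auto simp: Z_def hd_map)
  show ?thesis
  proof (cases "directed_face E (arcs_of H) (tri f)")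
    case True
    then have "tower V E (arcs_of H) [tri f]" using f by (simp add: tower_single bounded_faces_eq)
    then have "map tri L = [tri f]" using uniq[of "[tri f]"] by simp
    then have one: "length L = 1" and "tower_cycle E (map tri L) = face_edges E (tri f)"
      by (auto simp: tower_cycle_def dest: arg_cong[of _ _ length])
    then have "tower_move V E tp (arcs_of H) (tri f) = return_pmf (arcs_of H')"
      using True rev by (simp add: tower_move_def)
    moreover have "act (f, b, u) H = H'" for u using act[of u] one by (simp add: acc_def)
    ultimately show ?thesis by (simp add: map_pmf_const)
  next
    case False
    have "length L \<noteq> 1"
    proof
      assume "length L = 1"
      then have "lmin Z f" using tow_length_1[of Z f] by (simp add: L_def)
      then show False using False directed_face_iff[OF f] by (auto simp: Z_def split: if_splits)
    qed
    moreover have "length L \<noteq> 0" using Lne by simp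
    ultimately have h: "2 \<le> length L" by linarith
    have hn: "length L \<le> card Sf" by (simp add: L_def tow_length_le)
    have some: "(SOME T. tower V E (arcs_of H) T \<and> hd T = tri f) = map tri L"
      using towL uniq by (intro some_equality) auto
    have ex: "\<exists>T. tower V E (arcs_of H) T \<and> hd T = tri f" using towL by blast
    have "tower_move V E tp (arcs_of H) (tri f)
        = map_pmf (\<lambda>b. if b then arcs_of H' else arcs_of H) (bernoulli_pmf (1 / (3 * real (length L))))"
      unfolding tower_move_def if_not_P[OF False] if_P[OF ex] some Let_def rev length_map by (rule refl)
    also have "\<dots> = map_pmf (\<lambda>u. arcs_of (act (f, b, u) H)) (pmf_of_set {..<ub})"
      unfolding acc_bernoulli[OF h hn, symmetric] map_pmf_comp act by (intro map_pmf_cong) auto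
    finally show ?thesis .
  qed
qed

lemma tower_move_none:
  assumes f: "f \<in> Sf" and none: "tow H f = []" "tow (- H) f = []"
  shows "tower_move V E tp (arcs_of H) (tri f) = return_pmf (arcs_of H)"
proof -
  have noU: "\<not> hasU H f" "\<not> hasU (- H) f" using none tow_length_0[of H f] tow_length_0[of "- H" f] by auto
  have nd: "\<not> directed_face E (arcs_of H) (tri f)"
    using directed_face_iff[OF f] noU hasU.hasU_lmin f by blast
  have nt: "\<not> (\<exists>T. tower V E (arcs_of H) T \<and> hd T = tri f)"
  proof
    assume "\<exists>T. tower V E (arcs_of H) T \<and> hd T = tri f"
    then obtain T where T: "tower V E (arcs_of H) T" "hd T = tri f" by blast
    from T(1) obtain L where "T = map tri L" "utower H L \<or> utower (- H) L"
      unfolding tower_iff by blast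
    then have L: "utower H L \<or> utower (- H) L" "hd (map tri L) = tri f" using T(2) by auto
    then have "L \<noteq> []" using utower_not_Nil by blast
    then obtain L' where "L = f # L'" using L(2) tri_inj by (cases L) auto
    then show False using L(1) noU by (auto simp: hasU_iff)
  qed
  show ?thesis unfolding tower_move_def if_not_P[OF nd] if_not_P[OF nt] by (rule refl)
qed

text \<open>A face has a tower in at most one direction, so at least one value of the up/down coin
  leaves the state alone and can take the part of the lazy coin.\<close>

lemma lazy_move_eq:
  assumes H: "H \<in> states" and f: "f \<in> Sf"
  shows "bind_pmf (bernoulli_pmf (1 / 2)) (\<lambda>s. if s then return_pmf (arcs_of H) else tower_move V E tp (arcs_of H) (tri f))
    = bind_pmf (pmf_of_set UNIV) (\<lambda>b. map_pmf (\<lambda>u. arcs_of (act (f, b, u) H)) (pmf_of_set {..<ub}))"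
proof -
  \<comment> \<open>In the chain the value \<open>True\<close> means staying, in the random map it
    means up; for an up tower the coin is therefore negated.\<close>
  have half: "bernoulli_pmf (1 / 2) = map_pmf Not (pmf_of_set (UNIV :: bool set))"
  proof -
    have "inj Not" by (rule injI) simp
    moreover have "surj Not" by (rule surjI[of _ Not]) simp
    ultimately show ?thesis
      unfolding bernoulli_pmf_half_conv_pmf_of_set by (subst map_pmf_of_set_inj) simp_all
  qed
  have still: "map_pmf (\<lambda>u. arcs_of (act (f, b, u) H)) (pmf_of_set {..<ub}) = return_pmf (arcs_of H)"
    if "tow (if b then H else - H) f = []" for b
  proof -
    have "act (f, b, u) H = H" for u using that by (cases b) (auto simp: upmove_def)
    then show ?thesis by (simp add: map_pmf_const)
  qed
  have excl: "tow H f = [] \<or> tow (- H) f = []"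
  proof (rule ccontr)
    assume "\<not> ?thesis"
    then have "hasU H f" "hasU (- H) f" using tow_Nil by blast+
    then show False using tow_utower[of H f] tow_utower[of "- H" f] utower_neg_disjoint[of H "tow H f" "tow (- H) f"] by auto
  qed
  consider (up) "tow H f \<noteq> []" "tow (- H) f = []" | (down) "tow (- H) f \<noteq> []" "tow H f = []"
    | (none) "tow H f = []" "tow (- H) f = []" using excl by blast
  then show ?thesis
  proof cases
    case up
    have "(\<lambda>b. map_pmf (\<lambda>u. arcs_of (act (f, b, u) H)) (pmf_of_set {..<ub}))
        = (\<lambda>b. if \<not> b then return_pmf (arcs_of H) else tower_move V E tp (arcs_of H) (tri f))"
      using tower_move_eq[OF H f, of True] still[of False] up by (intro ext) (simp del: act.simps)
    then show ?thesis unfolding half by (simp add: bind_map_pmf del: act.simps)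
  next
    case down
    have "(\<lambda>b. map_pmf (\<lambda>u. arcs_of (act (f, b, u) H)) (pmf_of_set {..<ub}))
        = (\<lambda>b. if b then return_pmf (arcs_of H) else tower_move V E tp (arcs_of H) (tri f))"
      using tower_move_eq[OF H f, of False] still[of True] down by (intro ext) (simp del: act.simps)
    then show ?thesis unfolding bernoulli_pmf_half_conv_pmf_of_set by (simp del: act.simps)
  next
    case none
    have "(\<lambda>b. map_pmf (\<lambda>u. arcs_of (act (f, b, u) H)) (pmf_of_set {..<ub})) = (\<lambda>b. return_pmf (arcs_of H))"
      using still none by (intro ext) (simp del: act.simps)
    then show ?thesis unfolding tower_move_none[OF f none] if_cancel bind_pmf_const by simp
  qed
qed

lemma tower_chain_eq:
  assumes H: "H \<in> states" and ne: "Sf \<noteq> {}"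
  shows "tower_chain V E tp (arcs_of H) = map_pmf (\<lambda>w. arcs_of (act w H)) (pmf_of_set W)"
proof -
  have ub: "{..<ub} \<noteq> {}" using ub_pos by blast
  have "tower_chain V E tp (arcs_of H) = bind_pmf (pmf_of_set (bounded_faces V E)) (\<lambda>F.
      bind_pmf (bernoulli_pmf (1 / 2)) (\<lambda>s. if s then return_pmf (arcs_of H) else tower_move V E tp (arcs_of H) F))"
    unfolding tower_chain_def
    by (subst bind_commute_pmf) (intro bind_pmf_cong refl, simp)
  also have "pmf_of_set (bounded_faces V E) = map_pmf tri (pmf_of_set Sf)"
    unfolding bounded_faces_eq using map_pmf_of_set_inj[OF inj_tri ne finite_Sf] by simp
  also have "bind_pmf (map_pmf tri (pmf_of_set Sf)) (\<lambda>F.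
      bind_pmf (bernoulli_pmf (1 / 2)) (\<lambda>s. if s then return_pmf (arcs_of H) else tower_move V E tp (arcs_of H) F))
    = bind_pmf (pmf_of_set Sf) (\<lambda>f. bind_pmf (pmf_of_set UNIV) (\<lambda>b. map_pmf (\<lambda>u. arcs_of (act (f, b, u) H)) (pmf_of_set {..<ub})))"
    unfolding bind_map_pmf
    by (intro bind_pmf_cong refl lazy_move_eq[OF H]) (use ne finite_Sf in simp)
  also have "\<dots> = map_pmf (\<lambda>w. arcs_of (act w H)) (pmf_of_set W)"
    unfolding W_def using ne finite_Sf ub
    by (simp add: pmf_of_set_Times map_bind_pmf map_pmf_comp bind_map_pmf comp_def del: act.simps)
  finally show ?thesis .
qed

text \<open>The second part is carried through the induction because \<open>tower_chain_eq\<close>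
  applies to states only.\<close>

lemma steps_eq:
  assumes "H \<in> states" "Sf \<noteq> {}"
  shows "steps (tower_chain V E tp) t (arcs_of H)
      = map_pmf arcs_of (steps (\<lambda>H. map_pmf (\<lambda>w. act w H) (pmf_of_set W)) t H)
    \<and> set_pmf (steps (\<lambda>H. map_pmf (\<lambda>w. act w H) (pmf_of_set W)) t H) \<subseteq> states"
proof (induction t)
  case 0
  then show ?case using assms by simp
next
  case (Suc t)
  let ?K = "\<lambda>H. map_pmf (\<lambda>w. act w H) (pmf_of_set W)"
  have sub: "set_pmf (steps ?K t H) \<subseteq> states" using Suc by blast
  have "steps (tower_chain V E tp) (Suc t) (arcs_of H)
      = bind_pmf (steps ?K t H) (\<lambda>G. tower_chain V E tp (arcs_of G))"
    using Suc by (simp add: bind_map_pmf)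
  also have "\<dots> = bind_pmf (steps ?K t H) (\<lambda>G. map_pmf arcs_of (?K G))"
    by (intro bind_pmf_cong refl) (use sub tower_chain_eq[OF _ assms(2)] in \<open>auto simp: map_pmf_comp\<close>)
  also have "\<dots> = map_pmf arcs_of (steps ?K (Suc t) H)" by (simp add: map_bind_pmf)
  finally show ?case using sub act_states by (auto simp: set_bind_pmf)
qed

lemma mixing_time_le:
  assumes "0 < \<epsilon>" "\<epsilon> < 1"
  shows "ereal_of_enat (mixing_time (EO V E) (tower_chain V E tp) (pmf_of_set (EO V E)) \<epsilon>)
    \<le> ereal (600 * real (card (bounded_faces V E)) ^ 4 * real_of_int \<lceil>ln (1 / \<epsilon>)\<rceil>)"
proof -
  have ln_pos: "0 < ln (1 / \<epsilon>)" using assms by (simp add: ln_div)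
  define k where "k = nat \<lceil>ln (1 / \<epsilon>)\<rceil>"
  have k: "real k = real_of_int \<lceil>ln (1 / \<epsilon>)\<rceil>" using ln_pos by (simp add: k_def)
  have card: "card (bounded_faces V E) = card Sf"
    unfolding bounded_faces_eq by (rule card_image[OF inj_tri])
  let ?t = "k * (600 * card Sf ^ 4)"
  have "mixing_time (EO V E) (tower_chain V E tp) (pmf_of_set (EO V E)) \<epsilon> \<le> enat ?t"
    unfolding mixing_time_def
  proof (rule SUP_least)
    fix X assume X: "X \<in> EO V E"
    then have ne: "EO V E \<noteq> {}" by blast
    obtain H where H: "H \<in> states" "X = arcs_of H" using EO_height[OF X] by metis
    have st: "states \<noteq> {}" using H by blast
    have pi: "pmf_of_set (EO V E) = map_pmf arcs_of (pmf_of_set states)"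
      using map_pmf_of_set_inj[of arcs_of states] bij_arcs_of[OF ne] finite_states[OF ne] st
      by (simp add: bij_betw_def)
    have "exp (- 1) ^ k \<le> \<epsilon>"
    proof -
      have "exp (- 1) ^ k = exp (- real k)" by (simp add: exp_of_nat_mult[symmetric])
      also have "\<dots> \<le> exp (- ln (1 / \<epsilon>))" unfolding k by simp
      also have "\<dots> = \<epsilon>" using assms by (simp add: ln_div)
      finally show ?thesis .
    qed
    then have "tv_dist (steps (tower_chain V E tp) ?t X) (pmf_of_set (EO V E)) \<le> \<epsilon>"
      unfolding H(2) pi conjunct1[OF steps_eq[OF H(1) Sf_nonempty[OF ne]]]
      by (intro tv_dist_map_le order_trans[OF height_chain_mixing[OF Sf_nonempty[OF ne] finite_states[OF ne] H(1)]])
    then show "(INF t\<in>{t. tv_dist (steps (tower_chain V E tp) t X) (pmf_of_set (EO V E)) \<le> \<epsilon>}. enat t) \<le> enat ?t"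
      by (intro INF_lower) simp
  qed
  then have "ereal_of_enat (mixing_time (EO V E) (tower_chain V E tp) (pmf_of_set (EO V E)) \<epsilon>)
      \<le> ereal_of_enat (enat ?t)" by (simp only: ereal_of_enat_le_iff)
  also have "\<dots> = ereal (600 * real (card (bounded_faces V E)) ^ 4 * real_of_int \<lceil>ln (1 / \<epsilon>)\<rceil>)"
    by (simp add: card k[symmetric] mult_ac)
  finally show ?thesis .
qed

end

text \<open>The logarithm is rounded up because at least one step is needed as soon as
  \<open>\<epsilon>\<close> is below 1 - 1/N, where N is the number of orientations; just below this
  value, ln (1/\<epsilon>) is about 1/N, which may be exponentially small in the number of
  faces.\<close>

theorem theorem5:
  shows "\<exists>c::real. c > 0 \<and>
    (\<forall>V E. solid_subgraph V E \<and> eulerian V E \<longrightarrow>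
      (\<forall>\<epsilon>::real. 0 < \<epsilon> \<and> \<epsilon> < 1 \<longrightarrow>
        ereal_of_enat
          (mixing_time (EO V E) (tower_chain V E (\<lambda>T. 1 / (3 * real (length T))))
             (pmf_of_set (EO V E)) \<epsilon>)
        \<le> ereal (c * real (card (bounded_faces V E)) ^ 4 * real_of_int \<lceil>ln (1 / \<epsilon>)\<rceil>)))"
proof (intro exI[of _ 600] conjI allI impI)
  fix V E and \<epsilon> :: real
  assume VE: "solid_subgraph V E \<and> eulerian V E" and \<epsilon>: "0 < \<epsilon> \<and> \<epsilon> < 1"
  then obtain Bd where "solid V E Bd"
    unfolding solid_subgraph_def solid_def by blast
  then interpret solid V E Bd .
  show "ereal_of_enat
          (mixing_time (EO V E) (tower_chain V E (\<lambda>T. 1 / (3 * real (length T))))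
             (pmf_of_set (EO V E)) \<epsilon>)
        \<le> ereal (600 * real (card (bounded_faces V E)) ^ 4 * real_of_int \<lceil>ln (1 / \<epsilon>)\<rceil>)"
    using mixing_time_le \<epsilon> by blast
qed simp

end
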